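(* Let $\alpha>2$ and $\rho,r_{\mathrm{tr}},\beta>0$. Consider spatial multiplexing with ZF (zero forcing) receivers, with $N$ antennas per node and $M$ data streams per transmitter, and let $\mathrm{c}_{\mathrm{ZF}}(\epsilon)$ be its transmission capacity at outage level $\epsilon$. Then, as $N\to\infty$ with $M=\kappa N$ where $0<\kappa<1$, the transmission capacity as $\epsilon-H(\beta-\bar\beta_{\mathrm{ZF}})\to 0$ behaves as $$\frac{\mathrm{c}_{\mathrm{ZF}}(\epsilon)}{N}\to\kappa\left(\frac{r_{\mathrm{tr}}^{\alpha}}{\rho}\right)^{2/\alpha}\left(\left(\bar\beta_{\mathrm{ZF}}-\beta\right)^{+}\right)^{2/\alpha}\frac{\left(\epsilon-H(\beta-\bar\beta_{\mathrm{ZF}})\right)^{+}}{\pi r_{\mathrm{tr}}^{2}\beta^{2/\alpha}}+O\left(\left(\left(\epsilon-H(\beta-\bar\beta_{\mathrm{ZF}})\right)^{2}\right)^{+}\right),$$ where $$\bar\beta_{\mathrm{ZF}}=\frac{\rho}{r_{\mathrm{tr}}^{\alpha}}\left(\frac{1}{\kappa}-1\right).$$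
   Context: Model: the SINR of a data stream with ZF receivers is distributed as $$\gamma=\frac{W}{\sum_{\ell}|X_\ell|^{-\alpha}\Psi_{\ell 0}+1},$$ where $W\sim\mathrm{Gamma}\left(N-M+1,\frac{\rho}{Mr_{\mathrm{tr}}^{\alpha}}\right)$ (signal), $\{X_\ell\}$ is a homogeneous Poisson point process on $\mathbb{R}^2$ of intensity $\mu$ (the intensity of active transmitters), and $\Psi_{\ell 0}$ are i.i.d. $\mathrm{Gamma}\left(M,\frac{\rho}{M}\right)$ (interference from other nodes), all mutually independent. $\mathrm{Gamma}(v,\vartheta)$ has shape $v$ and scale $\vartheta$; $\rho$ is the transmit SNR, $r_{\mathrm{tr}}$ the transmitter-receiver distance, $\alpha$ the path loss exponent and $\beta$ the SINR threshold. Let $\mathrm{F}(\beta;\mu)=\Pr(\gamma\le\beta)$. The transmission capacity is $\mathrm{c}_{\mathrm{ZF}}(\epsilon)=M\,\mu(\epsilon)(1-\epsilon)$, where $\mu(\epsilon)$ is the inverse of $\epsilon=\mathrm{F}(\beta;\mu)$ with respect to $\mu$; it is zero if $\epsilon$ falls below $\Pr(W\le\beta)$, since the outage constraint then cannot be met. $(a)^{+}=\max(a,0)$, and $H$ is the Heaviside step function ($H(x)=0$ for $x<0$, $H(x)=1$ for $x>0$). *)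

theory Defs
  imports "HOL-Probability.Probability" "HOL-Library.Landau_Symbols"
begin

(* Gamma distribution of shape v and scale \<theta>. Only integer shapes v \<ge> 1 occur, and for
   these it is the Erlang distribution, whose library density takes v - 1 and the rate. *)
definition gamma_density :: "nat \<Rightarrow> real \<Rightarrow> real \<Rightarrow> real" where
  "gamma_density v \<theta> = erlang_density (v - 1) (1 / \<theta>)"

(* Number of indices l with X l \<omega> \<in> A, possibly infinite. *)
definition point_count :: "(nat \<Rightarrow> 'a \<Rightarrow> 'b) \<Rightarrow> 'b set \<Rightarrow> 'a \<Rightarrow> ennreal" where
  "point_count X A \<omega> = (\<Sum>l. indicator A (X l \<omega>))"

(* A homogeneous Poisson point process of intensity \<mu> > 0 has almost surely infinitely many
   points, so it is given by an enumeration (X l) of its points, in any measurable order.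
   The first two conditions make the process almost surely locally finite.
   The Poisson probabilities are spelled out because the library's poisson_pmf excludes
   the rate 0, which arises for null sets A. *)
definition (in prob_space) poisson_point_process ::
    "real \<Rightarrow> (nat \<Rightarrow> 'a \<Rightarrow> 'b::euclidean_space) \<Rightarrow> bool" where
  "poisson_point_process \<mu> X \<longleftrightarrow>
     (\<forall>l. random_variable borel (X l)) \<and>
     (\<forall>A\<in>sets borel. bounded A \<longrightarrow> (\<forall>k::nat.
        prob {\<omega> \<in> space M. point_count X A \<omega> = of_nat k} =
          (\<mu> * measure lborel A) ^ k / fact k * exp (- (\<mu> * measure lborel A)))) \<and>
     (\<forall>(A :: nat \<Rightarrow> 'b set) n.
        (\<forall>i<n. A i \<in> sets borel \<and> bounded (A i)) \<longrightarrow> disjoint_family_on A {..<n} \<longrightarrow>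
        indep_vars (\<lambda>_. borel) (\<lambda>i. point_count X (A i)) {..<n})"

datatype source = Signal | Points | Fading nat

(* The random quantities in the SINR of one data stream, for N antennas, M streams
   (1 \<le> M \<le> N) and intensity \<mu> of active transmitters. Mutual independence is that of
   the sigma-algebras generated by W, by the whole sequence X, and by each \<Psi> l. *)
locale zf_model = prob_space \<Omega> for \<Omega> :: "'a measure" +
  fixes \<rho> r \<alpha> :: real and N M :: nat and \<mu> :: real
    and W :: "'a \<Rightarrow> real" and X :: "nat \<Rightarrow> 'a \<Rightarrow> real ^ 2" and \<Psi> :: "nat \<Rightarrow> 'a \<Rightarrow> real"
  assumes signal:
      "distributed \<Omega> lborel W (gamma_density (N - M + 1) (\<rho> / (real M * r powr \<alpha>)))"
    and points: "poisson_point_process \<mu> X"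
    and fading: "\<And>l. distributed \<Omega> lborel (\<Psi> l) (gamma_density M (\<rho> / real M))"
    and independent:
      "indep_sets (\<lambda>s. case s of
          Signal \<Rightarrow> sets (vimage_algebra (space \<Omega>) W borel)
        | Points \<Rightarrow> sets (vimage_algebra (space \<Omega>) (\<lambda>\<omega> l. X l \<omega>) (\<Pi>\<^sub>M l\<in>UNIV. borel))
        | Fading l \<Rightarrow> sets (vimage_algebra (space \<Omega>) (\<Psi> l) borel)) UNIV"

(* For \<alpha> > 2 the series converges almost surely in the model above. *)
definition sinr :: "real \<Rightarrow> real \<Rightarrow> (nat \<Rightarrow> 'b::real_normed_vector) \<Rightarrow> (nat \<Rightarrow> real) \<Rightarrow> real" where
  "sinr \<alpha> w x \<psi> = w / ((\<Sum>l. norm (x l) powr (- \<alpha>) * \<psi> l) + 1)"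

definition outage_prob ::
    "'a measure \<Rightarrow> real \<Rightarrow> real \<Rightarrow> ('a \<Rightarrow> real) \<Rightarrow> (nat \<Rightarrow> 'a \<Rightarrow> real ^ 2) \<Rightarrow> (nat \<Rightarrow> 'a \<Rightarrow> real) \<Rightarrow> real"
  where
  "outage_prob \<Omega> \<alpha> \<beta> W X \<Psi> =
     measure \<Omega> {\<omega> \<in> space \<Omega>. sinr \<alpha> (W \<omega>) (\<lambda>l. X l \<omega>) (\<lambda>l. \<Psi> l \<omega>) \<le> \<beta>}"

(* Pr(W \<le> \<beta>), the outage probability without interference. *)
definition zf_outage_floor :: "real \<Rightarrow> real \<Rightarrow> real \<Rightarrow> real \<Rightarrow> nat \<Rightarrow> nat \<Rightarrow> real" where
  "zf_outage_floor \<rho> r \<alpha> \<beta> N M =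
     measure (density lborel (gamma_density (N - M + 1) (\<rho> / (real M * r powr \<alpha>)))) {..\<beta>}"

(* M \<mu>(\<epsilon>) (1 - \<epsilon>), where \<mu>(\<epsilon>) inverts the outage probability F as a function of \<mu> > 0, and
   p = Pr(W \<le> \<beta>). At \<epsilon> = p the constraint is met only without interferers (\<mu> = 0), so
   the capacity is 0 there as well. *)
definition transmission_capacity :: "nat \<Rightarrow> real \<Rightarrow> (real \<Rightarrow> real) \<Rightarrow> real \<Rightarrow> real" where
  "transmission_capacity M p F \<epsilon> =
     (if \<epsilon> \<le> p then 0 else real M * the_inv_into {0<..} F \<epsilon> * (1 - \<epsilon>))"

definition beta_bar_zf :: "real \<Rightarrow> real \<Rightarrow> real \<Rightarrow> real \<Rightarrow> real" where
  "beta_bar_zf \<rho> r \<alpha> \<kappa> = \<rho> / r powr \<alpha> * (1 / \<kappa> - 1)"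

end

theory Submission
  imports Defs "HOL-Real_Asymp.Real_Asymp"
begin

text \<open>
  The Laplace functional of the Poisson process shows that the interference \<open>I\<close> has Laplace transform
  \<open>exp (- \<mu> * C * s powr \<delta>)\<close> with \<open>\<delta> = 2 / \<alpha>\<close>, so it is distributed as
  \<open>(\<mu> * C) powr (1 / \<delta>) * J\<close> for one fixed positive stable variable \<open>J\<close> with Laplace transform
  \<open>exp (- s powr \<delta>)\<close>. All dependence on \<open>N\<close> then sits in \<open>C\<close>, which converges, and in the signal, which
  concentrates at \<open>beta_bar_zf\<close> by Chebyshev's inequality. In the limit, outage is the event that
  \<open>(\<mu> * C) powr (1 / \<delta>) * J\<close> exceeds \<open>beta_bar_zf / \<beta> - 1\<close>, so the limiting capacity is governed by the
  tail of \<open>J\<close>. Its asymptotics \<open>P (J > x) = x powr (- \<delta>) / Gamma (1 - \<delta>) + O(x powr (- 2 * \<delta>))\<close> follow from the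
  identity \<open>E (J * g J) = \<delta> / Gamma (1 - \<delta>) * (\<integral>u>0. E (g (J + u)) * u powr (- \<delta>))\<close>, which is the derivative
  of the Laplace transform in disguise; it also shows that \<open>J\<close> has no atoms and charges every interval.
\<close>

section \<open>Uniqueness of Laplace transforms\<close>

text \<open>The stable law is never constructed. Only its Laplace transform is used, so uniqueness
  identifies any two realisations, and one is read off from the model itself at a single antenna
  number and intensity 1. The same uniqueness handles the fact that each pair of antenna number and
  intensity has its own probability space. No explicit density enters, so tail, atoms and support
  all have to come from the transform. The last two are what inverting the outage requires: without
  atoms the limit of the conditional outage is an indicator almost surely, and a strictly decreasing
  tail makes the limiting equation for the intensity uniquely solvable, so that pointwise
  convergence of monotone curves passes to their inverses. The exponent 2 / \<alpha> is the scaling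
  of area in the plane, and the \<open>Gamma (1 - \<delta>)\<close> of the tail cancels the one in
  the limit of \<open>C\<close>. Antennas go to infinity at fixed \<epsilon>; the expansion concerns
  the limit function. Once \<beta> reaches \<open>beta_bar_zf\<close>, that function is identically
  0 on (0, 1), so only the other case needs asymptotics.\<close>

lemma real_distribution_eq_of_moments:
  fixes M1 M2 :: "real measure"
  assumes "real_distribution M1" "real_distribution M2"
    and ae1: "AE x in M1. \<bar>x\<bar> \<le> 1" and ae2: "AE x in M2. \<bar>x\<bar> \<le> 1"
    and moments: "\<And>n. (\<integral>x. x ^ n \<partial>M1) = (\<integral>x. x ^ n \<partial>M2)"
  shows "M1 = M2"
proof -
  \<comment> \<open>Support in [-1, 1] bounds every moment by 1 in absolute value, so the
    exponential series is dominated by the one for \<open>\<bar>t\<bar>\<close> and may be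
    integrated term by term. The moments then determine the characteristic function.\<close>
  have char_eq: "char M t = (\<Sum>n. (\<i> * of_real t) ^ n /\<^sub>R fact n * of_real (\<integral>x. x ^ n \<partial>M))"
    if M: "real_distribution M" and ae: "AE x in M. \<bar>x\<bar> \<le> 1" for M t
  proof -
    interpret real_distribution M by (rule M)
    let ?f = "\<lambda>n x. (\<i> * of_real t) ^ n /\<^sub>R fact n * of_real (x ^ n) :: complex"
    have int_pow: "integrable M (\<lambda>x. x ^ n)" for n
      by (rule integrable_const_bound[where B=1])
        (use ae in \<open>auto elim!: eventually_mono simp: power_abs intro: power_le_one\<close>)
    have int: "integrable M (?f n)" for n
      by (intro integrable_mult_right integrable_of_real int_pow)
    have sm: "summable (\<lambda>n. \<bar>t\<bar> ^ n /\<^sub>R fact n)"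
      using summable_exp_generic[of "\<bar>t\<bar>"] by simp
    have bnd: "norm (?f n x) \<le> \<bar>t\<bar> ^ n /\<^sub>R fact n" if "\<bar>x\<bar> \<le> 1" for n x
    proof -
      have "\<bar>x\<bar> ^ n \<le> 1" using that by (intro power_le_one) auto
      then show ?thesis
        by (auto simp: norm_mult norm_power norm_divide power_abs field_simps intro!: mult_left_le)
    qed
    have "char M t = (\<integral>x. (\<Sum>n. ?f n x) \<partial>M)"
    proof (unfold char_def, intro Bochner_Integration.integral_cong refl)
      fix x
      have "(\<lambda>n. (\<i> * of_real (t * x)) ^ n /\<^sub>R fact n) sums exp (\<i> * of_real (t * x))"
        by (rule exp_converges)
      also have "(\<lambda>n. (\<i> * of_real (t * x)) ^ n /\<^sub>R fact n) = (\<lambda>n. ?f n x)"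
        by (auto simp: power_mult_distrib)
      finally show "iexp (t * x) = (\<Sum>n. ?f n x)" by (simp add: sums_iff)
    qed
    also have "\<dots> = (\<Sum>n. \<integral>x. ?f n x \<partial>M)"
    proof (rule integral_suminf[OF int])
      show "AE x in M. summable (\<lambda>n. norm (?f n x))"
        using ae by eventually_elim (rule summable_comparison_test'[OF sm, of 0], use bnd in auto)
      have le: "(\<integral>x. norm (?f n x) \<partial>M) \<le> \<bar>t\<bar> ^ n /\<^sub>R fact n" for n
      proof (rule integral_le_const)
        show "integrable M (\<lambda>x. norm (?f n x))" by (rule integrable_norm[OF int])
        show "AE x in M. norm (?f n x) \<le> \<bar>t\<bar> ^ n /\<^sub>R fact n"
          using ae by eventually_elim (rule bnd)
      qed
      show "summable (\<lambda>n. \<integral>x. norm (?f n x) \<partial>M)"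
        by (rule summable_comparison_test'[OF sm, of 0]) (use le in auto)
    qed
    finally show ?thesis by (simp only: integral_mult_right_zero integral_of_real int_pow)
  qed
  have "char M1 = char M2"
    using char_eq[OF assms(1) ae1] char_eq[OF assms(2) ae2] moments by (intro ext) simp
  then show ?thesis by (intro Levy_uniqueness assms)
qed

text \<open>The map \<open>exp (- x)\<close> carries the half-line into [0, 1] and turns Laplace
  transforms at natural numbers into moments, so the moment criterion applies; \<open>- ln y\<close>
  carries the laws back.\<close>

lemma real_distribution_eq_of_laplace:
  fixes M1 M2 :: "real measure"
  assumes "real_distribution M1" "real_distribution M2"
    and ae1: "AE x in M1. 0 \<le> x" and ae2: "AE x in M2. 0 \<le> x"
    and laplace: "\<And>n::nat. (\<integral>\<^sup>+x. ennreal (exp (- (real n * x))) \<partial>M1) = (\<integral>\<^sup>+x. ennreal (exp (- (real n * x))) \<partial>M2)"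
  shows "M1 = M2"
proof -
  interpret M1: real_distribution M1 by fact
  interpret M2: real_distribution M2 by fact
  let ?Y = "\<lambda>x::real. exp (- x)"
  have mom: "(\<integral>x. x ^ n \<partial>distr M borel ?Y) = enn2real (\<integral>\<^sup>+x. ennreal (exp (- (real n * x))) \<partial>M)"
    if "real_distribution M" for M n
  proof -
    interpret real_distribution M by fact
    have "(\<integral>x. x ^ n \<partial>distr M borel ?Y) = (\<integral>x. exp (- (real n * x)) \<partial>M)"
      by (subst integral_distr) (auto simp flip: exp_of_nat_mult)
    then show ?thesis by (subst (asm) integral_eq_nn_integral) auto
  qed
  have "distr M1 borel ?Y = distr M2 borel ?Y"
  proof (rule real_distribution_eq_of_moments)
    show "real_distribution (distr M1 borel ?Y)" by (rule M1.real_distribution_distr) auto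
    show "real_distribution (distr M2 borel ?Y)" by (rule M2.real_distribution_distr) auto
    show "AE x in distr M1 borel ?Y. \<bar>x\<bar> \<le> 1" using ae1 by (subst AE_distr_iff) auto
    show "AE x in distr M2 borel ?Y. \<bar>x\<bar> \<le> 1" using ae2 by (subst AE_distr_iff) auto
    show "(\<integral>x. x ^ n \<partial>distr M1 borel ?Y) = (\<integral>x. x ^ n \<partial>distr M2 borel ?Y)" for n
      by (simp add: mom assms laplace)
  qed
  then have "distr (distr M1 borel ?Y) borel (\<lambda>y. - ln y) = distr (distr M2 borel ?Y) borel (\<lambda>y. - ln y)"
    by simp
  moreover have "distr (distr M borel ?Y) borel (\<lambda>y. - ln y) = M" if "real_distribution M" for M
  proof -
    interpret real_distribution M by fact
    have "distr (distr M borel ?Y) borel (\<lambda>y. - ln y) = distr M borel (\<lambda>x. x)"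
      by (subst distr_distr) (auto simp: o_def)
    also have "\<dots> = M" by (rule distr_id2) simp
    finally show ?thesis .
  qed
  ultimately show ?thesis using assms by simp
qed

section \<open>One-sided stable laws\<close>

lemma nn_integral_powr_exp:
  fixes a d :: real
  assumes "a > 0" "d < 1"
  shows "(\<integral>\<^sup>+u. ennreal (u powr (- d) * exp (- (a * u))) * indicator {0<..} u \<partial>lborel)
    = ennreal (Gamma (1 - d) * a powr (d - 1))"
proof -
  let ?f = "\<lambda>u. ennreal (u powr (- d) * exp (- u)) * indicator {0<..} u"
  have "ennreal (Gamma (1 - d)) = (\<integral>\<^sup>+t. ennreal (indicator {0..} t * t powr (1 - d - 1) / exp t) \<partial>lborel)"
    using assms by (intro Gamma_conv_nn_integral_real) auto
  also have "\<dots> = (\<integral>\<^sup>+u. ?f u \<partial>lborel)"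
    by (intro nn_integral_cong) (auto simp: exp_minus field_simps split: split_indicator)
  also have "\<dots> = ennreal a * (\<integral>\<^sup>+u. ?f (a * u) \<partial>lborel)"
    using nn_integral_real_affine[of ?f a 0] assms by simp
  also have "(\<integral>\<^sup>+u. ?f (a * u) \<partial>lborel) =
    (\<integral>\<^sup>+u. ennreal (a powr (- d)) * (ennreal (u powr (- d) * exp (- (a * u))) * indicator {0<..} u) \<partial>lborel)"
    using assms by (intro nn_integral_cong)
      (auto simp: powr_mult zero_less_mult_iff ennreal_mult'[symmetric] mult_ac split: split_indicator)
  also have "\<dots> = ennreal (a powr (- d)) * (\<integral>\<^sup>+u. ennreal (u powr (- d) * exp (- (a * u))) * indicator {0<..} u \<partial>lborel)"
    (is "_ = _ * ?I") by (intro nn_integral_cmult) auto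
  finally have *: "ennreal (Gamma (1 - d)) = ennreal (a powr (1 - d)) * ?I"
    using assms by (simp add: mult.assoc[symmetric] ennreal_mult'[symmetric] powr_diff powr_minus field_simps)
  have "ennreal (Gamma (1 - d) * a powr (d - 1)) = ennreal (a powr (d - 1)) * ennreal (Gamma (1 - d))"
    using assms by (simp add: ennreal_mult'[symmetric] mult.commute)
  also have "\<dots> = ennreal (a powr (d - 1) * a powr (1 - d)) * ?I"
    using assms by (simp add: * mult.assoc[symmetric] ennreal_mult'[symmetric])
  also have "a powr (d - 1) * a powr (1 - d) = 1"
    using assms by (simp add: powr_add[symmetric])
  finally show ?thesis by simp
qed

locale one_sided_stable = real_distribution P for P :: "real measure" +
  fixes \<delta> :: real
  assumes index: "0 < \<delta>" "\<delta> < 1"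
    and nonneg: "AE x in P. 0 \<le> x"
    and laplace: "\<And>s. s > 0 \<Longrightarrow> (\<integral>\<^sup>+x. ennreal (exp (- (s * x))) \<partial>P) = ennreal (exp (- (s powr \<delta>)))"
begin

lemma prob_UNIV [simp]: "prob UNIV = 1"
  using prob_space by simp

lemma laplace_integral:
  assumes "s > 0"
  shows "integrable P (\<lambda>x. exp (- (s * x)))" "(\<integral>x. exp (- (s * x)) \<partial>P) = exp (- (s powr \<delta>))"
proof -
  show "integrable P (\<lambda>x. exp (- (s * x)))"
    by (intro integrableI_nonneg) (use laplace[OF assms] in auto)
  show "(\<integral>x. exp (- (s * x)) \<partial>P) = exp (- (s powr \<delta>))"
    by (subst integral_eq_nn_integral) (use laplace[OF assms] in auto)
qed

text \<open>Chernoff bound: the indicator of \<open>{..b}\<close> lies below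
  \<open>exp (s * (b - x))\<close>. For b = 0 and s tending to infinity it excludes mass at
  0.\<close>

lemma prob_atMost_le: "s > 0 \<Longrightarrow> prob {..b} \<le> exp (s * b - s powr \<delta>)"
proof -
  assume s: "s > 0"
  have "prob {..b} = (\<integral>x. indicator {..b} x \<partial>P)" by simp
  also have "\<dots> \<le> (\<integral>x. exp (s * b) * exp (- (s * x)) \<partial>P)"
  proof (rule integral_mono)
    show "integrable P (\<lambda>x. exp (s * b) * exp (- (s * x)))"
      using laplace_integral[OF s] by simp
    fix x show "indicator {..b} x \<le> exp (s * b) * exp (- (s * x))"
      using s by (auto simp: exp_add[symmetric] split: split_indicator)
  qed (simp add: integrable_indicator_iff less_top[symmetric])
  also have "\<dots> = exp (s * b - s powr \<delta>)"
    unfolding integral_mult_right_zero laplace_integral(2)[OF s] by (simp add: exp_add[symmetric])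
  finally show ?thesis .
qed

lemma pos: "AE x in P. 0 < x"
proof -
  have "((\<lambda>s. exp (- (s powr \<delta>))) \<longlongrightarrow> 0) at_top"
    using index by real_asymp
  moreover have "\<forall>\<^sub>F s in at_top. prob {..0} \<le> exp (- (s powr \<delta>))"
    using eventually_gt_at_top[of 0] by eventually_elim (use prob_atMost_le[of _ 0] in simp)
  ultimately have "prob {..0} \<le> 0"
    by (intro tendsto_lowerbound) auto
  then have "emeasure P {..0} = 0" by (simp add: emeasure_eq_measure measure_nonneg antisym)
  then have "{..0} \<in> null_sets P" by (simp add: null_sets_def)
  from AE_not_in[OF this] show ?thesis by eventually_elim auto
qed

text \<open>A variable bounded below by b has Laplace transform at most
  \<open>exp (- (s * b))\<close>, whereas \<open>s powr \<delta>\<close> grows more slowly than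
  \<open>s * b\<close>.\<close>

lemma prob_lessThan_pos:
  assumes "b > 0" shows "prob {..<b} > 0"
proof (rule ccontr)
  assume "\<not> prob {..<b} > 0"
  then have "emeasure P {..<b} = 0" by (simp add: emeasure_eq_measure not_less measure_nonneg antisym)
  then have "{..<b} \<in> null_sets P" by (simp add: null_sets_def)
  from AE_not_in[OF this] have ae: "AE x in P. b \<le> x" by eventually_elim auto
  have "exp (- (s powr \<delta>)) \<le> exp (- (s * b))" if s: "s > 0" for s
  proof -
    have "(\<integral>x. exp (- (s * x)) \<partial>P) \<le> exp (- (s * b))"
      using ae s by (intro integral_le_const laplace_integral) auto
    then show ?thesis using laplace_integral[OF s] by simp
  qed
  then have "b \<le> s powr (\<delta> - 1)" if "s > 0" for s
    using that by (simp add: powr_diff pos_le_divide_eq mult.commute[of b])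
  then have "\<forall>\<^sub>F s in at_top. b \<le> s powr (\<delta> - 1)"
    by (intro eventually_mono[OF eventually_gt_at_top[of 0]])
  moreover have "((\<lambda>s. s powr (\<delta> - 1)) \<longlongrightarrow> 0) at_top" using index by real_asymp
  ultimately have "b \<le> 0" by (intro tendsto_lowerbound[of _ 0 at_top b]) auto
  then show False using assms by simp
qed

text \<open>Differentiation under the integral sign at s. Difference quotients along the positive
  steps \<open>h n\<close> suffice, because the derivative of the right-hand side is known to exist;
  they are dominated by \<open>x * exp (- (s * x))\<close> since \<open>1 - exp (- (h * x))\<close>
  is at most \<open>h * x\<close>.\<close>

lemma nn_integral_mult_exp:
  assumes s: "s > 0"
  shows "(\<integral>\<^sup>+x. ennreal (x * exp (- (s * x))) \<partial>P) = ennreal (\<delta> * s powr (\<delta> - 1) * exp (- (s powr \<delta>)))"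
proof -
  define h where "h n = inverse (real (Suc n))" for n
  define q where "q n x = (exp (- (s * x)) - exp (- ((s + h n) * x))) / h n" for n x
  have h: "h n > 0" for n by (simp add: h_def)
  have h0: "h \<longlonglongrightarrow> 0" unfolding h_def by (rule LIMSEQ_inverse_real_of_nat)
  have hat: "filterlim h (at 0) sequentially"
    using h0 h by (simp add: filterlim_at order_less_imp_not_eq2)
  have bnd: "x * exp (- (s * x)) \<le> 1 / s" for x
  proof -
    have "s * x \<le> exp (s * x)" using exp_ge_add_one_self[of "s * x"] by linarith
    then show ?thesis using s by (simp add: exp_minus field_simps)
  qed
  have int: "integrable P (\<lambda>x. x * exp (- (s * x)))"
    using nonneg bnd s by (intro integrable_const_bound[where B="1/s"]) auto
  have "(\<lambda>n. \<integral>x. q n x \<partial>P) \<longlonglongrightarrow> (\<integral>x. x * exp (- (s * x)) \<partial>P)"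
  proof (rule integral_dominated_convergence[OF _ _ int])
    show "AE x in P. (\<lambda>n. q n x) \<longlonglongrightarrow> x * exp (- (s * x))"
    proof (rule AE_I2)
      fix x
      have "((\<lambda>t. exp (- (t * x))) has_real_derivative - (x * exp (- (s * x)))) (at s)"
        by (auto intro!: derivative_eq_intros)
      then have "((\<lambda>h. (exp (- ((s + h) * x)) - exp (- (s * x))) / h) \<longlongrightarrow> - (x * exp (- (s * x)))) (at 0)"
        by (simp add: DERIV_def)
      from tendsto_minus[OF filterlim_compose[OF this hat]]
      show "(\<lambda>n. q n x) \<longlonglongrightarrow> x * exp (- (s * x))"
        by (simp add: q_def minus_divide_left)
    qed
    show "AE x in P. norm (q n x) \<le> x * exp (- (s * x))" for n
      using nonneg
    proof eventually_elim
      fix x :: real assume x: "0 \<le> x"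
      have "q n x = exp (- (s * x)) * ((1 - exp (- (h n * x))) / h n)"
        by (simp add: q_def algebra_simps exp_add[symmetric] exp_diff[symmetric] diff_divide_distrib)
      moreover have "(1 - exp (- (h n * x))) / h n \<le> x"
        using h[of n] exp_ge_add_one_self[of "- (h n * x)"] by (simp add: field_simps)
      moreover have "0 \<le> (1 - exp (- (h n * x))) / h n" using h[of n] x by simp
      ultimately have "0 \<le> q n x" "q n x \<le> exp (- (s * x)) * x"
        by (simp_all only: mult_nonneg_nonneg exp_ge_zero mult_left_mono)
      then show "norm (q n x) \<le> x * exp (- (s * x))"
        by (simp add: mult.commute)
    qed
  qed (auto simp: q_def)
  moreover have "(\<integral>x. q n x \<partial>P) = - ((exp (- ((s + h n) powr \<delta>)) - exp (- (s powr \<delta>))) / h n)" for n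
  proof -
    have "s + h n > 0" using s h[of n] by simp
    then show ?thesis unfolding q_def using laplace_integral[OF s] laplace_integral[of "s + h n"]
      by (simp add: minus_divide_left)
  qed
  moreover have "(\<lambda>n. - ((exp (- ((s + h n) powr \<delta>)) - exp (- (s powr \<delta>))) / h n)) \<longlonglongrightarrow>
      - (- (\<delta> * s powr (\<delta> - 1) * exp (- (s powr \<delta>))))"
  proof (intro tendsto_minus filterlim_compose[OF _ hat])
    have "((\<lambda>t. exp (- (t powr \<delta>))) has_real_derivative - (\<delta> * s powr (\<delta> - 1) * exp (- (s powr \<delta>)))) (at s)"
      using s by (auto intro!: derivative_eq_intros simp: powr_diff field_simps)
    then show "((\<lambda>h. (exp (- ((s + h) powr \<delta>)) - exp (- (s powr \<delta>))) / h) \<longlongrightarrow>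
        - (\<delta> * s powr (\<delta> - 1) * exp (- (s powr \<delta>)))) (at 0)"
      by (simp add: DERIV_def)
  qed
  ultimately have "(\<integral>x. x * exp (- (s * x)) \<partial>P) = \<delta> * s powr (\<delta> - 1) * exp (- (s powr \<delta>))"
    using LIMSEQ_unique by fastforce
  then show ?thesis using nonneg
    by (subst nn_integral_eq_integral[OF int]) (auto elim!: eventually_mono)
qed

text \<open>The derivative of the Laplace transform is the product of \<open>exp (- s powr \<delta>)\<close> and the Laplace transform of
  \<open>\<delta> / Gamma (1 - \<delta>) * u powr (- \<delta>) du\<close>. Both sides are tilted by \<open>exp (- x)\<close> to become probability measures.\<close>
lemma size_bias:
  assumes g[measurable]: "g \<in> borel_measurable borel"
  shows "(\<integral>\<^sup>+x. ennreal x * g x \<partial>P) = ennreal (\<delta> / Gamma (1 - \<delta>)) *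
    (\<integral>\<^sup>+x. (\<integral>\<^sup>+u. g (x + u) * (ennreal (u powr (- \<delta>)) * indicator {0<..} u) \<partial>lborel) \<partial>P)"
proof -
  have Gpos: "Gamma (1 - \<delta>) > 0" using index by (intro Gamma_real_pos) simp
  \<comment> \<open>\<open>w\<close> is the Gamma density of shape \<open>1 - \<delta>\<close> and
    scale 1. The constants in \<open>T\<close> and \<open>D1\<close> normalise the tilted measures,
    as the transform and its derivative at s = 1 give \<open>exp (- 1)\<close> and
    \<open>\<delta> * exp (- 1)\<close>. \<open>D2\<close> is the law of the sum of independent
    draws from \<open>T\<close> and \<open>U\<close>.\<close>
  define w where "w u = ennreal (u powr (- \<delta>) * exp (- u) / Gamma (1 - \<delta>)) * indicator {0<..} u" for u
  define D1 where "D1 = density P (\<lambda>x. ennreal (x * exp (1 - x) / \<delta>))"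
  define T where "T = density P (\<lambda>x. ennreal (exp (1 - x)))"
  define U where "U = density lborel w"
  define D2 where "D2 = distr (T \<Otimes>\<^sub>M U) borel (\<lambda>(x, u). x + u)"
  have [measurable]: "w \<in> borel_measurable borel" unfolding w_def by measurable
  have int_D1: "(\<integral>\<^sup>+x. f x \<partial>D1) = (\<integral>\<^sup>+x. ennreal (x * exp (1 - x) / \<delta>) * f x \<partial>P)"
    if [measurable]: "f \<in> borel_measurable borel" for f
    unfolding D1_def by (subst nn_integral_density) auto
  have int_T: "(\<integral>\<^sup>+x. f x \<partial>T) = (\<integral>\<^sup>+x. ennreal (exp (1 - x)) * f x \<partial>P)"
    if [measurable]: "f \<in> borel_measurable borel" for f
    unfolding T_def by (subst nn_integral_density) auto
  have int_U: "(\<integral>\<^sup>+u. f u \<partial>U) = (\<integral>\<^sup>+u. w u * f u \<partial>lborel)"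
    if [measurable]: "f \<in> borel_measurable borel" for f
    unfolding U_def by (subst nn_integral_density) auto
  have [measurable_cong]: "sets T = sets borel" "sets U = sets borel" by (simp_all add: T_def U_def)
  have spT: "space T = UNIV" "space U = UNIV" by (simp_all add: T_def U_def)
  have lT: "(\<integral>\<^sup>+x. ennreal (exp (- (s * x))) \<partial>T) = ennreal (exp (1 - (s + 1) powr \<delta>))" if "s \<ge> 0" for s
  proof -
    have "(\<integral>\<^sup>+x. ennreal (exp (- (s * x))) \<partial>T) = (\<integral>\<^sup>+x. ennreal (exp 1) * ennreal (exp (- ((s + 1) * x))) \<partial>P)"
      by (subst int_T) (auto intro!: nn_integral_cong simp: ennreal_mult'[symmetric] exp_add[symmetric] algebra_simps)
    also have "\<dots> = ennreal (exp 1) * ennreal (exp (- ((s + 1) powr \<delta>)))"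
      using that by (subst nn_integral_cmult) (auto simp: laplace)
    finally show ?thesis by (simp add: ennreal_mult'[symmetric] exp_add[symmetric])
  qed
  have lU: "(\<integral>\<^sup>+u. ennreal (exp (- (s * u))) \<partial>U) = ennreal ((s + 1) powr (\<delta> - 1))" if "s \<ge> 0" for s
  proof -
    have "(\<integral>\<^sup>+u. ennreal (exp (- (s * u))) \<partial>U) =
      (\<integral>\<^sup>+u. ennreal (1 / Gamma (1 - \<delta>)) * (ennreal (u powr (- \<delta>) * exp (- ((s + 1) * u))) * indicator {0<..} u) \<partial>lborel)"
      by (subst int_U) (use Gpos in \<open>auto intro!: nn_integral_cong simp: w_def ennreal_mult'[symmetric]
          exp_add[symmetric] exp_diff exp_minus field_simps split: split_indicator\<close>)
    also have "\<dots> = ennreal (1 / Gamma (1 - \<delta>)) * ennreal (Gamma (1 - \<delta>) * (s + 1) powr (\<delta> - 1))"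
      using that index by (subst nn_integral_cmult) (auto simp: nn_integral_powr_exp)
    finally show ?thesis using Gpos by (simp add: ennreal_mult'[symmetric])
  qed
  have "prob_space T"
    by (rule prob_spaceI) (use lT[of 0] in \<open>simp add: spT\<close>)
  interpret T: prob_space T by fact
  have "prob_space U"
    by (rule prob_spaceI) (use lU[of 0] in \<open>simp add: spT\<close>)
  interpret U: prob_space U by fact
  interpret TU: pair_prob_space T U ..
  have int_D2: "(\<integral>\<^sup>+x. f x \<partial>D2) = (\<integral>\<^sup>+x. (\<integral>\<^sup>+u. f (x + u) \<partial>U) \<partial>T)"
    if [measurable]: "f \<in> borel_measurable borel" for f
    unfolding D2_def by (subst nn_integral_distr) (auto simp: U.nn_integral_fst[symmetric])
  have "D1 = D2"
  proof (rule real_distribution_eq_of_laplace)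
    have l1: "(\<integral>\<^sup>+x. ennreal (exp (- (s * x))) \<partial>D1) = ennreal ((s + 1) powr (\<delta> - 1) * exp (1 - (s + 1) powr \<delta>))"
      if "s \<ge> 0" for s
    proof -
      have "(\<integral>\<^sup>+x. ennreal (exp (- (s * x))) \<partial>D1) =
        (\<integral>\<^sup>+x. ennreal (exp 1 / \<delta>) * ennreal (x * exp (- ((s + 1) * x))) \<partial>P)"
      proof (subst int_D1, simp, intro nn_integral_cong)
        fix x
        have "exp (1 - x) * exp (- (s * x)) = exp 1 * exp (- ((s + 1) * x))"
          by (simp add: exp_add[symmetric] algebra_simps)
        then have "x * exp (1 - x) / \<delta> * exp (- (s * x)) = exp 1 / \<delta> * (x * exp (- ((s + 1) * x)))"
          by (simp add: mult_ac)
        then have "ennreal (x * exp (1 - x) / \<delta> * exp (- (s * x))) = ennreal (exp 1 / \<delta> * (x * exp (- ((s + 1) * x))))"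
          by (rule arg_cong)
        then show "ennreal (x * exp (1 - x) / \<delta>) * ennreal (exp (- (s * x))) =
            ennreal (exp 1 / \<delta>) * ennreal (x * exp (- ((s + 1) * x)))"
          using index by (simp only: ennreal_mult''[OF exp_ge_zero] ennreal_mult'[OF divide_nonneg_pos[OF exp_ge_zero]])
      qed
      also have "\<dots> = ennreal (exp 1 / \<delta>) * ennreal (\<delta> * (s + 1) powr (\<delta> - 1) * exp (- ((s + 1) powr \<delta>)))"
        using that by (subst nn_integral_cmult) (auto simp: nn_integral_mult_exp)
      finally show ?thesis using index by (simp add: ennreal_mult'[symmetric] exp_diff exp_minus field_simps)
    qed
    have spD: "space D1 = UNIV" "space D2 = UNIV" by (simp_all add: D1_def D2_def)
    have "prob_space D1" by (rule prob_spaceI) (use l1[of 0] in \<open>simp add: spD\<close>)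
    then show "real_distribution D1"
      by (simp add: real_distribution_def real_distribution_axioms_def D1_def)
    show "real_distribution D2" unfolding D2_def
      by (rule TU.real_distribution_distr) measurable
    show "AE x in D1. 0 \<le> x" unfolding D1_def
      by (subst AE_density) (use nonneg in auto)
    have aeT: "AE x in T. 0 \<le> x" unfolding T_def by (subst AE_density) (use nonneg in auto)
    have aeU: "AE u in U. 0 \<le> u" unfolding U_def by (subst AE_density) (auto simp: w_def split: split_indicator)
    have "AE z in T \<Otimes>\<^sub>M U. 0 \<le> fst z + snd z"
    proof (rule TU.AE_pair_measure)
      show "AE x in T. AE y in U. 0 \<le> fst (x, y) + snd (x, y)"
        using aeT by eventually_elim (use aeU in auto)
    qed measurable
    then show "AE x in D2. 0 \<le> x" unfolding D2_def by (subst AE_distr_iff) (auto simp: case_prod_beta)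
    show "(\<integral>\<^sup>+x. ennreal (exp (- (real n * x))) \<partial>D1) = (\<integral>\<^sup>+x. ennreal (exp (- (real n * x))) \<partial>D2)" for n
    proof -
      have "(\<integral>\<^sup>+x. ennreal (exp (- (real n * x))) \<partial>D2) =
         (\<integral>\<^sup>+x. ennreal (exp (- (real n * x))) * (\<integral>\<^sup>+u. ennreal (exp (- (real n * u))) \<partial>U) \<partial>T)"
        by (subst int_D2) (auto intro!: nn_integral_cong simp: nn_integral_cmult[symmetric] ennreal_mult'[symmetric] exp_add[symmetric] algebra_simps)
      also have "\<dots> = ennreal ((real n + 1) powr (\<delta> - 1) * exp (1 - (real n + 1) powr \<delta>))"
        unfolding lU[OF of_nat_0_le_iff]
        by (subst nn_integral_multc) (simp_all add: lT[OF of_nat_0_le_iff] ennreal_mult'[symmetric] mult.commute[of "exp _"])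
      finally show ?thesis using l1[of "real n"] by simp
    qed
  qed
  \<comment> \<open>The tilt is now undone: \<open>\<delta> * exp (x - 1)\<close> is the reciprocal
    of the tilting factor in \<open>D1\<close>, and evaluated at \<open>x + u\<close> it cancels the
    exponentials of both \<open>T\<close> and \<open>U\<close>, so that only the power of u
    survives.\<close>
  have "x * exp (1 - x) / \<delta> * (\<delta> * exp (x - 1)) = x" for x
    using index by (simp add: exp_add[symmetric])
  then have "(\<integral>\<^sup>+x. ennreal x * g x \<partial>P) = (\<integral>\<^sup>+x. ennreal (\<delta> * exp (x - 1)) * g x \<partial>D1)"
    using index by (subst int_D1) (auto simp: mult.assoc[symmetric] ennreal_mult''[symmetric] simp del: times_divide_eq_left)
  also have "\<dots> = (\<integral>\<^sup>+x. (\<integral>\<^sup>+u. ennreal (\<delta> * exp (x + u - 1)) * g (x + u) \<partial>U) \<partial>T)"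
    unfolding \<open>D1 = D2\<close> by (subst int_D2) auto
  also have "\<dots> = (\<integral>\<^sup>+x. (\<integral>\<^sup>+u. ennreal (exp (1 - x)) * (w u * (ennreal (\<delta> * exp (x + u - 1)) * g (x + u))) \<partial>lborel) \<partial>P)"
    by (subst int_T) (auto simp: int_U nn_integral_cmult)
  also have "\<dots> = (\<integral>\<^sup>+x. (\<integral>\<^sup>+u. ennreal (\<delta> / Gamma (1 - \<delta>)) * (g (x + u) * (ennreal (u powr (- \<delta>)) * indicator {0<..} u)) \<partial>lborel) \<partial>P)"
  proof (intro nn_integral_cong)
    fix x u :: real
    have "ennreal (exp (1 - x)) * (w u * (ennreal (\<delta> * exp (x + u - 1)) * g (x + u))) =
      (ennreal (exp (1 - x)) * w u * ennreal (\<delta> * exp (x + u - 1))) * g (x + u)"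
      by (simp add: mult_ac)
    also have "ennreal (exp (1 - x)) * w u * ennreal (\<delta> * exp (x + u - 1)) =
      ennreal (exp (1 - x) * (u powr (- \<delta>) * exp (- u) / Gamma (1 - \<delta>)) * (\<delta> * exp (x + u - 1))) * indicator {0<..} u"
      using index Gpos by (auto simp: w_def ennreal_mult'[symmetric] split: split_indicator)
    also have "exp (1 - x) * (u powr (- \<delta>) * exp (- u) / Gamma (1 - \<delta>)) * (\<delta> * exp (x + u - 1)) =
       \<delta> / Gamma (1 - \<delta>) * u powr (- \<delta>)"
      by (simp add: exp_diff exp_minus exp_add field_simps)
    also have "ennreal (\<delta> / Gamma (1 - \<delta>) * u powr (- \<delta>)) = ennreal (\<delta> / Gamma (1 - \<delta>)) * ennreal (u powr (- \<delta>))"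
      using index Gpos by (intro ennreal_mult') simp
    finally show "ennreal (exp (1 - x)) * (w u * (ennreal (\<delta> * exp (x + u - 1)) * g (x + u))) =
      ennreal (\<delta> / Gamma (1 - \<delta>)) * (g (x + u) * (ennreal (u powr (- \<delta>)) * indicator {0<..} u))"
      by (simp only: mult_ac)
  qed
  also have "\<dots> = ennreal (\<delta> / Gamma (1 - \<delta>)) *
    (\<integral>\<^sup>+x. (\<integral>\<^sup>+u. g (x + u) * (ennreal (u powr (- \<delta>)) * indicator {0<..} u) \<partial>lborel) \<partial>P)"
    by (simp add: nn_integral_cmult)
  finally show ?thesis .
qed

end

section \<open>Atoms, support and tail of the stable law\<close>

lemma nn_integral_powr_Ioi:
  fixes d x :: real
  assumes "d > 0" "x > 0"
  shows "(\<integral>\<^sup>+u. ennreal (u powr (- d - 1)) * indicator {x..} u \<partial>lborel) = ennreal (x powr (- d) / d)"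
proof -
  have "(\<integral>\<^sup>+u. ennreal (u powr (- d - 1)) * indicator {x..} u \<partial>lborel) = ennreal (0 - (- (x powr (- d) / d)))"
  proof (rule nn_integral_FTC_atLeast)
    show "((\<lambda>u. - (u powr (- d) / d)) has_real_derivative u powr (- d - 1)) (at u)" if "x \<le> u" for u
      using assms that by (auto intro!: derivative_eq_intros simp: powr_diff)
    show "((\<lambda>u. - (u powr (- d) / d)) \<longlongrightarrow> 0) at_top"
      using assms by real_asymp
  qed simp_all
  then show ?thesis by simp
qed

lemma nn_integral_powr_Icc:
  fixes p a b :: real
  assumes "p > 0" "0 \<le> a" "a \<le> b"
  shows "(\<integral>\<^sup>+u. ennreal (u powr (p - 1)) * indicator {a..b} u \<partial>lborel) = ennreal ((b powr p - a powr p) / p)"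
proof -
  \<comment> \<open>For p < 1 and a = 0 the integrand is unbounded at the left end, so
    differentiability is required only in the interior and continuity of the antiderivative covers
    the endpoints.\<close>
  have *: "((\<lambda>u. u powr (p - 1)) has_integral (b powr p / p - a powr p / p)) {a..b}"
  proof (rule fundamental_theorem_of_calculus_interior)
    show "continuous_on {a..b} (\<lambda>u. u powr p / p)"
      using assms by (intro continuous_on_divide continuous_on_powr' continuous_on_id continuous_on_const) auto
    fix u assume u: "u \<in> {a<..<b}"
    then have "((\<lambda>u. u powr p / p) has_real_derivative u powr (p - 1)) (at u)"
      using assms by (auto intro!: derivative_eq_intros simp: powr_diff)
    then show "((\<lambda>u. u powr p / p) has_vector_derivative u powr (p - 1)) (at u)"
      by (simp add: has_real_derivative_iff_has_vector_derivative)
  qed (use assms in auto)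
  have "(\<integral>\<^sup>+u. ennreal (indicator {a..b} u * u powr (p - 1)) \<partial>lborel) = ennreal (b powr p / p - a powr p / p)"
    by (rule nn_integral_has_integral_lebesgue[OF _ *]) auto
  moreover have "(\<integral>\<^sup>+u. ennreal (u powr (p - 1)) * indicator {a..b} u \<partial>lborel) =
    (\<integral>\<^sup>+u. ennreal (indicator {a..b} u * u powr (p - 1)) \<partial>lborel)"
    by (intro nn_integral_cong) (auto split: split_indicator)
  ultimately show ?thesis by (simp add: diff_divide_distrib)
qed

context one_sided_stable
begin

text \<open>This is the inner integral of the size-bias identity for the test function that equals 1
  / z on A and 0 elsewhere, given the value x of the stable variable.\<close>

definition jump_kernel :: "real set \<Rightarrow> real \<Rightarrow> ennreal" where
  "jump_kernel A x = (\<integral>\<^sup>+u. indicator A (x + u) * ennreal (u powr (- \<delta>) / (x + u)) * indicator {0<..} u \<partial>lborel)"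

lemma borel_measurable_jump_kernel[measurable]:
  assumes [measurable]: "A \<in> sets borel"
  shows "jump_kernel A \<in> borel_measurable borel"
  unfolding jump_kernel_def by measurable

lemma Gamma_pos: "Gamma (1 - \<delta>) > 0"
  using index by (intro Gamma_real_pos) simp

text \<open>Dividing by z in the size-bias identity, legitimate on the positive half-line, writes P
  there as an average of measures with explicit densities. Atoms, support and tail are all read off
  from these densities.\<close>

lemma emeasure_eq_jump_kernel:
  assumes [measurable]: "A \<in> sets borel" and A: "A \<subseteq> {0<..}"
  shows "emeasure P A = ennreal (\<delta> / Gamma (1 - \<delta>)) * (\<integral>\<^sup>+x. jump_kernel A x \<partial>P)"
proof -
  have "emeasure P A = (\<integral>\<^sup>+x. indicator A x \<partial>P)" by simp
  also have "\<dots> = (\<integral>\<^sup>+x. ennreal x * (indicator A x * ennreal (1 / x)) \<partial>P)"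
    using A by (intro nn_integral_cong) (auto simp: ennreal_mult'[symmetric] split: split_indicator)
  also have "\<dots> = ennreal (\<delta> / Gamma (1 - \<delta>)) *
    (\<integral>\<^sup>+x. (\<integral>\<^sup>+u. indicator A (x + u) * ennreal (1 / (x + u)) * (ennreal (u powr (- \<delta>)) * indicator {0<..} u) \<partial>lborel) \<partial>P)"
    by (subst size_bias) auto
  also have "(\<integral>\<^sup>+x. (\<integral>\<^sup>+u. indicator A (x + u) * ennreal (1 / (x + u)) * (ennreal (u powr (- \<delta>)) * indicator {0<..} u) \<partial>lborel) \<partial>P)
     = (\<integral>\<^sup>+x. jump_kernel A x \<partial>P)"
    unfolding jump_kernel_def
    by (intro nn_integral_cong) (auto simp: ennreal_mult''[symmetric] split: split_indicator)
  finally show ?thesis .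
qed

text \<open>For positive x the kernel integrates over the single point \<open>u = x - y\<close>; the
  other points carry no mass because the law is positive.\<close>

lemma prob_singleton: "prob {x} = 0"
proof (cases "x > 0")
  case True
  have "jump_kernel {x} y = 0" for y
  proof -
    have "AE u in lborel. u \<noteq> x - y" by (rule AE_lborel_singleton)
    then show ?thesis unfolding jump_kernel_def
      by (subst nn_integral_0_iff_AE) (auto elim!: eventually_mono split: split_indicator)
  qed
  then have "jump_kernel {x} = (\<lambda>_. 0)" by (intro ext)
  then have "emeasure P {x} = 0" using True by (subst emeasure_eq_jump_kernel) auto
  then show ?thesis by (simp add: measure_def)
next
  case False
  have "AE y in P. y \<notin> {x}" using pos by eventually_elim (use False in auto)
  then show ?thesis by (subst prob_eq_0) auto
qed

text \<open>If the interval were null, the kernel would vanish almost surely. But it is positive at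
  every nonnegative starting point below b, since a jump from there into the interval has positive
  weight; so there would be no mass below b.\<close>

lemma prob_Ioc_pos:
  assumes "0 < a" "a < b"
  shows "prob {a<..b} > 0"
proof (rule ccontr)
  assume "\<not> prob {a<..b} > 0"
  then have "emeasure P {a<..b} = 0" by (simp add: emeasure_eq_measure not_less measure_nonneg antisym)
  then have "(\<integral>\<^sup>+x. jump_kernel {a<..b} x \<partial>P) = 0"
    using assms index Gamma_pos by (subst (asm) emeasure_eq_jump_kernel) (auto simp: ennreal_eq_0_iff divide_le_0_iff)
  then have "AE x in P. jump_kernel {a<..b} x = 0"
    by (subst (asm) nn_integral_0_iff_AE) auto
  then have "AE x in P. x \<notin> {..<b}"
    using nonneg
  proof eventually_elim
    fix x assume 0: "jump_kernel {a<..b} x = 0" and x: "0 \<le> x"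
    show "x \<notin> {..<b}"
    proof
      assume "x \<in> {..<b}"
      then have xb: "x < b" by simp
      have "AE u in lborel. indicator {a<..b} (x + u) * ennreal (u powr (- \<delta>) / (x + u)) * indicator {0<..} u = 0"
        using 0 unfolding jump_kernel_def by (subst (asm) nn_integral_0_iff_AE) auto
      then have "AE u in lborel. u \<notin> {max 0 (a - x)<..b - x}"
        by eventually_elim (use x in \<open>auto simp: ennreal_eq_0_iff divide_le_0_iff split: split_indicator_asm\<close>)
      then have "emeasure lborel {max 0 (a - x)<..b - x} = 0"
        by (subst AE_iff_measurable[symmetric, where P="\<lambda>u. u \<notin> {max 0 (a - x)<..b - x}"]) auto
      then show False using xb assms by (auto simp: emeasure_lborel_Ioc)
    qed
  qed
  then have "prob {..<b} = 0" by (subst prob_eq_0) auto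
  then show False using prob_lessThan_pos[of b] assms by simp
qed

text \<open>The mean is infinite, hence the truncation at x. Convexity of exp and
  \<open>exp (- 1) \<le> 1 / 2\<close> bound \<open>min 1 z\<close> by
  \<open>2 * (1 - exp (- z))\<close>, whose expectation is the Laplace transform at
  \<open>s = 1 / x\<close>.\<close>

lemma expectation_min_le:
  assumes "x > 0"
  shows "(\<integral>\<^sup>+y. ennreal (min 1 (y / x)) \<partial>P) \<le> ennreal (2 * x powr (- \<delta>))"
proof -
  have exp1: "exp (- 1) \<le> (1 / 2 :: real)"
    using exp_ge_add_one_self[of "1::real"] by (simp add: exp_minus field_simps)
  have le: "min 1 z \<le> 2 * (1 - exp (- z))" if "z \<ge> 0" for z :: real
  proof (cases "z \<le> 1")
    case True
    have cv: "convex_on UNIV (exp :: real \<Rightarrow> real)"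
      by (rule exp_convex)
    have "exp ((1 - z) *\<^sub>R 0 + z *\<^sub>R (-1)) \<le> (1 - z) * exp 0 + z * exp (- 1 :: real)"
      by (rule convex_onD[OF cv]) (use that True in auto)
    also have "\<dots> \<le> 1 - z / 2" using exp1 that mult_left_mono[OF exp1 that] by simp
    finally show ?thesis using True by simp
  next
    case False
    then have "exp (- z) \<le> exp (- 1)" by simp
    then have "2 * exp (- z) \<le> 1" using exp1 by linarith
    then show ?thesis using False by simp
  qed
  have int: "integrable P (\<lambda>y. 2 * (1 - exp (- (1 / x * y))))"
    using laplace_integral(1)[of "1/x"] assms by (intro integrable_mult_right integrable_diff) auto
  have "(\<integral>\<^sup>+y. ennreal (min 1 (y / x)) \<partial>P) \<le> (\<integral>\<^sup>+y. ennreal (2 * (1 - exp (- (1 / x * y)))) \<partial>P)"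
    by (intro nn_integral_mono_AE eventually_mono[OF nonneg] ennreal_leI) (use le assms in force)
  also have "\<dots> = ennreal (\<integral>y. 2 * (1 - exp (- (1 / x * y))) \<partial>P)"
    by (intro nn_integral_eq_integral int eventually_mono[OF nonneg]) (use assms in auto)
  also have "(\<integral>y. 2 * (1 - exp (- (1 / x * y))) \<partial>P) = 2 * (1 - exp (- ((1 / x) powr \<delta>)))"
    using laplace_integral[of "1/x"] assms by (subst integral_mult_right_zero, subst Bochner_Integration.integral_diff) (auto simp: prob_space)
  also have "\<dots> \<le> 2 * (1 / x) powr \<delta>"
    using exp_ge_add_one_self[of "- ((1 / x) powr \<delta>)"] by simp
  also have "(1 / x) powr \<delta> = x powr (- \<delta>)" using assms by (simp add: powr_divide powr_minus_divide)
  finally show ?thesis by (simp add: ennreal_leI)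
qed

text \<open>At y = 0 the kernel is exactly \<open>x powr (- \<delta>) / \<delta>\<close>, and
  \<open>m\<close> measures the relative perturbation. Above, \<open>y + u\<close> is replaced by u
  for u \<ge> x and by x for smaller jumps, which start at \<open>a = x * (1 - m)\<close>. Below,
  only jumps beyond x are kept, and there \<open>u / (y + u)\<close> is at least
  \<open>1 - m\<close>.\<close>

lemma jump_kernel_Ioi_bounds:
  assumes x: "x > 0" and y: "y \<ge> 0"
  defines "m \<equiv> min 1 (y / x)"
  shows "jump_kernel {x<..} y \<le> ennreal (x powr (- \<delta>) * (1 / \<delta> + m / (1 - \<delta>)))"
    and "ennreal (x powr (- \<delta>) / \<delta> * (1 - m)) \<le> jump_kernel {x<..} y"
proof -
  have m: "0 \<le> m" "m \<le> 1" using x y by (auto simp: m_def)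
  define a where "a = max 0 (x - y)"
  have a: "0 \<le> a" "a \<le> x" using x y by (auto simp: a_def)
  have am: "a = x * (1 - m)" using x y by (auto simp: a_def m_def min_def max_def field_simps)
  have "jump_kernel {x<..} y \<le> (\<integral>\<^sup>+u. ennreal (u powr (- \<delta> - 1)) * indicator {x..} u +
      ennreal (1 / x) * (ennreal (u powr (1 - \<delta> - 1)) * indicator {a..x} u) \<partial>lborel)"
    unfolding jump_kernel_def
  proof (intro nn_integral_mono)
    fix u :: real
    show "indicator {x<..} (y + u) * ennreal (u powr (- \<delta>) / (y + u)) * indicator {0<..} u \<le>
       ennreal (u powr (- \<delta> - 1)) * indicator {x..} u +
      ennreal (1 / x) * (ennreal (u powr (1 - \<delta> - 1)) * indicator {a..x} u)" (is "?l \<le> ?r")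
    proof (cases "0 < u \<and> x < y + u")
      case True
      show ?thesis
      proof (cases "x \<le> u")
        case True
        then have "u powr (- \<delta>) / (y + u) \<le> u powr (- \<delta>) / u"
          using x y by (intro divide_left_mono) auto
        also have "\<dots> = u powr (- \<delta> - 1)" using True x by (simp add: powr_diff)
        finally have "?l \<le> ennreal (u powr (- \<delta> - 1)) * indicator {x..} u"
          using True by (auto simp: ennreal_leI split: split_indicator)
        then show ?thesis by (rule order_trans) simp
      next
        case False
        have "u powr (- \<delta>) / (y + u) \<le> u powr (- \<delta>) / x"
          using x y True by (intro divide_left_mono) auto
        then have "?l \<le> ennreal (1 / x) * (ennreal (u powr (1 - \<delta> - 1)) * indicator {a..x} u)"
          using True False by (auto simp: a_def ennreal_mult'[symmetric] ennreal_leI split: split_indicator)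
        then show ?thesis by (rule order_trans) simp
      qed
    qed (auto split: split_indicator)
  qed
  also have "\<dots> = ennreal (x powr (- \<delta>) / \<delta>) + ennreal (1 / x) * ennreal ((x powr (1 - \<delta>) - a powr (1 - \<delta>)) / (1 - \<delta>))"
    using x a index
    by (subst nn_integral_add, simp, simp, subst nn_integral_cmult, simp,
      subst nn_integral_powr_Ioi, simp, simp, subst nn_integral_powr_Icc) auto
  also have "\<dots> = ennreal (x powr (- \<delta>) / \<delta> + (1 / x) * ((x powr (1 - \<delta>) - a powr (1 - \<delta>)) / (1 - \<delta>)))"
    using x a index by (subst ennreal_mult'[symmetric], simp, subst ennreal_plus)
      (auto intro!: powr_mono2 mult_nonneg_nonneg divide_nonneg_nonneg)
  also have "\<dots> \<le> ennreal (x powr (- \<delta>) * (1 / \<delta> + m / (1 - \<delta>)))"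
  proof (rule ennreal_leI)
    have "1 - m \<le> (1 - m) powr (1 - \<delta>)"
      using powr_mono'[of "1 - \<delta>" 1 "1 - m"] m index by auto
    then have "x powr (1 - \<delta>) - a powr (1 - \<delta>) \<le> x powr (1 - \<delta>) * m"
      using m x mult_left_mono[of "1 - m" "(1 - m) powr (1 - \<delta>)" "x powr (1 - \<delta>)"]
      by (simp add: am powr_mult right_diff_distrib[of "x powr (1 - \<delta>)"])
    then have "(1 / x) * ((x powr (1 - \<delta>) - a powr (1 - \<delta>)) / (1 - \<delta>)) \<le> (1 / x) * ((x powr (1 - \<delta>) * m) / (1 - \<delta>))"
      using x index by (intro mult_left_mono divide_right_mono) auto
    also have "\<dots> = x powr (- \<delta>) * (m / (1 - \<delta>))"
      using x by (simp add: powr_diff powr_minus field_simps)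
    finally show "x powr (- \<delta>) / \<delta> + (1 / x) * ((x powr (1 - \<delta>) - a powr (1 - \<delta>)) / (1 - \<delta>)) \<le>
      x powr (- \<delta>) * (1 / \<delta> + m / (1 - \<delta>))" by (simp add: algebra_simps)
  qed
  finally show "jump_kernel {x<..} y \<le> ennreal (x powr (- \<delta>) * (1 / \<delta> + m / (1 - \<delta>)))" .

  have "ennreal (x powr (- \<delta>) / \<delta> * (1 - m)) = ennreal (1 - m) * ennreal (x powr (- \<delta>) / \<delta>)"
    using m by (simp add: ennreal_mult'[symmetric] mult.commute)
  also have "\<dots> = (\<integral>\<^sup>+u. ennreal (1 - m) * (ennreal (u powr (- \<delta> - 1)) * indicator {x..} u) \<partial>lborel)"
    using x index by (subst nn_integral_cmult) (auto simp: nn_integral_powr_Ioi)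
  also have "\<dots> \<le> jump_kernel {x<..} y"
  proof -
    \<comment> \<open>The point u = x must be left out: for y = 0 the indicator of
      \<open>{x<..}\<close> vanishes there while the left-hand integrand does not.\<close>
    have "AE u in lborel. u \<noteq> x" by (rule AE_lborel_singleton)
    then show ?thesis unfolding jump_kernel_def
    proof (intro nn_integral_mono_AE, eventually_elim)
      fix u assume "u \<noteq> x"
      show "ennreal (1 - m) * (ennreal (u powr (- \<delta> - 1)) * indicator {x..} u) \<le>
        indicator {x<..} (y + u) * ennreal (u powr (- \<delta>) / (y + u)) * indicator {0<..} u"
      proof (cases "x \<le> u")
        case True
        then have u: "x < u" using \<open>u \<noteq> x\<close> by simp
        have "1 - m \<le> u / (y + u)"
        proof -
          have "y / (y + u) \<le> m"
            unfolding m_def using u x y by (auto intro!: divide_left_mono)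
          then show ?thesis using u x y by (simp add: field_simps)
        qed
        then have "(1 - m) * u powr (- \<delta> - 1) \<le> u / (y + u) * u powr (- \<delta> - 1)"
          by (intro mult_right_mono) auto
        also have "\<dots> = u powr (- \<delta>) / (y + u)"
          using u x by (simp add: powr_diff)
        finally show ?thesis
          using u x y m by (auto simp: ennreal_mult'[symmetric] ennreal_leI split: split_indicator)
      qed (auto split: split_indicator)
    qed
  qed
  finally show "ennreal (x powr (- \<delta>) / \<delta> * (1 - m)) \<le> jump_kernel {x<..} y" .
qed

text \<open>Averaging the kernel bounds leaves a relative error of the order of \<open>e\<close>,
  the truncated mean, which is itself at most \<open>2 * q\<close>; hence the error is quadratic in
  q. The upper deviation is at most \<open>c * q * (2 * q) / (1 - \<delta>)\<close>, the lower one
  at most \<open>2 * q\<^sup>2 / Gamma (1 - \<delta>)\<close>, and the stated constant dominates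
  both.\<close>

lemma tail_asymptotics:
  assumes x: "x > 0"
  shows "\<bar>prob {x<..} - x powr (- \<delta>) / Gamma (1 - \<delta>)\<bar> \<le> 2 / (Gamma (1 - \<delta>) * (1 - \<delta>)) * (x powr (- \<delta>))\<^sup>2"
proof -
  define c where "c = \<delta> / Gamma (1 - \<delta>)"
  define q where "q = x powr (- \<delta>)"
  have c: "c > 0" using index Gamma_pos by (simp add: c_def)
  have q: "q > 0" using x by (simp add: q_def)
  define e where "e = (\<integral>y. min 1 (y / x) \<partial>P)"
  have int: "integrable P (\<lambda>y. min 1 (y / x))"
    by (rule integrable_const_bound[where B=1]) (use nonneg x in \<open>auto elim!: eventually_mono\<close>)
  have "ennreal e = (\<integral>\<^sup>+y. ennreal (min 1 (y / x)) \<partial>P)"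
    unfolding e_def using nonneg x by (subst nn_integral_eq_integral[OF int]) (auto elim!: eventually_mono)
  then have "ennreal e \<le> ennreal (2 * q)" using expectation_min_le[OF x] by (simp add: q_def)
  then have e: "e \<le> 2 * q" using q by (subst (asm) ennreal_le_iff) auto
  have e0: "0 \<le> e" unfolding e_def by (rule integral_nonneg_AE) (use nonneg x in \<open>auto elim!: eventually_mono\<close>)
  have em: "emeasure P {x<..} = ennreal c * (\<integral>\<^sup>+y. jump_kernel {x<..} y \<partial>P)"
    unfolding c_def by (rule emeasure_eq_jump_kernel) (use x in auto)
  have "(\<integral>\<^sup>+y. jump_kernel {x<..} y \<partial>P) \<le> (\<integral>\<^sup>+y. ennreal (q * (1 / \<delta> + min 1 (y / x) / (1 - \<delta>))) \<partial>P)"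
    unfolding q_def by (intro nn_integral_mono_AE eventually_mono[OF nonneg] jump_kernel_Ioi_bounds x)
  also have "\<dots> = ennreal (\<integral>y. q * (1 / \<delta> + min 1 (y / x) / (1 - \<delta>)) \<partial>P)"
    by (intro nn_integral_eq_integral eventually_mono[OF nonneg] integrable_mult_right Bochner_Integration.integrable_add int integrable_divide)
      (use q x index in auto)
  also have "(\<integral>y. q * (1 / \<delta> + min 1 (y / x) / (1 - \<delta>)) \<partial>P) = q * (1 / \<delta> + e / (1 - \<delta>))"
    unfolding e_def using int by (simp add: prob_space)
  finally have "ennreal (prob {x<..}) \<le> ennreal c * ennreal (q * (1 / \<delta> + e / (1 - \<delta>)))"
    by (simp add: em emeasure_eq_measure[symmetric] mult_left_mono)
  then have ub: "prob {x<..} \<le> c * (q * (1 / \<delta> + e / (1 - \<delta>)))"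
    using c q e0 index by (subst (asm) ennreal_mult'[symmetric], simp, subst (asm) ennreal_le_iff) auto
  have "ennreal (q / \<delta> * (1 - e)) = ennreal (\<integral>y. q / \<delta> * (1 - min 1 (y / x)) \<partial>P)"
    unfolding e_def using int by simp
  also have "\<dots> = (\<integral>\<^sup>+y. ennreal (q / \<delta> * (1 - min 1 (y / x))) \<partial>P)"
    by (intro nn_integral_eq_integral[symmetric] eventually_mono[OF nonneg] integrable_mult_right Bochner_Integration.integrable_diff int)
      (use q x index in auto)
  also have "\<dots> \<le> (\<integral>\<^sup>+y. jump_kernel {x<..} y \<partial>P)"
    unfolding q_def by (intro nn_integral_mono_AE eventually_mono[OF nonneg] jump_kernel_Ioi_bounds x)
  finally have "ennreal c * ennreal (q / \<delta> * (1 - e)) \<le> ennreal (prob {x<..})"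
    by (simp add: em emeasure_eq_measure[symmetric] mult_left_mono)
  then have lb: "c * (q / \<delta> * (1 - e)) \<le> prob {x<..}"
    using c q e0 index by (subst (asm) ennreal_mult'[symmetric], simp, subst (asm) ennreal_le_iff) auto
  have cd: "c / \<delta> = 1 / Gamma (1 - \<delta>)" using index by (simp add: c_def)
  define B where "B = 2 / (Gamma (1 - \<delta>) * (1 - \<delta>)) * q\<^sup>2"
  have B: "0 \<le> B" using index Gamma_pos by (simp add: B_def)
  have "prob {x<..} - q / Gamma (1 - \<delta>) \<le> c * q * e / (1 - \<delta>)"
  proof -
    have "c * (q * (1 / \<delta> + e / (1 - \<delta>))) = q * (c / \<delta>) + c * q * e / (1 - \<delta>)"
      by (simp add: distrib_left mult_ac)
    then show ?thesis using ub unfolding cd by simp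
  qed
  also have "\<dots> \<le> c * q * (2 * q) / (1 - \<delta>)"
    using e c q index by (intro divide_right_mono mult_left_mono) auto
  also have "\<dots> \<le> 2 / (Gamma (1 - \<delta>) * (1 - \<delta>)) * q\<^sup>2"
    using index mult_right_mono[OF less_imp_le[OF index(2)] B]
    by (simp add: B_def c_def power2_eq_square mult_ac)
  finally have 1: "prob {x<..} - q / Gamma (1 - \<delta>) \<le> 2 / (Gamma (1 - \<delta>) * (1 - \<delta>)) * q\<^sup>2" .
  have "q / Gamma (1 - \<delta>) - prob {x<..} \<le> q * e / Gamma (1 - \<delta>)"
  proof -
    have "c * (q / \<delta> * (1 - e)) = (c / \<delta>) * (q * (1 - e))" by simp
    also have "\<dots> = q / Gamma (1 - \<delta>) - q * e / Gamma (1 - \<delta>)"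
      unfolding cd by (simp add: right_diff_distrib diff_divide_distrib)
    finally show ?thesis using lb by simp
  qed
  also have "\<dots> \<le> q * (2 * q) / Gamma (1 - \<delta>)"
    using e q Gamma_pos by (intro divide_right_mono mult_left_mono) auto
  also have "\<dots> \<le> 2 / (Gamma (1 - \<delta>) * (1 - \<delta>)) * q\<^sup>2"
  proof -
    have "q * (2 * q) / Gamma (1 - \<delta>) \<le> q * (2 * q) / (Gamma (1 - \<delta>) * (1 - \<delta>))"
      using index Gamma_pos q by (intro divide_left_mono mult_left_le) auto
    then show ?thesis by (simp add: power2_eq_square mult_ac)
  qed
  finally show ?thesis using 1 by (simp add: q_def abs_le_iff)
qed

end

section \<open>The Laplace functional of a Poisson process\<close>

text \<open>Since the point probabilities already sum to 1, no mass is left for infinity or for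
  non-integers. For Poisson counts this is what makes a bounded set contain finitely many points
  almost surely.\<close>

lemma nn_integral_nat_valued:
  fixes p :: "nat \<Rightarrow> real" and N :: "'a \<Rightarrow> ennreal"
  assumes "prob_space M" and N[measurable]: "N \<in> borel_measurable M"
    and p: "\<And>k. measure M {\<omega> \<in> space M. N \<omega> = of_nat k} = p k" and total: "p sums 1"
  shows "AE \<omega> in M. \<exists>k. N \<omega> = of_nat k"
    and "F \<in> borel_measurable borel \<Longrightarrow> (\<integral>\<^sup>+\<omega>. F (N \<omega>) \<partial>M) = (\<Sum>k. F (of_nat k) * ennreal (p k))"
proof -
  interpret prob_space M by fact
  let ?E = "\<lambda>k::nat. {\<omega> \<in> space M. N \<omega> = of_nat k}"
  have disj: "disjoint_family ?E" by (auto simp: disjoint_family_on_def)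
  have p0: "0 \<le> p k" for k by (simp add: p[symmetric])
  have "(\<lambda>k. prob (?E k)) sums prob (\<Union>k. ?E k)"
    by (rule finite_measure_UNION) (auto intro: disj)
  with total have "prob (\<Union>k. ?E k) = 1" unfolding p by (rule sums_unique2[symmetric])
  then have "AE \<omega> in M. \<omega> \<in> (\<Union>k. ?E k)"
    by (subst prob_eq_1[symmetric]) auto
  then show ae: "AE \<omega> in M. \<exists>k. N \<omega> = of_nat k" by (auto elim!: eventually_mono)
  assume [measurable]: "F \<in> borel_measurable borel"
  have "(\<integral>\<^sup>+\<omega>. F (N \<omega>) \<partial>M) = (\<integral>\<^sup>+\<omega>. (\<Sum>k. F (of_nat k) * indicator (?E k) \<omega>) \<partial>M)"
  proof (rule nn_integral_cong_AE, use ae AE_space in eventually_elim)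
    fix \<omega> assume "\<exists>k. N \<omega> = of_nat k" and sp: "\<omega> \<in> space M"
    then obtain k where k: "N \<omega> = of_nat k" by blast
    have "(\<Sum>j. F (of_nat j) * indicator (?E j) \<omega>) = (\<Sum>j\<in>{k}. F (of_nat j) * indicator (?E j) \<omega>)"
      using k by (intro suminf_finite) (auto split: split_indicator)
    then show "F (N \<omega>) = (\<Sum>j. F (of_nat j) * indicator (?E j) \<omega>)" using k sp by simp
  qed
  also have "\<dots> = (\<Sum>k. \<integral>\<^sup>+\<omega>. F (of_nat k) * indicator (?E k) \<omega> \<partial>M)"
    by (rule nn_integral_suminf) measurable
  also have "\<dots> = (\<Sum>k. F (of_nat k) * ennreal (p k))"
    by (simp add: nn_integral_cmult emeasure_eq_measure p)
  finally show "(\<integral>\<^sup>+\<omega>. F (N \<omega>) \<partial>M) = (\<Sum>k. F (of_nat k) * ennreal (p k))" .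
qed

lemma poisson_probabilities_sums: "(\<lambda>k. m ^ k / fact k * exp (- m)) sums (1 :: real)"
  using sums_mult2[OF exp_converges[of m], of "exp (- m)"]
  by (simp add: exp_add[symmetric] divide_inverse mult.commute)

lemma suminf_ennreal_poisson_exp:
  fixes m a :: real
  assumes "m \<ge> 0"
  shows "(\<Sum>k. ennreal (exp (- (a * real k))) * ennreal (m ^ k / fact k * exp (- m))) =
    ennreal (exp (- (m * (1 - exp (- a)))))"
proof -
  have *: "exp (- (a * real k)) * (m ^ k / fact k * exp (- m)) = exp (- m) * ((m * exp (- a)) ^ k /\<^sub>R fact k)" for k
    by (simp add: power_mult_distrib exp_of_nat_mult[symmetric] field_simps)
  have "(\<lambda>k. exp (- m) * ((m * exp (- a)) ^ k /\<^sub>R fact k)) sums (exp (- m) * exp (m * exp (- a)))"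
    by (intro sums_mult exp_converges)
  then have "(\<lambda>k. exp (- (a * real k)) * (m ^ k / fact k * exp (- m))) sums exp (- (m * (1 - exp (- a))))"
    unfolding * by (simp add: exp_add[symmetric] algebra_simps)
  then show ?thesis
    using assms by (subst ennreal_mult'[symmetric], simp, intro suminf_ennreal_eq) auto
qed

context prob_space
begin

lemma borel_measurable_point_count:
  assumes "poisson_point_process \<mu> X" and [measurable]: "A \<in> sets borel"
  shows "point_count X A \<in> borel_measurable M"
proof -
  have [measurable]: "random_variable borel (X l)" for l
    using assms by (auto simp: poisson_point_process_def)
  show ?thesis unfolding point_count_def[abs_def] by measurable
qed

lemma nn_integral_exp_point_count:
  fixes A :: "'b::euclidean_space set"
  assumes ppp: "poisson_point_process \<mu> X" and \<mu>: "\<mu> > 0"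
    and A: "A \<in> sets borel" "bounded A"
  shows "AE \<omega> in M. \<exists>k. point_count X A \<omega> = of_nat k"
    and "(\<integral>\<^sup>+\<omega>. ennreal (exp (- (a * enn2real (point_count X A \<omega>)))) \<partial>M) =
      ennreal (exp (- (\<mu> * measure lborel A * (1 - exp (- a)))))"
proof -
  let ?m = "\<mu> * measure lborel A"
  have p: "prob {\<omega> \<in> space M. point_count X A \<omega> = of_nat k} = ?m ^ k / fact k * exp (- ?m)" for k
    using ppp A unfolding poisson_point_process_def by blast
  note N = nn_integral_nat_valued[OF prob_space_axioms borel_measurable_point_count[OF ppp A(1)] p poisson_probabilities_sums]
  show "AE \<omega> in M. \<exists>k. point_count X A \<omega> = of_nat k" by (rule N(1))
  have "(\<integral>\<^sup>+\<omega>. ennreal (exp (- (a * enn2real (point_count X A \<omega>)))) \<partial>M) =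
    (\<Sum>k. ennreal (exp (- (a * enn2real (of_nat k)))) * ennreal (?m ^ k / fact k * exp (- ?m)))"
    by (rule N(2)) measurable
  also have "\<dots> = (\<Sum>k. ennreal (exp (- (a * real k))) * ennreal (?m ^ k / fact k * exp (- ?m)))"
    by (simp add: ennreal_of_nat_eq_real_of_nat)
  also have "\<dots> = ennreal (exp (- (?m * (1 - exp (- a)))))"
    using \<mu> by (intro suminf_ennreal_poisson_exp) simp
  finally show "(\<integral>\<^sup>+\<omega>. ennreal (exp (- (a * enn2real (point_count X A \<omega>)))) \<partial>M) =
      ennreal (exp (- (\<mu> * measure lborel A * (1 - exp (- a)))))" .
qed

text \<open>The level sets of g are bounded and disjoint, so the sum of g over the points is a
  combination of independent Poisson counts and the expectation factorises. The infimum over partial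
  sums makes sense without any summability, and boundedness of the support makes C finite.\<close>

lemma poisson_laplace_simple:
  fixes X :: "nat \<Rightarrow> 'a \<Rightarrow> 'b::euclidean_space" and g :: "'b \<Rightarrow> real"
  assumes ppp: "poisson_point_process \<mu> X" and \<mu>: "\<mu> > 0"
    and g: "simple_function borel g" "\<And>x. g x \<ge> 0" and bnd: "bounded {x. g x \<noteq> 0}"
  shows "\<exists>C\<ge>0. (\<integral>\<^sup>+x. ennreal (1 - exp (- g x)) \<partial>lborel) = ennreal C \<and>
    (INF n. \<integral>\<^sup>+\<omega>. ennreal (exp (- (\<Sum>l<n. g (X l \<omega>)))) \<partial>M) = ennreal (exp (- (\<mu> * C)))"
proof -
  have [measurable]: "random_variable borel (X l)" for l
    using ppp by (auto simp: poisson_point_process_def)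
  have [measurable]: "g \<in> borel_measurable borel"
    using g(1) by (rule borel_measurable_simple_function)
  define V where "V = range g - {0}"
  have finV: "finite V" using g(1) by (auto simp: V_def simple_function_def)
  define m where "m = card V"
  obtain h where h: "bij_betw h {..<m} V"
    using ex_bij_betw_nat_finite[OF finV] by (auto simp: m_def atLeast0LessThan)
  have hV: "h j \<in> V" if "j < m" for j using h that by (auto simp: bij_betw_def)
  then have h0: "h j \<noteq> 0" "h j \<ge> 0" if "j < m" for j
    using hV[OF that] g(2) by (auto simp: V_def)
  define A where "A j = g -` {h j}" for j
  have A[measurable]: "A j \<in> sets borel" for j
    unfolding A_def using measurable_sets[of g borel borel "{h j}"] by simp
  have bA: "bounded (A j)" if "j < m" for j
    by (rule bounded_subset[OF bnd]) (use h0[OF that] in \<open>auto simp: A_def\<close>)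
  have dA: "disjoint_family_on A {..<m}"
    using h by (auto simp: disjoint_family_on_def A_def bij_betw_def dest: inj_onD)
  \<comment> \<open>The decomposition into level sets holds for every G with \<open>G 0 = 0\<close>.
    It serves with \<open>1 - exp (- t)\<close> for the exponent and with the identity for the sum
    over the points.\<close>
  have g_eq: "G (g x) = (\<Sum>j<m. G (h j) * indicator (A j) x)" if "G 0 = 0" for x and G :: "real \<Rightarrow> real"
  proof (cases "g x = 0")
    case True
    then have "(\<Sum>j<m. G (h j) * indicator (A j) x) = 0"
      by (intro sum.neutral) (use h0 in \<open>auto simp: A_def indicator_def\<close>)
    then show ?thesis using that True by simp
  next
    case False
    then have "g x \<in> h ` {..<m}"
      using h by (simp add: bij_betw_def V_def)
    then obtain i where i: "i < m" "h i = g x" by auto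
    have "(\<Sum>j<m. G (h j) * indicator (A j) x) = (\<Sum>j\<in>{i}. G (h j) * indicator (A j) x)"
    proof (rule sum.mono_neutral_right)
      show "\<forall>j\<in>{..<m} - {i}. G (h j) * indicator (A j) x = 0"
      proof
        fix j assume j: "j \<in> {..<m} - {i}"
        then have "h j \<noteq> h i"
          using h i(1) unfolding bij_betw_def by (metis DiffE inj_on_eq_iff insertI1 lessThan_iff)
        then show "G (h j) * indicator (A j) x = 0" by (simp add: A_def i(2))
      qed
    qed (use i in auto)
    then show ?thesis using i by (simp add: A_def)
  qed
  define C where "C = (\<Sum>j<m. (1 - exp (- h j)) * measure lborel (A j))"
  have C0: "C \<ge> 0" unfolding C_def using h0 by (intro sum_nonneg mult_nonneg_nonneg) auto
  have "(\<integral>\<^sup>+x. ennreal (1 - exp (- g x)) \<partial>lborel) =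
      (\<integral>\<^sup>+x. (\<Sum>j<m. ennreal (1 - exp (- h j)) * indicator (A j) x) \<partial>lborel)"
  proof (intro nn_integral_cong)
    fix x
    have "ennreal (1 - exp (- g x)) = ennreal (\<Sum>j<m. (1 - exp (- h j)) * indicator (A j) x)"
      using g_eq[of "\<lambda>t. 1 - exp (- t)" x] by simp
    also have "\<dots> = (\<Sum>j<m. ennreal ((1 - exp (- h j)) * indicator (A j) x))"
      using h0 by (intro sum_ennreal[symmetric]) auto
    also have "\<dots> = (\<Sum>j<m. ennreal (1 - exp (- h j)) * indicator (A j) x)"
      by (intro sum.cong refl) (auto split: split_indicator)
    finally show "ennreal (1 - exp (- g x)) = (\<Sum>j<m. ennreal (1 - exp (- h j)) * indicator (A j) x)" .
  qed
  also have "\<dots> = (\<Sum>j<m. ennreal (1 - exp (- h j)) * emeasure lborel (A j))"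
    by (subst nn_integral_sum) (auto simp: nn_integral_cmult)
  also have "\<dots> = (\<Sum>j<m. ennreal ((1 - exp (- h j)) * measure lborel (A j)))"
  proof (intro sum.cong refl)
    fix j assume j: "j \<in> {..<m}"
    then have "emeasure lborel (A j) < \<infinity>" using emeasure_bounded_finite[of "A j"] bA by auto
    then have "emeasure lborel (A j) = ennreal (measure lborel (A j))"
      by (intro emeasure_eq_ennreal_measure) auto
    then show "ennreal (1 - exp (- h j)) * emeasure lborel (A j) = ennreal ((1 - exp (- h j)) * measure lborel (A j))"
      using j h0 by (simp add: ennreal_mult')
  qed
  also have "\<dots> = ennreal C" unfolding C_def
    using h0 by (intro sum_ennreal) auto
  finally have int: "(\<integral>\<^sup>+x. ennreal (1 - exp (- g x)) \<partial>lborel) = ennreal C" .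
  let ?N = "\<lambda>j \<omega>. point_count X (A j) \<omega>"
  have mN[measurable]: "?N j \<in> borel_measurable M" for j
    by (rule borel_measurable_point_count[OF ppp A])
  let ?f = "\<lambda>n \<omega>. ennreal (exp (- (\<Sum>l<n. g (X l \<omega>))))"
  have dec: "decseq ?f"
    using g(2) by (intro decseq_SucI le_funI ennreal_leI) auto
  have "(INF n. \<integral>\<^sup>+\<omega>. ?f n \<omega> \<partial>M) = (\<integral>\<^sup>+\<omega>. (INF n. ?f n \<omega>) \<partial>M)"
  proof (rule nn_integral_monotone_convergence_INF_decseq[symmetric, OF dec])
    show "(\<integral>\<^sup>+\<omega>. ?f 0 \<omega> \<partial>M) < \<infinity>" by (simp add: emeasure_space_1)
  qed measurable
  also have "\<dots> = (\<integral>\<^sup>+\<omega>. (\<Prod>j<m. ennreal (exp (- (h j * enn2real (?N j \<omega>))))) \<partial>M)"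
  proof (rule nn_integral_cong_AE)
    have "AE \<omega> in M. \<forall>j\<in>{..<m}. \<exists>k. ?N j \<omega> = of_nat k"
      by (rule AE_finite_allI) (auto intro!: nn_integral_exp_point_count[OF ppp \<mu>] A bA)
    then show "AE \<omega> in M. (INF n. ?f n \<omega>) = (\<Prod>j<m. ennreal (exp (- (h j * enn2real (?N j \<omega>)))))"
    proof eventually_elim
      fix \<omega> assume nat: "\<forall>j\<in>{..<m}. \<exists>k. ?N j \<omega> = of_nat k"
      have cnt: "(\<lambda>n. \<Sum>l<n. indicator (A j) (X l \<omega>)) \<longlonglongrightarrow> enn2real (?N j \<omega>)" if j: "j < m" for j
      proof -
        obtain k where k: "?N j \<omega> = of_nat k" using nat j by auto
        have "(\<lambda>l. indicator (A j) (X l \<omega>) :: ennreal) sums (?N j \<omega>)"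
          unfolding point_count_def by (simp add: summable_sums)
        then have "(\<lambda>l. ennreal (indicator (A j) (X l \<omega>))) sums ennreal (enn2real (?N j \<omega>))"
          by (simp add: k ennreal_of_nat_eq_real_of_nat flip: ennreal_indicator)
        then have "(\<lambda>l. indicator (A j) (X l \<omega>)) sums enn2real (?N j \<omega>)"
          by (subst (asm) sums_ennreal) auto
        then show ?thesis by (simp add: sums_def)
      qed
      have "(\<Sum>l<n. g (X l \<omega>)) = (\<Sum>j<m. h j * (\<Sum>l<n. indicator (A j) (X l \<omega>)))" for n
      proof -
        have "(\<Sum>l<n. g (X l \<omega>)) = (\<Sum>l<n. \<Sum>j<m. h j * indicator (A j) (X l \<omega>))"
          by (intro sum.cong refl g_eq[of "\<lambda>t. t"])
        also have "\<dots> = (\<Sum>j<m. \<Sum>l<n. h j * indicator (A j) (X l \<omega>))"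
          by (rule sum.swap)
        finally show ?thesis by (simp add: sum_distrib_left)
      qed
      moreover have "(\<lambda>n. \<Sum>j<m. h j * (\<Sum>l<n. indicator (A j) (X l \<omega>))) \<longlonglongrightarrow> (\<Sum>j<m. h j * enn2real (?N j \<omega>))"
        by (intro tendsto_intros cnt) auto
      ultimately have "(\<lambda>n. ?f n \<omega>) \<longlonglongrightarrow> ennreal (exp (- (\<Sum>j<m. h j * enn2real (?N j \<omega>))))"
        by (intro tendsto_ennrealI tendsto_exp tendsto_minus) simp
      moreover have "(\<lambda>n. ?f n \<omega>) \<longlonglongrightarrow> (INF n. ?f n \<omega>)"
        by (intro LIMSEQ_INF decseq_SucI ennreal_leI) (use g(2) in auto)
      ultimately have "(INF n. ?f n \<omega>) = ennreal (exp (- (\<Sum>j<m. h j * enn2real (?N j \<omega>))))"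
        by (rule LIMSEQ_unique[THEN sym])
      then show "(INF n. ?f n \<omega>) = (\<Prod>j<m. ennreal (exp (- (h j * enn2real (?N j \<omega>)))))"
        by (simp add: prod_ennreal exp_sum[symmetric] sum_negf)
    qed
  qed
  also have "\<dots> = (\<Prod>j<m. \<integral>\<^sup>+\<omega>. ennreal (exp (- (h j * enn2real (?N j \<omega>)))) \<partial>M)"
  proof (rule indep_vars_nn_integral)
    have "\<forall>i<m. A i \<in> sets borel \<and> bounded (A i)" using A bA by auto
    with ppp dA have "indep_vars (\<lambda>_. borel) (\<lambda>i. point_count X (A i)) {..<m}"
      unfolding poisson_point_process_def by blast
    then show "indep_vars (\<lambda>_. borel) (\<lambda>j \<omega>. ennreal (exp (- (h j * enn2real (?N j \<omega>))))) {..<m}"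
      by (rule indep_vars_compose2[where Y="\<lambda>j x. ennreal (exp (- (h j * enn2real x)))"]) measurable
  qed auto
  also have "\<dots> = (\<Prod>j<m. ennreal (exp (- (\<mu> * measure lborel (A j) * (1 - exp (- h j))))))"
    by (intro prod.cong refl nn_integral_exp_point_count[OF ppp \<mu>] A bA) auto
  also have "\<dots> = ennreal (exp (- (\<mu> * C)))"
    by (simp add: prod_ennreal C_def sum_distrib_left mult_ac exp_sum[symmetric] sum_negf)
  finally show ?thesis using C0 int by blast
qed

text \<open>Monotone approximation from below by simple functions of bounded support; the exponents
  \<open>D i\<close> converge by monotone convergence.\<close>

lemma poisson_laplace:
  fixes X :: "nat \<Rightarrow> 'a \<Rightarrow> 'b::euclidean_space" and g :: "'b \<Rightarrow> real"
  assumes ppp: "poisson_point_process \<mu> X" and \<mu>: "\<mu> > 0"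
    and g[measurable]: "g \<in> borel_measurable borel" and g0: "\<And>x. g x \<ge> 0"
    and C: "(\<integral>\<^sup>+x. ennreal (1 - exp (- g x)) \<partial>lborel) = ennreal C" "C \<ge> 0"
  shows "(INF n. \<integral>\<^sup>+\<omega>. ennreal (exp (- (\<Sum>l<n. g (X l \<omega>)))) \<partial>M) = ennreal (exp (- (\<mu> * C)))"
proof -
  have [measurable]: "random_variable borel (X l)" for l
    using ppp by (auto simp: poisson_point_process_def)
  obtain f where f: "incseq f" "\<And>i. simple_function borel (f i)" "\<And>x. bdd_above (range (\<lambda>i. f i x))"
    "\<And>i x. 0 \<le> f i x" "g = (SUP i. f i)"
    using borel_measurable_implies_simple_function_sequence_real[OF g g0] by blast
  \<comment> \<open>Cutting off to growing balls supplies bounded support and keeps the sequence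
    increasing, because the \<open>f i\<close> are nonnegative.\<close>
  define k where "k i x = f i x * indicator (cball 0 (real i)) x" for i x
  have k_simple: "simple_function borel (k i)" for i
    unfolding k_def by (intro simple_function_mult f) auto
  have [measurable]: "k i \<in> borel_measurable borel" for i
    using k_simple by (rule borel_measurable_simple_function)
  have k0: "k i x \<ge> 0" for i x using f(4) by (simp add: k_def)
  have k_bnd: "bounded {x. k i x \<noteq> 0}" for i
    by (rule bounded_subset[OF bounded_cball[of 0 "real i"]]) (auto simp: k_def indicator_def)
  have f_mono: "f i x \<le> f j x" if "i \<le> j" for i j x
    using f(1) that by (auto simp: incseq_def le_fun_def)
  have k_mono: "k i x \<le> k j x" if "i \<le> j" for i j x
    using f_mono[OF that] f(4)[of j x] that by (auto simp: k_def split: split_indicator)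
  have f_lim: "(\<lambda>i. f i x) \<longlonglongrightarrow> g x" for x
  proof -
    have "(\<lambda>i. f i x) \<longlonglongrightarrow> (SUP i. f i x)"
      using f(3)[of x] f_mono by (intro LIMSEQ_incseq_SUP) (auto simp: incseq_def)
    then show ?thesis by (simp add: f(5) image_comp)
  qed
  have k_lim: "(\<lambda>i. k i x) \<longlonglongrightarrow> g x" for x
  proof (rule Lim_transform_eventually[OF f_lim])
    have "\<forall>\<^sub>F i in sequentially. norm x \<le> real i"
      using real_arch_simple[of "norm x"] by (auto simp: eventually_sequentially intro: order_trans[OF _ of_nat_mono])
    then show "\<forall>\<^sub>F i in sequentially. f i x = k i x"
      by eventually_elim (auto simp: k_def)
  qed
  obtain D where D: "\<And>i. D i \<ge> 0" "\<And>i. (\<integral>\<^sup>+x. ennreal (1 - exp (- k i x)) \<partial>lborel) = ennreal (D i)"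
    "\<And>i. (INF n. \<integral>\<^sup>+\<omega>. ennreal (exp (- (\<Sum>l<n. k i (X l \<omega>)))) \<partial>M) = ennreal (exp (- (\<mu> * D i)))"
    using poisson_laplace_simple[OF ppp \<mu> k_simple k0 k_bnd] by metis
  have "(\<lambda>i. \<integral>\<^sup>+x. ennreal (1 - exp (- k i x)) \<partial>lborel) \<longlonglongrightarrow> (\<integral>\<^sup>+x. ennreal (1 - exp (- g x)) \<partial>lborel)"
    by (rule nn_integral_LIMSEQ)
      (auto simp: incseq_def le_fun_def intro!: ennreal_leI k_mono tendsto_ennrealI tendsto_intros k_lim)
  then have "D \<longlonglongrightarrow> C" using C D by simp
  then have lim1: "(\<lambda>i. ennreal (exp (- (\<mu> * D i)))) \<longlonglongrightarrow> ennreal (exp (- (\<mu> * C)))"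
    by (intro tendsto_ennrealI tendsto_intros)
  let ?F = "\<lambda>i n. \<integral>\<^sup>+\<omega>. ennreal (exp (- (\<Sum>l<n. k i (X l \<omega>)))) \<partial>M"
  have "decseq (\<lambda>i. INF n. ?F i n)"
    by (auto simp: decseq_def intro!: INF_mono' nn_integral_mono ennreal_leI sum_mono k_mono)
  then have "(\<lambda>i. INF n. ?F i n) \<longlonglongrightarrow> (INF i. INF n. ?F i n)"
    by (rule LIMSEQ_INF)
  from LIMSEQ_unique[OF lim1 this[unfolded D(3)]]
  have "ennreal (exp (- (\<mu> * C))) = (INF i. INF n. ?F i n)"
    by (simp only: D(3))
  \<comment> \<open>The expectations decrease both in the number of points and in the approximation
    index, so the exchange of limits is a mere exchange of infima.\<close>
  also have "\<dots> = (INF n. INF i. ?F i n)" by (rule INF_commute)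
  also have "\<dots> = (INF n. \<integral>\<^sup>+\<omega>. ennreal (exp (- (\<Sum>l<n. g (X l \<omega>)))) \<partial>M)"
  proof (intro INF_cong refl)
    fix n
    let ?f = "\<lambda>i \<omega>. ennreal (exp (- (\<Sum>l<n. k i (X l \<omega>))))"
    have dec: "decseq ?f"
      by (intro decseq_SucI le_funI ennreal_leI) (auto intro!: sum_mono k_mono)
    have "(INF i. ?F i n) = (\<integral>\<^sup>+\<omega>. (INF i. ?f i \<omega>) \<partial>M)"
    proof (rule nn_integral_monotone_convergence_INF_decseq[symmetric, OF dec])
      have "(\<integral>\<^sup>+\<omega>. ?f 0 \<omega> \<partial>M) \<le> (\<integral>\<^sup>+\<omega>. 1 \<partial>M)"
        by (intro nn_integral_mono) (auto intro!: sum_nonneg k0)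
      also have "\<dots> < \<infinity>" by (simp add: emeasure_space_1)
      finally show "(\<integral>\<^sup>+\<omega>. ?f 0 \<omega> \<partial>M) < \<infinity>" .
    qed measurable
    also have "\<dots> = (\<integral>\<^sup>+\<omega>. ennreal (exp (- (\<Sum>l<n. g (X l \<omega>)))) \<partial>M)"
    proof (intro nn_integral_cong)
      fix \<omega>
      have "(\<lambda>i. ?f i \<omega>) \<longlonglongrightarrow> ennreal (exp (- (\<Sum>l<n. g (X l \<omega>))))"
        by (intro tendsto_ennrealI tendsto_intros k_lim)
      moreover have "(\<lambda>i. ?f i \<omega>) \<longlonglongrightarrow> (INF i. ?f i \<omega>)"
        by (intro LIMSEQ_INF decseq_SucI ennreal_leI) (auto intro!: sum_mono k_mono)
      ultimately show "(INF i. ?f i \<omega>) = ennreal (exp (- (\<Sum>l<n. g (X l \<omega>))))"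
        by (rule LIMSEQ_unique[THEN sym])
    qed
    finally show "(INF i. ?F i n) = (\<integral>\<^sup>+\<omega>. ennreal (exp (- (\<Sum>l<n. g (X l \<omega>)))) \<partial>M)" .
  qed
  finally show ?thesis by simp
qed

end

section \<open>Path loss integrals\<close>

lemma nn_integral_lborel_scaleR:
  fixes f :: "'b::euclidean_space \<Rightarrow> ennreal"
  assumes [measurable]: "f \<in> borel_measurable borel" and c: "c > 0"
  shows "(\<integral>\<^sup>+x. f x \<partial>lborel) = ennreal (c ^ DIM('b)) * (\<integral>\<^sup>+x. f (c *\<^sub>R x) \<partial>lborel)"
proof -
  have "(\<integral>\<^sup>+x. f x \<partial>lborel) =
    (\<integral>\<^sup>+x. f x \<partial>density (distr lborel borel (\<lambda>x::'b. 0 + c *\<^sub>R x)) (\<lambda>_. ennreal (\<bar>c\<bar> ^ DIM('b))))"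
    using c lborel_affine[of c "0::'b"] by simp
  also have "\<dots> = ennreal (c ^ DIM('b)) * (\<integral>\<^sup>+x. f (c *\<^sub>R x) \<partial>lborel)"
    using c by (simp add: nn_integral_density nn_integral_distr nn_integral_cmult)
  finally show ?thesis .
qed

text \<open>Stretching the plane by \<open>c = s powr (1 / a)\<close> absorbs s into the path loss,
  and area scales by \<open>c\<^sup>2\<close>. This is the origin of the stability index 2 /
  \<alpha>.\<close>

lemma path_loss_integral_scale:
  fixes f :: "real \<Rightarrow> ennreal"
  assumes [measurable]: "f \<in> borel_measurable borel" and s: "s > 0" and a: "a > 0"
  shows "(\<integral>\<^sup>+(x::real^2). f (s * norm x powr (- a)) \<partial>lborel) =
    ennreal (s powr (2 / a)) * (\<integral>\<^sup>+(x::real^2). f (norm x powr (- a)) \<partial>lborel)"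
proof -
  define c where "c = s powr (1 / a)"
  have c: "c > 0" using s by (simp add: c_def)
  have ca: "s * c powr (- a) = 1"
    using s a by (simp add: c_def powr_powr powr_minus)
  have "(\<integral>\<^sup>+(x::real^2). f (s * norm x powr (- a)) \<partial>lborel) =
    ennreal (c\<^sup>2) * (\<integral>\<^sup>+(x::real^2). f (s * norm (c *\<^sub>R x) powr (- a)) \<partial>lborel)"
    using nn_integral_lborel_scaleR[OF _ c, of "\<lambda>x::real^2. f (s * norm x powr (- a))"] by simp
  also have "(\<lambda>x::real^2. f (s * norm (c *\<^sub>R x) powr (- a))) = (\<lambda>x. f (norm x powr (- a)))"
    using c ca by (simp add: powr_mult mult.assoc[symmetric])
  also have "c\<^sup>2 = s powr (2 / a)"
    using s by (simp add: c_def powr_power)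
  finally show ?thesis .
qed

lemma emeasure_path_loss_superlevel:
  fixes v a :: real
  assumes "v > 0" "a > 0"
  shows "emeasure lborel {x::real^2. v \<le> norm x powr (- a)} = ennreal (pi * v powr (- (2 / a)))"
proof -
  define R where "R = v powr (- (1 / a))"
  have R: "R \<ge> 0" by (simp add: R_def)
  have Ra: "R powr (- a) = v" using assms by (simp add: R_def powr_powr)
  \<comment> \<open>The value of \<open>0 powr (- a)\<close> is 0, so the origin falls outside the
    superlevel set and the disc is punctured.\<close>
  have "v \<le> norm x powr (- a) \<longleftrightarrow> x \<in> cball 0 R - {0}" for x :: "real^2"
  proof (cases "x = 0")
    case False
    have "R > 0" using assms by (simp add: R_def)
    then have "R powr (- a) \<le> norm x powr (- a) \<longleftrightarrow> norm x \<le> R"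
      using assms False by (smt (verit) powr_less_mono2_neg powr_mono2' zero_less_norm_iff)
    then show ?thesis using False Ra by simp
  qed (use assms in simp)
  then have "{x::real^2. v \<le> norm x powr (- a)} = cball 0 R - {0}"
    by (intro set_eqI) (simp only: mem_Collect_eq)
  moreover have "emeasure lborel (cball 0 R - {0 :: real^2}) = emeasure lborel (cball (0::real^2) R)"
    by (rule emeasure_Diff_null_set) auto
  moreover have "emeasure lborel (cball (0::real^2) R) = ennreal (pi * R\<^sup>2)"
    using R by (simp add: emeasure_cball unit_ball_vol_2)
  moreover have "R\<^sup>2 = v powr (- (2 / a))" using assms by (simp add: R_def powr_power)
  ultimately show ?thesis by simp
qed

text \<open>Layer-cake argument: \<open>1 - exp (- w)\<close> is the integral of
  \<open>exp (- v)\<close> over [0, w]. After exchanging the integrals, the area of the disc where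
  the path loss is at least v turns the remaining integral into a Gamma integral, which converges
  because a > 2.\<close>

lemma nn_integral_path_loss_exp:
  fixes a :: real
  assumes "a > 2"
  shows "(\<integral>\<^sup>+(x::real^2). ennreal (1 - exp (- (norm x powr (- a)))) \<partial>lborel) = ennreal (pi * Gamma (1 - 2 / a))"
proof -
  have layer: "ennreal (1 - exp (- w)) = (\<integral>\<^sup>+v. ennreal (exp (- v)) * indicator {0..w} v \<partial>lborel)" if "w \<ge> 0" for w :: real
  proof -
    have "(\<integral>\<^sup>+v. ennreal (exp (- v)) * indicator {0..w} v \<partial>lborel) = ennreal (- exp (- w) - - exp (- 0))"
      by (rule nn_integral_FTC_Icc) (use that in \<open>auto intro!: derivative_eq_intros\<close>)
    then show ?thesis by simp
  qed
  have "(\<integral>\<^sup>+(x::real^2). ennreal (1 - exp (- (norm x powr (- a)))) \<partial>lborel) =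
    (\<integral>\<^sup>+(x::real^2). \<integral>\<^sup>+v. ennreal (exp (- v)) * indicator {0..norm x powr (- a)} v \<partial>lborel \<partial>lborel)"
    by (simp add: layer)
  also have "\<dots> = (\<integral>\<^sup>+v. \<integral>\<^sup>+(x::real^2). ennreal (exp (- v)) * indicator {0..norm x powr (- a)} v \<partial>lborel \<partial>lborel)"
    unfolding indicator_def atLeastAtMost_iff by (rule lborel_pair.Fubini') measurable
  also have "\<dots> = (\<integral>\<^sup>+v. ennreal pi * (ennreal (v powr (- (2 / a)) * exp (- (1 * v))) * indicator {0<..} v) \<partial>lborel)"
  proof (rule nn_integral_cong_AE)
    have "AE v in lborel. v \<noteq> (0::real)" by (rule AE_lborel_singleton)
    then show "AE v in lborel. (\<integral>\<^sup>+(x::real^2). ennreal (exp (- v)) * indicator {0..norm x powr (- a)} v \<partial>lborel) =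
      ennreal pi * (ennreal (v powr (- (2 / a)) * exp (- (1 * v))) * indicator {0<..} v)"
    proof eventually_elim
      fix v :: real assume "v \<noteq> 0"
      show "(\<integral>\<^sup>+(x::real^2). ennreal (exp (- v)) * indicator {0..norm x powr (- a)} v \<partial>lborel) =
        ennreal pi * (ennreal (v powr (- (2 / a)) * exp (- (1 * v))) * indicator {0<..} v)"
      proof (cases "v > 0")
        case True
        have "(\<integral>\<^sup>+(x::real^2). ennreal (exp (- v)) * indicator {0..norm x powr (- a)} v \<partial>lborel) =
          (\<integral>\<^sup>+(x::real^2). ennreal (exp (- v)) * indicator {x. v \<le> norm x powr (- a)} x \<partial>lborel)"
          using True by (intro nn_integral_cong) (auto split: split_indicator)
        also have "\<dots> = ennreal (exp (- v)) * ennreal (pi * v powr (- (2 / a)))"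
          using True assms by (subst nn_integral_cmult_indicator) (auto simp: emeasure_path_loss_superlevel)
        finally show ?thesis using True by (simp add: ennreal_mult'[symmetric] mult_ac)
      next
        case False
        then show ?thesis using \<open>v \<noteq> 0\<close> by simp
      qed
    qed
  qed
  also have "\<dots> = ennreal pi * ennreal (Gamma (1 - 2 / a) * 1 powr (2 / a - 1))"
    using assms by (subst nn_integral_cmult) (simp_all add: nn_integral_powr_exp[of 1 "2 / a", simplified])
  finally show ?thesis by (simp add: ennreal_mult'[symmetric])
qed

text \<open>With fading of mean \<open>\<rho>\<close>, the interference at intensity \<open>\<mu>\<close> has Laplace transform
  \<open>exp (- \<mu> * interference_rate * s powr (2 / \<alpha>))\<close>.\<close>
definition fading_laplace :: "real \<Rightarrow> nat \<Rightarrow> real \<Rightarrow> real" where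
  "fading_laplace \<rho> m u = (1 / (1 + u * (\<rho> / real m))) ^ m"

definition interference_rate :: "real \<Rightarrow> real \<Rightarrow> nat \<Rightarrow> real" where
  "interference_rate \<alpha> \<rho> m = enn2real (\<integral>\<^sup>+(x::real^2). ennreal (1 - fading_laplace \<rho> m (norm x powr (- \<alpha>))) \<partial>lborel)"

lemma borel_measurable_fading_laplace[measurable]: "fading_laplace \<rho> m \<in> borel_measurable borel"
  unfolding fading_laplace_def by measurable

text \<open>The lower bound is \<open>(1 + y) ^ m \<le> exp y ^ m\<close>, an instance of Jensen's
  inequality for fading of mean \<rho>. It dominates the path loss integrand, uniformly in m, by the
  one for constant fading \<rho>.\<close>

lemma fading_laplace_bounds:
  assumes "\<rho> > 0" "m \<ge> 1" "u \<ge> 0"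
  shows "exp (- (\<rho> * u)) \<le> fading_laplace \<rho> m u" "fading_laplace \<rho> m u \<le> 1" "0 < fading_laplace \<rho> m u"
proof -
  define y where "y = u * (\<rho> / real m)"
  have y: "y \<ge> 0" using assms by (simp add: y_def)
  have "(1 + y) ^ m \<le> exp y ^ m" using y by (intro power_mono) auto
  also have "\<dots> = exp (\<rho> * u)" using assms by (simp add: y_def exp_of_nat_mult[symmetric])
  finally have "1 / exp (\<rho> * u) \<le> 1 / (1 + y) ^ m" using y by (intro divide_left_mono) auto
  then show "exp (- (\<rho> * u)) \<le> fading_laplace \<rho> m u"
    by (simp add: fading_laplace_def y_def exp_minus power_divide inverse_eq_divide)
  have "fading_laplace \<rho> m u = (1 / (1 + y)) ^ m" by (simp only: fading_laplace_def y_def)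
  then show "fading_laplace \<rho> m u \<le> 1" "0 < fading_laplace \<rho> m u"
    using y by (auto intro!: power_le_one)
qed

lemma nn_integral_path_loss_exp_scaled:
  assumes "\<alpha> > 2" "\<rho> > 0"
  shows "(\<integral>\<^sup>+(x::real^2). ennreal (1 - exp (- (\<rho> * norm x powr (- \<alpha>)))) \<partial>lborel) =
    ennreal (\<rho> powr (2 / \<alpha>) * (pi * Gamma (1 - 2 / \<alpha>)))"
  using path_loss_integral_scale[of "\<lambda>w. ennreal (1 - exp (- w))" \<rho> \<alpha>] assms
  by (simp add: nn_integral_path_loss_exp ennreal_mult'[symmetric])

lemma ennreal_interference_rate:
  assumes "\<alpha> > 2" "\<rho> > 0" "m \<ge> 1"
  shows "(\<integral>\<^sup>+(x::real^2). ennreal (1 - fading_laplace \<rho> m (norm x powr (- \<alpha>))) \<partial>lborel) = ennreal (interference_rate \<alpha> \<rho> m)"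
proof -
  have "(\<integral>\<^sup>+(x::real^2). ennreal (1 - fading_laplace \<rho> m (norm x powr (- \<alpha>))) \<partial>lborel) \<le>
    (\<integral>\<^sup>+(x::real^2). ennreal (1 - exp (- (\<rho> * norm x powr (- \<alpha>)))) \<partial>lborel)"
    using fading_laplace_bounds(1) assms by (intro nn_integral_mono ennreal_leI) simp
  also have "\<dots> < \<infinity>" using assms by (simp add: nn_integral_path_loss_exp_scaled)
  finally show ?thesis unfolding interference_rate_def by (simp add: less_top)
qed

lemma interference_rate_nonneg: "0 \<le> interference_rate \<alpha> \<rho> m"
  by (simp add: interference_rate_def)

lemma nn_integral_fading_laplace_scaled:
  assumes "\<alpha> > 2" "\<rho> > 0" "m \<ge> 1" "s > 0"
  shows "(\<integral>\<^sup>+(x::real^2). ennreal (1 - fading_laplace \<rho> m (s * norm x powr (- \<alpha>))) \<partial>lborel) =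
    ennreal (s powr (2 / \<alpha>) * interference_rate \<alpha> \<rho> m)"
  using path_loss_integral_scale[of "\<lambda>w. ennreal (1 - fading_laplace \<rho> m w)" s \<alpha>] assms
  by (simp add: ennreal_interference_rate ennreal_mult'[symmetric])

lemma fading_laplace_tendsto:
  "(\<lambda>m. fading_laplace \<rho> m u) \<longlonglongrightarrow> exp (- (\<rho> * u))"
proof -
  have "(\<lambda>m. (1 + (\<rho> * u) / real m) ^ m) \<longlonglongrightarrow> exp (\<rho> * u)"
    by (rule tendsto_exp_limit_sequentially)
  then have "(\<lambda>m. inverse ((1 + (\<rho> * u) / real m) ^ m)) \<longlonglongrightarrow> inverse (exp (\<rho> * u))"
    by (rule tendsto_inverse) simp
  then show ?thesis
    by (simp add: fading_laplace_def exp_minus power_divide inverse_eq_divide mult.commute)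
qed

text \<open>Fading averaged over more and more streams hardens to its mean \<rho>, and the
  constant-fading integrand dominates. The sequence is shifted to \<open>Suc m\<close> because that
  domination needs at least one stream.\<close>

lemma interference_rate_tendsto:
  assumes "\<alpha> > 2" "\<rho> > 0"
  shows "(\<lambda>m. interference_rate \<alpha> \<rho> m) \<longlonglongrightarrow> \<rho> powr (2 / \<alpha>) * (pi * Gamma (1 - 2 / \<alpha>))"
proof -
  let ?G = "\<rho> powr (2 / \<alpha>) * (pi * Gamma (1 - 2 / \<alpha>))"
  have G0: "?G \<ge> 0" using assms by (intro mult_nonneg_nonneg less_imp_le[OF Gamma_real_pos]) auto
  have "(\<lambda>m. \<integral>\<^sup>+(x::real^2). ennreal (1 - fading_laplace \<rho> (Suc m) (norm x powr (- \<alpha>))) \<partial>lborel) \<longlonglongrightarrow>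
    (\<integral>\<^sup>+(x::real^2). ennreal (1 - exp (- (\<rho> * norm x powr (- \<alpha>)))) \<partial>lborel)"
  proof (rule nn_integral_dominated_convergence[where w="\<lambda>x. ennreal (1 - exp (- (\<rho> * norm x powr (- \<alpha>))))"])
    show "AE x in lborel. ennreal (1 - fading_laplace \<rho> (Suc m) (norm x powr (- \<alpha>))) \<le>
        ennreal (1 - exp (- (\<rho> * norm (x::real^2) powr (- \<alpha>))))" for m
      using fading_laplace_bounds(1) assms by (intro AE_I2 ennreal_leI) simp
    show "AE x in lborel. (\<lambda>m. ennreal (1 - fading_laplace \<rho> (Suc m) (norm x powr (- \<alpha>)))) \<longlonglongrightarrow>
        ennreal (1 - exp (- (\<rho> * norm (x::real^2) powr (- \<alpha>))))"
      by (intro AE_I2 tendsto_ennrealI tendsto_diff tendsto_const LIMSEQ_Suc[OF fading_laplace_tendsto])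
    show "(\<integral>\<^sup>+(x::real^2). ennreal (1 - exp (- (\<rho> * norm x powr (- \<alpha>)))) \<partial>lborel) < \<infinity>"
      using assms by (simp add: nn_integral_path_loss_exp_scaled)
  qed measurable
  then have "(\<lambda>m. ennreal (interference_rate \<alpha> \<rho> (Suc m))) \<longlonglongrightarrow> ennreal ?G"
    using assms by (simp add: ennreal_interference_rate nn_integral_path_loss_exp_scaled)
  then have "(\<lambda>m. interference_rate \<alpha> \<rho> (Suc m)) \<longlonglongrightarrow> ?G"
    using G0 interference_rate_nonneg by (subst (asm) tendsto_ennreal_iff) auto
  then show ?thesis by (rule LIMSEQ_imp_Suc)
qed

section \<open>The distribution of the interference\<close>

context prob_space
begin

lemma indep_var_collect:
  assumes F: "indep_sets F UNIV" "\<And>i. sigma_algebra (space M) (F i)"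
    and disj: "I \<inter> J = {}"
    and Y: "Y \<in> measurable (sigma (space M) (\<Union>i\<in>I. F i)) S"
    and Z: "Z \<in> measurable (sigma (space M) (\<Union>i\<in>J. F i)) T"
  shows "indep_var S Y T Z"
proof -
  have ev: "F i \<subseteq> events" for i using F(1) by (auto simp: indep_sets_def)
  have sub: "(\<Union>i\<in>K. F i) \<subseteq> Pow (space M)" for K
    using ev sets.sets_into_space by blast
  have sig: "sigma_sets (space M) (\<Union>i\<in>K. F i) \<subseteq> events" for K
    by (rule sets.sigma_sets_subset) (use ev in auto)
  have rv: "f \<in> measurable M U" if "f \<in> measurable (sigma (space M) (\<Union>i\<in>K. F i)) U" for f K and U :: "'x measure"
    using that sig[of K] sub[of K] by (auto simp: measurable_def sets_measure_of space_measure_of)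
  have pre: "{f -` A \<inter> space M | A. A \<in> sets U} \<subseteq> sigma_sets (space M) (\<Union>i\<in>K. F i)"
    if "f \<in> measurable (sigma (space M) (\<Union>i\<in>K. F i)) U" for f K and U :: "'x measure"
    using that sub[of K] by (auto simp: measurable_def sets_measure_of space_measure_of)
  have "indep_sets (\<lambda>b. sigma_sets (space M) (\<Union>i\<in>(if b then I else J). F i)) (UNIV :: bool set)"
  proof (rule indep_sets_collect_sigma)
    show "indep_sets F (\<Union>b\<in>UNIV. if b then I else J)"
      by (rule indep_sets_mono_index[OF _ F(1)]) simp
    show "Int_stable (F i)" for i
    proof -
      interpret sigma_algebra "space M" "F i" by (rule F(2))
      show ?thesis by (auto simp: Int_stable_def)
    qed
    show "disjoint_family_on (\<lambda>b. if b then I else J) UNIV"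
      using disj by (auto simp: disjoint_family_on_def)
  qed
  then have "indep_set (sigma_sets (space M) {Y -` A \<inter> space M | A. A \<in> sets S})
      (sigma_sets (space M) {Z -` A \<inter> space M | A. A \<in> sets T})"
    unfolding indep_set_def
    by (rule indep_sets_mono_sets) (auto split: bool.split intro!: subsetD[OF sigma_sets_mono[OF pre[OF Y]]] subsetD[OF sigma_sets_mono[OF pre[OF Z]]])
  then show ?thesis unfolding indep_var_eq using rv[OF Y] rv[OF Z] by blast
qed

lemma nn_integral_indep_var:
  assumes indep: "indep_var S Y T Z" and f[measurable]: "f \<in> borel_measurable (S \<Otimes>\<^sub>M T)"
  shows "(\<integral>\<^sup>+\<omega>. f (Y \<omega>, Z \<omega>) \<partial>M) = (\<integral>\<^sup>+\<omega>. \<integral>\<^sup>+\<omega>'. f (Y \<omega>, Z \<omega>') \<partial>M \<partial>M)"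
proof -
  have [measurable]: "Y \<in> measurable M S" "Z \<in> measurable M T"
    using indep_var_rv1[OF indep] indep_var_rv2[OF indep] by auto
  interpret Z: prob_space "distr M T Z" by (rule prob_space_distr) simp
  have "(\<integral>\<^sup>+\<omega>. f (Y \<omega>, Z \<omega>) \<partial>M) = (\<integral>\<^sup>+p. f p \<partial>distr M (S \<Otimes>\<^sub>M T) (\<lambda>\<omega>. (Y \<omega>, Z \<omega>)))"
    by (subst nn_integral_distr) auto
  also have "distr M (S \<Otimes>\<^sub>M T) (\<lambda>\<omega>. (Y \<omega>, Z \<omega>)) = distr M S Y \<Otimes>\<^sub>M distr M T Z"
    using indep by (simp add: indep_var_distribution_eq)
  also have "(\<integral>\<^sup>+p. f p \<partial>(distr M S Y \<Otimes>\<^sub>M distr M T Z)) = (\<integral>\<^sup>+y. \<integral>\<^sup>+z. f (y, z) \<partial>distr M T Z \<partial>distr M S Y)"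
    by (subst Z.nn_integral_fst[symmetric]) auto
  also have "\<dots> = (\<integral>\<^sup>+\<omega>. \<integral>\<^sup>+\<omega>'. f (Y \<omega>, Z \<omega>') \<partial>M \<partial>M)"
  proof -
    have [measurable]: "(\<lambda>y. \<integral>\<^sup>+\<omega>'. f (y, Z \<omega>') \<partial>M) \<in> borel_measurable S" by measurable
    have "(\<integral>\<^sup>+z. f (y, z) \<partial>distr M T Z) = (\<integral>\<^sup>+\<omega>'. f (y, Z \<omega>') \<partial>M)" if "y \<in> space S" for y
      using that by (subst nn_integral_distr) auto
    then have "(\<integral>\<^sup>+y. \<integral>\<^sup>+z. f (y, z) \<partial>distr M T Z \<partial>distr M S Y) = (\<integral>\<^sup>+y. \<integral>\<^sup>+\<omega>'. f (y, Z \<omega>') \<partial>M \<partial>distr M S Y)"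
      by (intro nn_integral_cong) simp
    also have "\<dots> = (\<integral>\<^sup>+\<omega>. \<integral>\<^sup>+\<omega>'. f (Y \<omega>, Z \<omega>') \<partial>M \<partial>M)"
      by (subst nn_integral_distr) auto
    finally show ?thesis .
  qed
  finally show ?thesis .
qed

text \<open>Exponential tilting turns the Erlang density of rate l into a multiple of the one of
  rate \<open>l + u\<close>; the multiple is the transform, since the zeroth moment of the new
  density is 1.\<close>

lemma erlang_laplace:
  assumes D: "distributed M lborel Y (erlang_density k l)" and l: "l > 0" and u: "u \<ge> 0"
  shows "(\<integral>\<^sup>+\<omega>. ennreal (exp (- (u * Y \<omega>))) \<partial>M) = ennreal ((l / (l + u)) ^ Suc k)"
proof -
  have "(\<integral>\<^sup>+\<omega>. ennreal (exp (- (u * Y \<omega>))) \<partial>M) =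
    (\<integral>\<^sup>+x. ennreal (erlang_density k l x) * ennreal (exp (- (u * x))) \<partial>lborel)"
    using l by (intro distributed_nn_integral[OF D, symmetric]) auto
  also have "\<dots> = (\<integral>\<^sup>+x. ennreal ((l / (l + u)) ^ Suc k) * ennreal (erlang_density k (l + u) x * x ^ 0) \<partial>lborel)"
  proof (intro nn_integral_cong)
    fix x :: real
    have "l ^ Suc k = (l / (l + u)) ^ Suc k * (l + u) ^ Suc k"
      using l u by (simp add: power_mult_distrib[symmetric] del: power_Suc)
    moreover have "exp (- l * x) * exp (- (u * x)) = exp (- (l + u) * x)"
      by (simp add: exp_add[symmetric] algebra_simps)
    ultimately have "erlang_density k l x * exp (- (u * x)) = (l / (l + u)) ^ Suc k * erlang_density k (l + u) x"
      by (auto simp: erlang_density_def simp del: power_Suc)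
    then show "ennreal (erlang_density k l x) * ennreal (exp (- (u * x))) =
      ennreal ((l / (l + u)) ^ Suc k) * ennreal (erlang_density k (l + u) x * x ^ 0)"
      using l u by (simp add: ennreal_mult''[symmetric] del: power_Suc)
  qed
  also have "\<dots> = ennreal ((l / (l + u)) ^ Suc k)"
    using l u by (subst nn_integral_cmult, simp, subst nn_integral_erlang_ith_moment) auto
  finally show ?thesis .
qed

end

lemma measurable_path_loss:
  fixes f :: "'c \<Rightarrow> 'b::euclidean_space"
  assumes [measurable]: "f \<in> borel_measurable A"
  shows "(\<lambda>\<omega>. norm (f \<omega>) powr a) \<in> borel_measurable A"
  by measurable

section \<open>Laplace transform and law of the interference in the model\<close>

locale zf_regime = zf_model +
  assumes exponent: "\<alpha> > 2" and snr: "\<rho> > 0" and distance: "r > 0"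
    and streams: "M \<ge> 1" and intensity: "\<mu> > 0"
begin

definition source_sets :: "source \<Rightarrow> 'a set set" where
  "source_sets s = (case s of
      Signal \<Rightarrow> sets (vimage_algebra (space \<Omega>) W borel)
    | Points \<Rightarrow> sets (vimage_algebra (space \<Omega>) (\<lambda>\<omega> l. X l \<omega>) (\<Pi>\<^sub>M l\<in>UNIV. borel))
    | Fading l \<Rightarrow> sets (vimage_algebra (space \<Omega>) (\<Psi> l) borel))"

text \<open>Measurability with respect to \<open>source_sigma K\<close> records that a quantity
  depends on the sources in K only. Quantities measurable for disjoint blocks are
  independent.\<close>

definition source_sigma :: "source set \<Rightarrow> 'a measure" where
  "source_sigma K = sigma (space \<Omega>) (\<Union>s\<in>K. source_sets s)"

lemma indep_source_sets: "indep_sets source_sets UNIV"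
  using independent unfolding source_sets_def[abs_def] .

lemma sigma_algebra_source_sets: "sigma_algebra (space \<Omega>) (source_sets s)"
  unfolding source_sets_def
  using sets.sigma_algebra_axioms[of "vimage_algebra (space \<Omega>) W borel"]
    sets.sigma_algebra_axioms[of "vimage_algebra (space \<Omega>) (\<lambda>\<omega> l. X l \<omega>) (\<Pi>\<^sub>M l\<in>UNIV. borel)"]
    sets.sigma_algebra_axioms[of "vimage_algebra (space \<Omega>) (\<Psi> l) borel" for l]
  by (auto split: source.split)

lemma source_sets_subset: "source_sets s \<subseteq> Pow (space \<Omega>)"
  using sigma_algebra_source_sets[of s] by (simp add: sigma_algebra_iff2)

lemma space_source_sigma [simp]: "space (source_sigma K) = space \<Omega>"
  unfolding source_sigma_def by (rule space_measure_of) (use source_sets_subset in blast)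

lemma sets_source_sigma: "s \<in> K \<Longrightarrow> source_sets s \<subseteq> sets (source_sigma K)"
  unfolding source_sigma_def by (subst sets_measure_of) (use source_sets_subset in blast)+

lemma measurable_source_sigma:
  assumes "f \<in> space \<Omega> \<rightarrow> space S" "s \<in> K" "source_sets s = sets (vimage_algebra (space \<Omega>) f S)"
  shows "f \<in> measurable (source_sigma K) S"
  using measurable_vimage_algebra1[OF assms(1)] measurable_mono[of S S "vimage_algebra (space \<Omega>) f S" "source_sigma K"]
    sets_source_sigma[OF assms(2)] assms(3) by auto

lemma measurable_W: "Signal \<in> K \<Longrightarrow> W \<in> borel_measurable (source_sigma K)"
  by (rule measurable_source_sigma) (auto simp: source_sets_def)

lemma measurable_Psi: "Fading l \<in> K \<Longrightarrow> \<Psi> l \<in> borel_measurable (source_sigma K)"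
  by (rule measurable_source_sigma) (auto simp: source_sets_def)

lemma measurable_X:
  assumes "Points \<in> K"
  shows "X l \<in> borel_measurable (source_sigma K)"
proof -
  have "(\<lambda>\<omega> l. X l \<omega>) \<in> measurable (source_sigma K) (\<Pi>\<^sub>M l\<in>UNIV. borel)"
    by (rule measurable_source_sigma[OF _ assms]) (auto simp: source_sets_def space_PiM)
  then have "(\<lambda>\<omega>. (\<lambda>l. X l \<omega>) l) \<in> borel_measurable (source_sigma K)"
    by (rule measurable_compose[OF _ measurable_component_singleton[of l]]) simp
  then show ?thesis by simp
qed

lemma measurable_source_sigma_imp:
  assumes "f \<in> measurable (source_sigma K) S" shows "f \<in> measurable \<Omega> S"
proof -
  have "source_sets s \<subseteq> events" for s using indep_source_sets by (auto simp: indep_sets_def)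
  moreover have "(\<Union>s\<in>K. source_sets s) \<subseteq> Pow (space \<Omega>)" using source_sets_subset by blast
  ultimately have "sets (source_sigma K) \<subseteq> events"
    unfolding source_sigma_def by (auto simp: sets_measure_of intro!: sets.sigma_sets_subset)
  then show ?thesis using assms measurable_mono[of S S "source_sigma K" \<Omega>] by auto
qed

lemma indep_source_sigma:
  assumes "K \<inter> L = {}" "Y \<in> measurable (source_sigma K) S" "Z \<in> measurable (source_sigma L) T"
  shows "indep_var S Y T Z"
  using indep_var_collect[OF indep_source_sets sigma_algebra_source_sets assms(1)] assms(2,3)
  unfolding source_sigma_def by blast

definition partial_interference :: "nat \<Rightarrow> 'a \<Rightarrow> real" where
  "partial_interference n \<omega> = (\<Sum>l<n. norm (X l \<omega>) powr (- \<alpha>) * \<Psi> l \<omega>)"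

definition interference :: "'a \<Rightarrow> real" where
  "interference \<omega> = (\<Sum>l. norm (X l \<omega>) powr (- \<alpha>) * \<Psi> l \<omega>)"

lemma measurable_partial_interference:
  "insert Points (Fading ` {..<n}) \<subseteq> K \<Longrightarrow> partial_interference n \<in> borel_measurable (source_sigma K)"
  unfolding partial_interference_def
  by (intro borel_measurable_sum borel_measurable_times measurable_path_loss measurable_X measurable_Psi) auto

lemma measurable_interference:
  "insert Points (range Fading) \<subseteq> K \<Longrightarrow> interference \<in> borel_measurable (source_sigma K)"
  unfolding interference_def
  by (intro borel_measurable_suminf borel_measurable_times measurable_path_loss measurable_X measurable_Psi) auto

lemma measurable_sources [measurable]:
  "W \<in> borel_measurable \<Omega>" "X l \<in> borel_measurable \<Omega>" "\<Psi> l \<in> borel_measurable \<Omega>"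
  "partial_interference n \<in> borel_measurable \<Omega>" "interference \<in> borel_measurable \<Omega>"
  by (auto intro!: measurable_source_sigma_imp[of _ UNIV] measurable_W measurable_X measurable_Psi
      measurable_partial_interference measurable_interference)

lemma Psi_nonneg: "AE \<omega> in \<Omega>. 0 \<le> \<Psi> l \<omega>"
proof -
  have "AE x in distr \<Omega> lborel (\<Psi> l). 0 \<le> x"
    unfolding distributed_distr_eq_density[OF fading]
    by (subst AE_density) (auto simp: gamma_density_def erlang_density_def)
  then show ?thesis by (subst (asm) AE_distr_iff) auto
qed

lemma Psi_laplace:
  assumes "u \<ge> 0"
  shows "(\<integral>\<^sup>+\<omega>. ennreal (exp (- (u * \<Psi> l \<omega>))) \<partial>\<Omega>) = ennreal (fading_laplace \<rho> M u)"
proof -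
  let ?l = "1 / (\<rho> / real M)"
  have l: "?l > 0" using snr streams by simp
  have "?l / (?l + u) = 1 / (1 + u * (\<rho> / real M))"
    using snr streams assms by (simp add: field_simps add_pos_nonneg)
  then show ?thesis
    using erlang_laplace[OF fading[unfolded gamma_density_def] l assms] streams
    by (simp add: fading_laplace_def)
qed

text \<open>The fading variables are integrated out one at a time, given the points. The arbitrary
  weight Z carries the induction: the factor produced by \<open>\<Psi> n\<close> depends on the
  points only and is absorbed into Z before the induction hypothesis is applied.\<close>

lemma partial_interference_laplace:
  assumes s: "s > 0"
  shows "Z \<in> borel_measurable (source_sigma {Points}) \<Longrightarrow>
    (\<integral>\<^sup>+\<omega>. Z \<omega> * ennreal (exp (- (s * partial_interference n \<omega>))) \<partial>\<Omega>) =
    (\<integral>\<^sup>+\<omega>. Z \<omega> * ennreal (\<Prod>l<n. fading_laplace \<rho> M (s * norm (X l \<omega>) powr (- \<alpha>))) \<partial>\<Omega>)"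
proof (induction n arbitrary: Z)
  case 0
  show ?case by (simp add: partial_interference_def)
next
  case (Suc n)
  let ?K = "insert Points (Fading ` {..<n})"
  define a where "a l \<omega> = s * norm (X l \<omega>) powr (- \<alpha>)" for l \<omega>
  have a0: "a l \<omega> \<ge> 0" for l \<omega> using s by (simp add: a_def)
  have aK: "a l \<in> borel_measurable (source_sigma K)" if "Points \<in> K" for l K
    unfolding a_def[abs_def]
    by (intro borel_measurable_times measurable_path_loss measurable_X that) auto
  define Y where "Y \<omega> = Z \<omega> * ennreal (exp (- (s * partial_interference n \<omega>)))" for \<omega>
  have "sets (source_sigma K) = sigma_sets (space \<Omega>) (\<Union>s\<in>K. source_sets s)" for K
    unfolding source_sigma_def by (rule sets_measure_of) (use source_sets_subset in blast)
  then have "sets (source_sigma {Points}) \<subseteq> sets (source_sigma ?K)"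
    by (simp only:) (intro sigma_sets_mono', auto)
  then have ZK: "Z \<in> borel_measurable (source_sigma ?K)"
    using Suc.prems measurable_mono[of borel borel "source_sigma {Points}" "source_sigma ?K"] by auto
  have [measurable]: "(\<lambda>x. ennreal (exp (- (s * x)))) \<in> borel_measurable borel" by measurable
  have YK: "Y \<in> borel_measurable (source_sigma ?K)"
    unfolding Y_def[abs_def]
    by (intro borel_measurable_times_ennreal ZK measurable_compose[OF measurable_partial_interference])
      (auto intro: measurable_compose)
  \<comment> \<open>\<open>indep_var\<close> needs both variables in the same type, hence the dummy component \<open>0\<close>.\<close>
  have indep: "indep_var (borel \<Otimes>\<^sub>M borel) (\<lambda>\<omega>. (Y \<omega>, a n \<omega>)) (borel \<Otimes>\<^sub>M borel) (\<lambda>\<omega>. (0, \<Psi> n \<omega>))"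
    by (rule indep_source_sigma[of ?K "{Fading n}"])
      (auto intro!: measurable_Pair YK aK measurable_Psi)
  have "Z \<omega> * ennreal (exp (- (s * partial_interference (Suc n) \<omega>))) =
    Y \<omega> * ennreal (exp (- (a n \<omega> * \<Psi> n \<omega>)))" for \<omega>
    by (simp add: Y_def a_def partial_interference_def mult.assoc ennreal_mult'[symmetric] exp_add[symmetric] distrib_left)
  then have "(\<integral>\<^sup>+\<omega>. Z \<omega> * ennreal (exp (- (s * partial_interference (Suc n) \<omega>))) \<partial>\<Omega>) =
    (\<integral>\<^sup>+\<omega>. Y \<omega> * ennreal (exp (- (a n \<omega> * \<Psi> n \<omega>))) \<partial>\<Omega>)" by simp
  also have "\<dots> = (\<integral>\<^sup>+\<omega>. \<integral>\<^sup>+\<omega>'. Y \<omega> * ennreal (exp (- (a n \<omega> * \<Psi> n \<omega>'))) \<partial>\<Omega> \<partial>\<Omega>)"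
    using nn_integral_indep_var[OF indep, of "\<lambda>p. fst (fst p) * ennreal (exp (- (snd (fst p) * snd (snd p))))"] by simp
  also have "\<dots> = (\<integral>\<^sup>+\<omega>. Y \<omega> * ennreal (fading_laplace \<rho> M (a n \<omega>)) \<partial>\<Omega>)"
    by (simp add: nn_integral_cmult Psi_laplace a0)
  also have "\<dots> = (\<integral>\<^sup>+\<omega>. (Z \<omega> * ennreal (fading_laplace \<rho> M (a n \<omega>))) * ennreal (exp (- (s * partial_interference n \<omega>))) \<partial>\<Omega>)"
    by (simp add: Y_def mult_ac)
  also have "\<dots> = (\<integral>\<^sup>+\<omega>. (Z \<omega> * ennreal (fading_laplace \<rho> M (a n \<omega>))) * ennreal (\<Prod>l<n. fading_laplace \<rho> M (s * norm (X l \<omega>) powr (- \<alpha>))) \<partial>\<Omega>)"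
    by (intro Suc.IH borel_measurable_times_ennreal Suc.prems measurable_compose[OF aK]) auto
  also have "\<dots> = (\<integral>\<^sup>+\<omega>. Z \<omega> * ennreal (\<Prod>l<Suc n. fading_laplace \<rho> M (s * norm (X l \<omega>) powr (- \<alpha>))) \<partial>\<Omega>)"
    using fading_laplace_bounds(3)[OF snr streams a0]
    by (intro nn_integral_cong) (simp add: a_def[symmetric] mult.assoc ennreal_mult'[symmetric] less_imp_le mult.commute)
  finally show ?case .
qed

abbreviation (input) "rate \<equiv> interference_rate \<alpha> \<rho> M"

lemma partial_interference_laplace_INF:
  assumes s: "s > 0"
  shows "(INF n. \<integral>\<^sup>+\<omega>. ennreal (exp (- (s * partial_interference n \<omega>))) \<partial>\<Omega>) =
    ennreal (exp (- (\<mu> * (s powr (2 / \<alpha>) * rate))))"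
proof -
  \<comment> \<open>The negative logarithm turns the product of fading transforms into the
    exponential of a sum over the points, the shape required by the Laplace functional.\<close>
  define g where "g x = - ln (fading_laplace \<rho> M (s * norm (x::real^2) powr (- \<alpha>)))" for x
  have b: "fading_laplace \<rho> M (s * norm x powr (- \<alpha>)) \<le> 1" "0 < fading_laplace \<rho> M (s * norm x powr (- \<alpha>))" for x :: "real^2"
    using fading_laplace_bounds(2,3)[OF snr streams] s by auto
  have eg: "exp (- g x) = fading_laplace \<rho> M (s * norm x powr (- \<alpha>))" for x
    using b by (simp add: g_def)
  have "(\<integral>\<^sup>+\<omega>. ennreal (exp (- (s * partial_interference n \<omega>))) \<partial>\<Omega>) =
    (\<integral>\<^sup>+\<omega>. ennreal (exp (- (\<Sum>l<n. g (X l \<omega>)))) \<partial>\<Omega>)" for n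
    using partial_interference_laplace[OF s, of "\<lambda>_. 1" n] by (simp add: eg exp_sum sum_negf[symmetric])
  then have "(INF n. \<integral>\<^sup>+\<omega>. ennreal (exp (- (s * partial_interference n \<omega>))) \<partial>\<Omega>) =
    (INF n. \<integral>\<^sup>+\<omega>. ennreal (exp (- (\<Sum>l<n. g (X l \<omega>)))) \<partial>\<Omega>)" by simp
  also have "\<dots> = ennreal (exp (- (\<mu> * (s powr (2 / \<alpha>) * rate))))"
  proof (rule poisson_laplace[OF points intensity])
    show "g \<in> borel_measurable borel" unfolding g_def[abs_def] by measurable
    show "0 \<le> g x" for x using b by (simp add: g_def)
    show "(\<integral>\<^sup>+x. ennreal (1 - exp (- g x)) \<partial>lborel) = ennreal (s powr (2 / \<alpha>) * rate)"
      unfolding eg by (rule nn_integral_fading_laplace_scaled[OF exponent snr streams s])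
  qed (simp add: interference_rate_nonneg)
  finally show ?thesis .
qed

lemma terms_nonneg: "AE \<omega> in \<Omega>. \<forall>l. 0 \<le> norm (X l \<omega>) powr (- \<alpha>) * \<Psi> l \<omega>"
  unfolding AE_all_countable
proof
  fix l show "AE \<omega> in \<Omega>. 0 \<le> norm (X l \<omega>) powr (- \<alpha>) * \<Psi> l \<omega>"
    using Psi_nonneg[of l] by eventually_elim simp
qed

lemma nn_integral_INF_partial_interference:
  assumes s: "s > 0"
  shows "(\<integral>\<^sup>+\<omega>. (INF n. ennreal (exp (- (s * partial_interference n \<omega>)))) \<partial>\<Omega>) =
    ennreal (exp (- (\<mu> * (s powr (2 / \<alpha>) * rate))))"
proof -
  have "(\<integral>\<^sup>+\<omega>. (INF n. ennreal (exp (- (s * partial_interference n \<omega>)))) \<partial>\<Omega>) =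
    (INF n. \<integral>\<^sup>+\<omega>. ennreal (exp (- (s * partial_interference n \<omega>))) \<partial>\<Omega>)"
  proof (rule nn_integral_monotone_convergence_INF_AE[where i=0])
    show "AE \<omega> in \<Omega>. ennreal (exp (- (s * partial_interference (Suc i) \<omega>))) \<le> ennreal (exp (- (s * partial_interference i \<omega>)))" for i
      using terms_nonneg by eventually_elim (use s in \<open>auto intro!: ennreal_leI mult_left_mono simp: partial_interference_def\<close>)
    show "(\<integral>\<^sup>+\<omega>. ennreal (exp (- (s * partial_interference 0 \<omega>))) \<partial>\<Omega>) < \<infinity>"
      by (simp add: partial_interference_def emeasure_space_1)
  qed measurable
  then show ?thesis using partial_interference_laplace_INF[OF s] by simp
qed

text \<open>On a divergent series \<open>interference\<close> has an unspecified value, so the limit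
  of the exponentials is treated separately from \<open>exp (- (s * interference \<omega>))\<close>.
  With nonnegative terms the partial sums then tend to infinity and the limit is 0.\<close>

lemma INF_exp_partial_interference:
  assumes s: "s > 0" and nn: "\<And>l. 0 \<le> norm (X l \<omega>) powr (- \<alpha>) * \<Psi> l \<omega>"
  shows "summable (\<lambda>l. norm (X l \<omega>) powr (- \<alpha>) * \<Psi> l \<omega>) \<Longrightarrow>
      (INF n. ennreal (exp (- (s * partial_interference n \<omega>)))) = ennreal (exp (- (s * interference \<omega>)))"
    and "\<not> summable (\<lambda>l. norm (X l \<omega>) powr (- \<alpha>) * \<Psi> l \<omega>) \<Longrightarrow>
      (INF n. ennreal (exp (- (s * partial_interference n \<omega>)))) = 0"
proof -
  let ?t = "\<lambda>l. norm (X l \<omega>) powr (- \<alpha>) * \<Psi> l \<omega>"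
  have lim: "(\<lambda>n. ennreal (exp (- (s * partial_interference n \<omega>)))) \<longlonglongrightarrow>
      (INF n. ennreal (exp (- (s * partial_interference n \<omega>))))"
    by (intro LIMSEQ_INF decseq_SucI ennreal_leI)
      (use s nn in \<open>auto simp: partial_interference_def intro!: mult_left_mono\<close>)
  {
    assume "summable ?t"
    then have "(\<lambda>n. partial_interference n \<omega>) \<longlonglongrightarrow> interference \<omega>"
      unfolding partial_interference_def interference_def by (rule summable_LIMSEQ)
    then have "(\<lambda>n. ennreal (exp (- (s * partial_interference n \<omega>)))) \<longlonglongrightarrow> ennreal (exp (- (s * interference \<omega>)))"
      by (intro tendsto_ennrealI tendsto_intros)
    from LIMSEQ_unique[OF lim this]
    show "(INF n. ennreal (exp (- (s * partial_interference n \<omega>)))) = ennreal (exp (- (s * interference \<omega>)))" .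
  next
    assume ns: "\<not> summable ?t"
    have "filterlim (\<lambda>n. partial_interference n \<omega>) at_top sequentially"
      unfolding filterlim_at_top
    proof
      fix Z
      have "\<exists>n. Z < partial_interference n \<omega>"
      proof (rule ccontr)
        assume "\<nexists>n. Z < partial_interference n \<omega>"
        then have "summable ?t"
          by (intro summableI_nonneg_bounded[where x=Z]) (auto simp: nn partial_interference_def not_less)
        with ns show False ..
      qed
      then obtain n where n: "Z < partial_interference n \<omega>" ..
      have "Z \<le> partial_interference m \<omega>" if "m \<ge> n" for m
      proof -
        have "partial_interference n \<omega> \<le> partial_interference m \<omega>"
          unfolding partial_interference_def using that nn by (intro sum_mono2) auto
        then show ?thesis using n by simp
      qed
      then show "\<forall>\<^sub>F n in sequentially. Z \<le> partial_interference n \<omega>"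
        by (auto simp: eventually_sequentially)
    qed
    then have "filterlim (\<lambda>n. s * partial_interference n \<omega>) at_top sequentially"
      by (rule filterlim_tendsto_pos_mult_at_top[OF tendsto_const s])
    then have "filterlim (\<lambda>n. - (s * partial_interference n \<omega>)) at_bot sequentially"
      by (simp add: filterlim_uminus_at_top)
    then have "(\<lambda>n. exp (- (s * partial_interference n \<omega>))) \<longlonglongrightarrow> 0"
      by (rule filterlim_compose[OF exp_at_bot])
    then have "(\<lambda>n. ennreal (exp (- (s * partial_interference n \<omega>)))) \<longlonglongrightarrow> ennreal 0"
      by (rule tendsto_ennrealI)
    from LIMSEQ_unique[OF lim this]
    show "(INF n. ennreal (exp (- (s * partial_interference n \<omega>)))) = 0" by simp
  }
qed

text \<open>Where the series diverges, the limit of the exponentials vanishes; letting \<open>s\<close> tend to \<open>0\<close> shows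
  that this happens with probability \<open>0\<close>.\<close>
lemma summable_interference: "AE \<omega> in \<Omega>. summable (\<lambda>l. norm (X l \<omega>) powr (- \<alpha>) * \<Psi> l \<omega>)"
proof -
  let ?S = "{\<omega> \<in> space \<Omega>. summable (\<lambda>l. norm (X l \<omega>) powr (- \<alpha>) * \<Psi> l \<omega>)}"
  have [measurable]: "?S \<in> events" unfolding summable_iff_convergent Cauchy_convergent_iff[symmetric] by measurable
  have le: "exp (- (\<mu> * (s powr (2 / \<alpha>) * rate))) \<le> prob ?S" if s: "s > 0" for s
  proof -
    have "ennreal (exp (- (\<mu> * (s powr (2 / \<alpha>) * rate)))) =
      (\<integral>\<^sup>+\<omega>. (INF n. ennreal (exp (- (s * partial_interference n \<omega>)))) \<partial>\<Omega>)"
      by (rule nn_integral_INF_partial_interference[OF s, symmetric])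
    also have "\<dots> \<le> (\<integral>\<^sup>+\<omega>. indicator ?S \<omega> \<partial>\<Omega>)"
    proof (rule nn_integral_mono_AE, use terms_nonneg AE_space in eventually_elim)
      fix \<omega> assume nn: "\<forall>l. 0 \<le> norm (X l \<omega>) powr (- \<alpha>) * \<Psi> l \<omega>" and sp: "\<omega> \<in> space \<Omega>"
      show "(INF n. ennreal (exp (- (s * partial_interference n \<omega>)))) \<le> indicator ?S \<omega>"
      proof (cases "\<omega> \<in> ?S")
        case True
        have "(INF n. ennreal (exp (- (s * partial_interference n \<omega>)))) \<le> ennreal (exp (- (s * partial_interference 0 \<omega>)))"
          by (rule INF_lower) simp
        then show ?thesis using True by (simp add: partial_interference_def)
      next
        case False
        then show ?thesis using INF_exp_partial_interference(2)[OF s, of \<omega>] nn sp by simp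
      qed
    qed
    also have "\<dots> = ennreal (prob ?S)" by (simp add: emeasure_eq_measure)
    finally show ?thesis by (simp add: ennreal_le_iff2)
  qed
  have "((\<lambda>s. exp (- (\<mu> * (s powr (2 / \<alpha>) * rate)))) \<longlongrightarrow> exp (- (\<mu> * (0 * rate)))) (at_right 0)"
    using exponent by (intro tendsto_intros tendsto_zero_powrI[where b="2 / \<alpha>"] tendsto_ident_at tendsto_const)
      (auto intro: eventually_mono[OF eventually_at_right_less[of 0]])
  then have "1 \<le> prob ?S"
    by (intro tendsto_upperbound[of "\<lambda>s. exp (- (\<mu> * (s powr (2 / \<alpha>) * rate)))" 1 "at_right 0"])
      (auto intro!: eventually_mono[OF eventually_at_right_less[of 0]] le)
  then have "prob ?S = 1" using prob_le_1[of ?S] by linarith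
  then show ?thesis by (subst (asm) prob_Collect_eq_1) auto
qed

lemma interference_nonneg: "AE \<omega> in \<Omega>. 0 \<le> interference \<omega>"
  using terms_nonneg summable_interference
  by eventually_elim (auto simp: interference_def intro: suminf_nonneg)

lemma interference_laplace:
  assumes s: "s > 0"
  shows "(\<integral>\<^sup>+\<omega>. ennreal (exp (- (s * interference \<omega>))) \<partial>\<Omega>) = ennreal (exp (- (\<mu> * (s powr (2 / \<alpha>) * rate))))"
proof -
  have "(\<integral>\<^sup>+\<omega>. ennreal (exp (- (s * interference \<omega>))) \<partial>\<Omega>) =
     (\<integral>\<^sup>+\<omega>. (INF n. ennreal (exp (- (s * partial_interference n \<omega>)))) \<partial>\<Omega>)"
    using terms_nonneg summable_interference
    by (intro nn_integral_cong_AE, eventually_elim) (auto intro!: INF_exp_partial_interference(1)[symmetric] s)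
  then show ?thesis using nn_integral_INF_partial_interference[OF s] by simp
qed

text \<open>Dividing by \<open>(\<mu> * rate) powr (\<alpha> / 2)\<close> cancels the factor
  \<open>\<mu> * rate\<close> in the exponent, because \<alpha> / 2 is the reciprocal of the
  index.\<close>

lemma one_sided_stable_interference:
  assumes "rate > 0"
  shows "one_sided_stable (distr \<Omega> borel (\<lambda>\<omega>. interference \<omega> / (\<mu> * rate) powr (\<alpha> / 2))) (2 / \<alpha>)"
proof -
  let ?c = "(\<mu> * rate) powr (\<alpha> / 2)"
  have c: "?c > 0" using assms intensity by simp
  have "real_distribution (distr \<Omega> borel (\<lambda>\<omega>. interference \<omega> / ?c))"
    by (rule real_distribution_distr) measurable
  then show ?thesis
  proof (unfold one_sided_stable_def one_sided_stable_axioms_def, intro conjI allI impI)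
    show "0 < 2 / \<alpha>" "2 / \<alpha> < 1" using exponent by auto
    show "AE x in distr \<Omega> borel (\<lambda>\<omega>. interference \<omega> / ?c). 0 \<le> x"
      using interference_nonneg c by (subst AE_distr_iff) auto
    fix s :: real assume s: "0 < s"
    have "(\<integral>\<^sup>+x. ennreal (exp (- (s * x))) \<partial>distr \<Omega> borel (\<lambda>\<omega>. interference \<omega> / ?c)) =
      (\<integral>\<^sup>+\<omega>. ennreal (exp (- ((s / ?c) * interference \<omega>))) \<partial>\<Omega>)"
      by (subst nn_integral_distr) auto
    also have "\<dots> = ennreal (exp (- (\<mu> * ((s / ?c) powr (2 / \<alpha>) * rate))))"
      using s c by (intro interference_laplace) simp
    also have "\<mu> * ((s / ?c) powr (2 / \<alpha>) * rate) = s powr (2 / \<alpha>)"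
      using s c assms intensity exponent by (simp add: powr_divide powr_powr)
    finally show "(\<integral>\<^sup>+x. ennreal (exp (- (s * x))) \<partial>distr \<Omega> borel (\<lambda>\<omega>. interference \<omega> / ?c)) = ennreal (exp (- (s powr (2 / \<alpha>))))" .
  qed
qed

text \<open>By uniqueness of Laplace transforms P may be any stable law of this index, on whatever
  space it arose. One P thus serves every antenna number and intensity.\<close>

lemma distr_interference:
  assumes "rate > 0" "one_sided_stable P (2 / \<alpha>)"
  shows "distr \<Omega> borel interference = distr P borel (\<lambda>y. (\<mu> * rate) powr (\<alpha> / 2) * y)"
proof -
  let ?c = "(\<mu> * rate) powr (\<alpha> / 2)"
  let ?Q = "distr \<Omega> borel (\<lambda>\<omega>. interference \<omega> / ?c)"
  have c: "?c > 0" using assms intensity by simp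
  interpret P: one_sided_stable P "2 / \<alpha>" by fact
  interpret Q: one_sided_stable ?Q "2 / \<alpha>" by (rule one_sided_stable_interference) fact
  have "?Q = P"
  proof (rule real_distribution_eq_of_laplace[OF Q.real_distribution_axioms P.real_distribution_axioms Q.nonneg P.nonneg])
    show "(\<integral>\<^sup>+x. ennreal (exp (- (real n * x))) \<partial>?Q) = (\<integral>\<^sup>+x. ennreal (exp (- (real n * x))) \<partial>P)" for n
      using Q.laplace[of "real n"] P.laplace[of "real n"] Q.emeasure_space_1 P.emeasure_space_1
      by (cases "n = 0") (auto simp: emeasure_space_1)
  qed
  then have "distr P borel (\<lambda>y. ?c * y) = distr ?Q borel (\<lambda>y. ?c * y)" by simp
  also have "\<dots> = distr \<Omega> borel interference"
    using c by (subst distr_distr) (auto simp: o_def)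
  finally show ?thesis ..
qed

text \<open>The interference depends on points and fading only and is independent of W. Conditioning
  on it, outage is the event that W is at most \<open>\<beta> * (1 + interference \<omega>)\<close>,
  since the denominator of the SINR is positive almost surely.\<close>

lemma outage_prob_eq:
  assumes \<beta>: "\<beta> > 0" and "rate > 0" and P: "one_sided_stable P (2 / \<alpha>)"
  shows "outage_prob \<Omega> \<alpha> \<beta> W X \<Psi> =
    (\<integral>y. erlang_CDF (N - M) (real M * r powr \<alpha> / \<rho>) (\<beta> * (1 + (\<mu> * rate) powr (\<alpha> / 2) * y)) \<partial>P)"
proof -
  interpret P: one_sided_stable P "2 / \<alpha>" by fact
  let ?k = "N - M" and ?l = "real M * r powr \<alpha> / \<rho>" and ?c = "(\<mu> * rate) powr (\<alpha> / 2)"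
  have l: "?l > 0" using snr streams distance by simp
  have D: "distributed \<Omega> lborel W (erlang_density ?k ?l)"
    using signal by (simp add: gamma_density_def)
  have [measurable]: "erlang_CDF ?k ?l \<in> borel_measurable borel"
    unfolding erlang_CDF_def[abs_def] by measurable
  have "outage_prob \<Omega> \<alpha> \<beta> W X \<Psi> = prob {\<omega> \<in> space \<Omega>. W \<omega> / (interference \<omega> + 1) \<le> \<beta>}"
    unfolding outage_prob_def sinr_def interference_def ..
  also have "\<dots> = prob {\<omega> \<in> space \<Omega>. W \<omega> \<le> \<beta> * (1 + interference \<omega>)}"
    using interference_nonneg
    by (intro measure_eq_AE) (auto elim!: eventually_mono simp: divide_le_eq add.commute)
  finally have "ennreal (outage_prob \<Omega> \<alpha> \<beta> W X \<Psi>) =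
    emeasure \<Omega> {\<omega> \<in> space \<Omega>. W \<omega> \<le> \<beta> * (1 + interference \<omega>)}"
    by (simp add: emeasure_eq_measure)
  also have "\<dots> = (\<integral>\<^sup>+\<omega>. indicator {\<omega> \<in> space \<Omega>. W \<omega> \<le> \<beta> * (1 + interference \<omega>)} \<omega> \<partial>\<Omega>)"
    by simp
  also have "\<dots> = (\<integral>\<^sup>+\<omega>. indicator {p. snd p \<le> \<beta> * (1 + fst p)} (interference \<omega>, W \<omega>) \<partial>\<Omega>)"
    by (intro nn_integral_cong) (auto split: split_indicator)
  also have "\<dots> = (\<integral>\<^sup>+\<omega>. \<integral>\<^sup>+\<omega>'. indicator {p. snd p \<le> \<beta> * (1 + fst p)} (interference \<omega>, W \<omega>') \<partial>\<Omega> \<partial>\<Omega>)"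
  proof (rule nn_integral_indep_var)
    show "indep_var borel interference borel W"
      by (rule indep_source_sigma[of "- {Signal}" "{Signal}"])
        (auto intro!: measurable_interference measurable_W)
  qed measurable
  also have "\<dots> = (\<integral>\<^sup>+\<omega>. ennreal (erlang_CDF ?k ?l (\<beta> * (1 + interference \<omega>))) \<partial>\<Omega>)"
  proof (rule nn_integral_cong_AE, use interference_nonneg in eventually_elim)
    fix \<omega> assume "0 \<le> interference \<omega>"
    then have "0 \<le> \<beta> * (1 + interference \<omega>)" using \<beta> by simp
    from erlang_distributed_le[OF D l this]
    have "ennreal (erlang_CDF ?k ?l (\<beta> * (1 + interference \<omega>))) = emeasure \<Omega> {\<omega>' \<in> space \<Omega>. W \<omega>' \<le> \<beta> * (1 + interference \<omega>)}"
      by (simp add: emeasure_eq_measure)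
    also have "\<dots> = (\<integral>\<^sup>+\<omega>'. indicator {\<omega>' \<in> space \<Omega>. W \<omega>' \<le> \<beta> * (1 + interference \<omega>)} \<omega>' \<partial>\<Omega>)" by simp
    also have "\<dots> = (\<integral>\<^sup>+\<omega>'. indicator {p. snd p \<le> \<beta> * (1 + fst p)} (interference \<omega>, W \<omega>') \<partial>\<Omega>)"
      by (intro nn_integral_cong) (auto split: split_indicator)
    finally show "(\<integral>\<^sup>+\<omega>'. indicator {p. snd p \<le> \<beta> * (1 + fst p)} (interference \<omega>, W \<omega>') \<partial>\<Omega>) =
      ennreal (erlang_CDF ?k ?l (\<beta> * (1 + interference \<omega>)))" ..
  qed
  also have "\<dots> = (\<integral>\<^sup>+x. ennreal (erlang_CDF ?k ?l (\<beta> * (1 + x))) \<partial>distr \<Omega> borel interference)"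
    by (subst nn_integral_distr) auto
  also have "\<dots> = (\<integral>\<^sup>+y. ennreal (erlang_CDF ?k ?l (\<beta> * (1 + ?c * y))) \<partial>P)"
    unfolding distr_interference[OF assms(2,3)] by (subst nn_integral_distr) auto
  finally have "(\<integral>\<^sup>+y. ennreal (erlang_CDF ?k ?l (\<beta> * (1 + ?c * y))) \<partial>P) = ennreal (outage_prob \<Omega> \<alpha> \<beta> W X \<Psi>)" ..
  moreover have "0 \<le> outage_prob \<Omega> \<alpha> \<beta> W X \<Psi>" by (simp add: outage_prob_def)
  ultimately show ?thesis
    by (subst integral_eq_nn_integral) (auto simp: l less_imp_le intro!: AE_I2)
qed

end

section \<open>Outage against a stable interference\<close>

lemma erlang_CDF_prob:
  assumes "l > 0"
  shows "erlang_CDF k l x = measure (density lborel (erlang_density k l)) {..x}"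
proof -
  interpret prob_space "density lborel (erlang_density k l)"
    by (rule prob_space_erlang_density) fact
  show ?thesis
    using emeasure_erlang_density[OF assms, of k x] assms by (simp add: emeasure_eq_measure)
qed

lemma erlang_CDF_le_1: "l > 0 \<Longrightarrow> erlang_CDF k l x \<le> 1"
  using prob_space.prob_le_1[OF prob_space_erlang_density] by (simp add: erlang_CDF_prob)

lemma borel_measurable_erlang_CDF [measurable]: "erlang_CDF k l \<in> borel_measurable borel"
  unfolding erlang_CDF_def[abs_def] by measurable

lemma erlang_CDF_eq: "x \<ge> 0 \<Longrightarrow> erlang_CDF k l x = 1 - (\<Sum>n\<le>k. (l * x) ^ n * exp (- l * x) / fact n)"
  by (simp add: erlang_CDF_def)

text \<open>\<open>?G\<close> agrees with the distribution function on the half-line and is smooth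
  everywhere. By induction on k its derivative telescopes to the Erlang density, which is positive
  on the open interval.\<close>

lemma erlang_CDF_strict_mono:
  assumes l: "l > 0" and "0 \<le> x" "x < y"
  shows "erlang_CDF k l x < erlang_CDF k l y"
proof -
  let ?G = "\<lambda>k x. 1 - (\<Sum>n\<le>k. (l * x) ^ n * exp (- l * x) / fact n)"
  have deriv: "(?G k has_real_derivative l * (l * x) ^ k * exp (- l * x) / fact k) (at x)" for k x
  proof (induction k)
    case 0
    show ?case by (auto intro!: derivative_eq_intros)
  next
    case (Suc k)
    have "((\<lambda>x. (l * x) ^ Suc k * exp (- l * x) / fact (Suc k)) has_real_derivative
        (real (Suc k) * (l * (l * x) ^ k * exp (- l * x)) - l * (l * x) ^ Suc k * exp (- l * x)) / fact (Suc k)) (at x)"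
      by (rule derivative_eq_intros refl | simp)+
    also have "(real (Suc k) * (l * (l * x) ^ k * exp (- l * x)) - l * (l * x) ^ Suc k * exp (- l * x)) / fact (Suc k) =
        l * (l * x) ^ k * exp (- l * x) / fact k - l * (l * x) ^ Suc k * exp (- l * x) / fact (Suc k)"
      unfolding diff_divide_distrib fact_Suc of_nat_mult by simp
    finally have "((\<lambda>x. (l * x) ^ Suc k * exp (- l * x) / fact (Suc k)) has_real_derivative
        l * (l * x) ^ k * exp (- l * x) / fact k - l * (l * x) ^ Suc k * exp (- l * x) / fact (Suc k)) (at x)" .
    from DERIV_diff[OF Suc this] show ?case by (simp add: algebra_simps)
  qed
  have "?G k x < ?G k y"
  proof (rule DERIV_pos_imp_increasing_open[OF \<open>x < y\<close>])
    fix z assume "x < z" "z < y"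
    then have "0 < l * (l * z) ^ k * exp (- l * z) / fact k" using l \<open>0 \<le> x\<close> by auto
    with deriv[of k z] show "\<exists>d. (?G k has_real_derivative d) (at z) \<and> 0 < d" by blast
  qed (auto intro!: continuous_intros)
  then show ?thesis using assms by (simp add: erlang_CDF_eq)
qed

lemma erlang_CDF_tendsto:
  assumes "f \<longlonglongrightarrow> (x :: real)" "\<And>n. f n \<ge> 0"
  shows "(\<lambda>n. erlang_CDF k l (f n)) \<longlonglongrightarrow> erlang_CDF k l x"
proof -
  have "x \<ge> 0" using assms by (intro LIMSEQ_le_const[OF assms(1)]) auto
  then show ?thesis unfolding erlang_CDF_eq[OF \<open>x \<ge> 0\<close>] erlang_CDF_eq[OF assms(2)]
    by (intro tendsto_intros assms) auto
qed

text \<open>The Erlang law has mean m and variance \<open>m / l\<close>. Written this way, the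
  bounds become trivial in the limit as soon as m converges to a value other than x and the rate l
  tends to infinity.\<close>

lemma erlang_chebyshev:
  fixes k :: nat and l x :: real
  assumes l: "l > 0" and x: "x \<ge> 0"
  defines "m \<equiv> (real k + 1) / l"
  shows "x < m \<Longrightarrow> erlang_CDF k l x \<le> m / l / (m - x)\<^sup>2"
    and "m < x \<Longrightarrow> 1 - m / l / (x - m)\<^sup>2 \<le> erlang_CDF k l x"
proof -
  let ?D = "density lborel (erlang_density k l)"
  interpret prob_space ?D by (rule prob_space_erlang_density) fact
  have D: "distributed ?D lborel (\<lambda>x. x) (erlang_density k l)"
    using l by (auto simp: distributed_def distr_id2)
  have e: "expectation (\<lambda>x. x) = m"
    using erlang_ith_moment[OF l D, of 1] by (simp add: m_def add.commute)
  have v: "variance (\<lambda>x. x) = m / l"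
    using erlang_distributed_variance[OF l D] l by (simp add: m_def power2_eq_square add.commute)
  have cheb: "prob {y \<in> space ?D. a \<le> \<bar>y - m\<bar>} \<le> m / l / a\<^sup>2" if "a > 0" for a
    using Chebyshev_inequality[of "\<lambda>x. x" a] erlang_ith_moment_integrable[OF l D, of 2] that
    by (simp add: e v[unfolded e])
  {
    assume "x < m"
    have "erlang_CDF k l x = prob {..x}" using l by (simp add: erlang_CDF_prob)
    also have "\<dots> \<le> prob {y \<in> space ?D. m - x \<le> \<bar>y - m\<bar>}"
      by (rule finite_measure_mono) auto
    also have "\<dots> \<le> m / l / (m - x)\<^sup>2" using \<open>x < m\<close> by (intro cheb) simp
    finally show "erlang_CDF k l x \<le> m / l / (m - x)\<^sup>2" .
  next
    assume "m < x"
    have "1 - erlang_CDF k l x = prob (space ?D - {..x})"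
      using l by (subst prob_compl) (auto simp: erlang_CDF_prob)
    also have "\<dots> \<le> prob {y \<in> space ?D. x - m \<le> \<bar>y - m\<bar>}"
      by (rule finite_measure_mono) auto
    also have "\<dots> \<le> m / l / (x - m)\<^sup>2" using \<open>m < x\<close> by (intro cheb) simp
    finally show "1 - m / l / (x - m)\<^sup>2 \<le> erlang_CDF k l x" by simp
  }
qed

lemma erlang_CDF_at_top:
  assumes l: "l > 0" and f: "filterlim f at_top F"
  shows "((\<lambda>n. erlang_CDF k l (f n)) \<longlongrightarrow> 1) F"
proof (rule tendsto_sandwich)
  let ?m = "(real k + 1) / l"
  have "((\<lambda>x. 1 - ?m / l / (x - ?m)\<^sup>2) \<longlongrightarrow> 1) at_top" by real_asymp
  from filterlim_compose[OF this f] show "((\<lambda>n. 1 - ?m / l / (f n - ?m)\<^sup>2) \<longlongrightarrow> 1) F" .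
  have m0: "0 < ?m" using l by (simp add: add_nonneg_pos)
  show "\<forall>\<^sub>F n in F. 1 - ?m / l / (f n - ?m)\<^sup>2 \<le> erlang_CDF k l (f n)"
    using f[unfolded filterlim_at_top_dense, rule_format, of ?m]
    by eventually_elim (rule erlang_chebyshev(2)[OF l], use m0 in linarith)
  show "\<forall>\<^sub>F n in F. erlang_CDF k l (f n) \<le> 1" using l by (simp add: erlang_CDF_le_1)
qed auto

lemma erlang_CDF_concentrates:
  fixes k :: "nat \<Rightarrow> nat" and l :: "nat \<Rightarrow> real"
  assumes l: "filterlim l at_top sequentially" and m: "(\<lambda>n. (real (k n) + 1) / l n) \<longlonglongrightarrow> b"
    and x: "x \<ge> 0"
  shows "x < b \<Longrightarrow> (\<lambda>n. erlang_CDF (k n) (l n) x) \<longlonglongrightarrow> 0"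
    and "b < x \<Longrightarrow> (\<lambda>n. erlang_CDF (k n) (l n) x) \<longlonglongrightarrow> 1"
proof -
  let ?m = "\<lambda>n. (real (k n) + 1) / l n"
  have lpos: "\<forall>\<^sub>F n in sequentially. l n > 0" using l by (simp add: filterlim_at_top_dense)
  have ml: "(\<lambda>n. ?m n / l n) \<longlonglongrightarrow> 0"
    by (rule real_tendsto_divide_at_top[OF m l])
  {
    assume xb: "x < b"
    show "(\<lambda>n. erlang_CDF (k n) (l n) x) \<longlonglongrightarrow> 0"
    proof (rule tendsto_sandwich[where f="\<lambda>_. 0"])
      have "(\<lambda>n. ?m n / l n / (?m n - x)\<^sup>2) \<longlonglongrightarrow> 0 / (b - x)\<^sup>2"
        using xb by (intro tendsto_intros ml m) auto
      then show "(\<lambda>n. ?m n / l n / (?m n - x)\<^sup>2) \<longlonglongrightarrow> 0" by simp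
      show "\<forall>\<^sub>F n in sequentially. erlang_CDF (k n) (l n) x \<le> ?m n / l n / (?m n - x)\<^sup>2"
        using lpos order_tendstoD(1)[OF m xb] by eventually_elim (rule erlang_chebyshev(1)[OF _ x])
      show "\<forall>\<^sub>F n in sequentially. 0 \<le> erlang_CDF (k n) (l n) x"
        using lpos by eventually_elim simp
    qed auto
  next
    assume xb: "b < x"
    show "(\<lambda>n. erlang_CDF (k n) (l n) x) \<longlonglongrightarrow> 1"
    proof (rule tendsto_sandwich)
      have "(\<lambda>n. 1 - ?m n / l n / (x - ?m n)\<^sup>2) \<longlonglongrightarrow> 1 - 0 / (x - b)\<^sup>2"
        using xb by (intro tendsto_intros ml m) auto
      then show "(\<lambda>n. 1 - ?m n / l n / (x - ?m n)\<^sup>2) \<longlonglongrightarrow> 1" by simp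
      show "\<forall>\<^sub>F n in sequentially. 1 - ?m n / l n / (x - ?m n)\<^sup>2 \<le> erlang_CDF (k n) (l n) x"
        using lpos order_tendstoD(2)[OF m xb] by eventually_elim (rule erlang_chebyshev(2)[OF _ x])
      show "\<forall>\<^sub>F n in sequentially. erlang_CDF (k n) (l n) x \<le> 1"
        using lpos by eventually_elim (simp add: erlang_CDF_le_1)
    qed auto
  }
qed

section \<open>Outage as a function of the normalised intensity\<close>

context one_sided_stable
begin

text \<open>\<nu> stands for \<open>\<mu> * interference_rate \<alpha> \<rho> M\<close>, so that
  \<open>\<nu> powr (1 / \<delta>) * y\<close> with y distributed as P has the law of the
  interference. In this parameter only k and l depend on the antenna number.\<close>

definition outage_curve :: "nat \<Rightarrow> real \<Rightarrow> real \<Rightarrow> real \<Rightarrow> real" where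
  "outage_curve k l \<beta> \<nu> = (\<integral>y. erlang_CDF k l (\<beta> * (1 + \<nu> powr (1 / \<delta>) * y)) \<partial>P)"

lemma integrable_outage_curve:
  "l > 0 \<Longrightarrow> integrable P (\<lambda>y. erlang_CDF k l (\<beta> * (1 + \<nu> powr (1 / \<delta>) * y)))"
  by (rule integrable_const_bound[where B=1]) (simp_all add: erlang_CDF_le_1)

lemma outage_curve_strict_mono:
  assumes l: "l > 0" and \<beta>: "\<beta> > 0" and "0 \<le> \<nu>" "\<nu> < \<nu>'"
  shows "outage_curve k l \<beta> \<nu> < outage_curve k l \<beta> \<nu>'"
  unfolding outage_curve_def
proof (rule integral_less_AE_space)
  show "AE y in P. erlang_CDF k l (\<beta> * (1 + \<nu> powr (1 / \<delta>) * y)) < erlang_CDF k l (\<beta> * (1 + \<nu>' powr (1 / \<delta>) * y))"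
    using pos
  proof eventually_elim
    fix y :: real assume y: "0 < y"
    have "\<nu> powr (1 / \<delta>) < \<nu>' powr (1 / \<delta>)" using assms index by (intro powr_less_mono2) auto
    then show "erlang_CDF k l (\<beta> * (1 + \<nu> powr (1 / \<delta>) * y)) < erlang_CDF k l (\<beta> * (1 + \<nu>' powr (1 / \<delta>) * y))"
      using y \<beta> l by (intro erlang_CDF_strict_mono) (auto simp: add_nonneg_pos)
  qed
  show "emeasure P (space P) \<noteq> 0" by (simp only: emeasure_space_1) simp
qed (rule integrable_outage_curve[OF l])+

text \<open>As \<open>0 powr (1 / \<delta>)\<close> is 0, the curve extends to \<nu> = 0 with the
  interference-free outage as its value.\<close>

lemma outage_curve_0: "outage_curve k l \<beta> 0 = erlang_CDF k l \<beta>"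
  by (simp add: outage_curve_def)

lemma continuous_on_outage_curve:
  assumes l: "l > 0" and \<beta>: "\<beta> > 0"
  shows "continuous_on {0..} (outage_curve k l \<beta>)"
  unfolding continuous_on_sequentially o_def
proof (intro allI ballI impI, elim conjE)
  fix \<nu> :: "nat \<Rightarrow> real" and \<nu>0 assume \<nu>0: "\<nu>0 \<in> {0..}" and \<nu>: "\<forall>n. \<nu> n \<in> {0..}" "\<nu> \<longlonglongrightarrow> \<nu>0"
  show "(\<lambda>n. outage_curve k l \<beta> (\<nu> n)) \<longlonglongrightarrow> outage_curve k l \<beta> \<nu>0"
    unfolding outage_curve_def
  proof (rule integral_dominated_convergence[where w="\<lambda>_. 1"])
    show "AE y in P. (\<lambda>n. erlang_CDF k l (\<beta> * (1 + \<nu> n powr (1 / \<delta>) * y))) \<longlonglongrightarrow>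
        erlang_CDF k l (\<beta> * (1 + \<nu>0 powr (1 / \<delta>) * y))"
      using nonneg
    proof eventually_elim
      fix y :: real assume y: "0 \<le> y"
      have "(\<lambda>n. \<nu> n powr (1 / \<delta>)) \<longlonglongrightarrow> \<nu>0 powr (1 / \<delta>)"
        by (rule tendsto_powr2[OF \<nu>(2) tendsto_const]) (use \<nu>(1) index in auto)
      then show "(\<lambda>n. erlang_CDF k l (\<beta> * (1 + \<nu> n powr (1 / \<delta>) * y))) \<longlonglongrightarrow>
          erlang_CDF k l (\<beta> * (1 + \<nu>0 powr (1 / \<delta>) * y))"
        using y \<beta> by (intro erlang_CDF_tendsto tendsto_mult tendsto_add tendsto_const) auto
    qed
    show "AE y in P. norm (erlang_CDF k l (\<beta> * (1 + \<nu> n powr (1 / \<delta>) * y))) \<le> 1" for n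
      using l by (simp add: erlang_CDF_le_1)
  qed simp_all
qed

lemma outage_curve_at_top:
  assumes l: "l > 0" and \<beta>: "\<beta> > 0"
  shows "(\<lambda>n. outage_curve k l \<beta> (real n)) \<longlonglongrightarrow> 1"
proof -
  have "(\<lambda>n. outage_curve k l \<beta> (real n)) \<longlonglongrightarrow> (\<integral>y. 1 \<partial>P)"
    unfolding outage_curve_def
  proof (rule integral_dominated_convergence[where w="\<lambda>_. 1"])
    show "AE y in P. (\<lambda>n. erlang_CDF k l (\<beta> * (1 + real n powr (1 / \<delta>) * y))) \<longlonglongrightarrow> 1"
      using pos
    proof eventually_elim
      fix y :: real assume y: "0 < y"
      have "filterlim (\<lambda>x::real. \<beta> * (1 + x powr (1 / \<delta>) * y)) at_top at_top"
        using y \<beta> index by real_asymp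
      from filterlim_compose[OF this filterlim_real_sequentially]
      show "(\<lambda>n. erlang_CDF k l (\<beta> * (1 + real n powr (1 / \<delta>) * y))) \<longlonglongrightarrow> 1"
        by (intro erlang_CDF_at_top l)
    qed
    show "AE y in P. norm (erlang_CDF k l (\<beta> * (1 + real n powr (1 / \<delta>) * y))) \<le> 1" for n
      using l by (simp add: erlang_CDF_le_1)
  qed simp_all
  then show ?thesis by simp
qed

text \<open>Intermediate value theorem between the floor at \<nu> = 0 and the limit 1 at infinity.
  The strict inequality above the floor forces the solution to be positive.\<close>

lemma outage_curve_surj:
  assumes l: "l > 0" and \<beta>: "\<beta> > 0" and \<epsilon>: "erlang_CDF k l \<beta> < \<epsilon>" "\<epsilon> < 1"
  shows "\<exists>\<nu>>0. outage_curve k l \<beta> \<nu> = \<epsilon>"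
proof -
  have "\<forall>\<^sub>F n in sequentially. \<epsilon> < outage_curve k l \<beta> (real n)"
    by (rule order_tendstoD(1)[OF outage_curve_at_top[OF l \<beta>] \<epsilon>(2)])
  then obtain n where n: "\<epsilon> < outage_curve k l \<beta> (real n)"
    by (auto dest: eventually_happens)
  have "\<exists>\<nu>. 0 \<le> \<nu> \<and> \<nu> \<le> real n \<and> outage_curve k l \<beta> \<nu> = \<epsilon>"
    by (rule IVT') (use n \<epsilon> continuous_on_subset[OF continuous_on_outage_curve[OF l \<beta>]] in \<open>auto simp: outage_curve_0\<close>)
  then obtain \<nu> where \<nu>: "0 \<le> \<nu>" "outage_curve k l \<beta> \<nu> = \<epsilon>" by blast
  moreover have "\<nu> \<noteq> 0" using \<nu> \<epsilon> by (auto simp: outage_curve_0)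
  ultimately show ?thesis by (intro exI[of _ \<nu>]) auto
qed

text \<open>Given the interference, the conditional outage tends to 1 or 0 according to the side of
  b on which the threshold lies. The one undecided value of y is null because the stable law has no
  atoms, so dominated convergence gives the tail probability.\<close>

lemma outage_curve_concentrates:
  fixes k :: "nat \<Rightarrow> nat" and l :: "nat \<Rightarrow> real"
  assumes l: "filterlim l at_top sequentially" and m: "(\<lambda>n. (real (k n) + 1) / l n) \<longlonglongrightarrow> b"
    and \<beta>: "\<beta> > 0" and \<nu>: "\<nu> > 0"
  shows "(\<lambda>n. outage_curve (k n) (l n) \<beta> \<nu>) \<longlonglongrightarrow> prob {(b - \<beta>) / \<beta> / \<nu> powr (1 / \<delta>)<..}"
proof -
  let ?\<xi> = "(b - \<beta>) / \<beta> / \<nu> powr (1 / \<delta>)"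
  have lpos: "\<forall>\<^sub>F n in sequentially. l n > 0" using l by (simp add: filterlim_at_top_dense)
  have c: "\<nu> powr (1 / \<delta>) > 0" using \<nu> by simp
  have "AE y in P. y \<notin> {?\<xi>}" by (subst prob_eq_0[symmetric]) (auto simp: prob_singleton)
  \<comment> \<open>The bound by 1 needs a positive rate, which holds only eventually; the value 0
    elsewhere makes the domination valid for every n.\<close>
  then have lim: "AE y in P. (\<lambda>n. if l n > 0 then erlang_CDF (k n) (l n) (\<beta> * (1 + \<nu> powr (1 / \<delta>) * y)) else 0) \<longlonglongrightarrow>
      indicator {?\<xi><..} y"
    using nonneg
  proof eventually_elim
    fix y :: real assume ne: "y \<notin> {?\<xi>}" and y: "0 \<le> y"
    let ?x = "\<beta> * (1 + \<nu> powr (1 / \<delta>) * y)"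
    have x0: "?x \<ge> 0" using y \<beta> by simp
    have ev: "\<forall>\<^sub>F n in sequentially. erlang_CDF (k n) (l n) ?x = (if l n > 0 then erlang_CDF (k n) (l n) ?x else 0)"
      using lpos by eventually_elim simp
    have iff: "?\<xi> < y \<longleftrightarrow> b < ?x"
    proof -
      have "?\<xi> < y \<longleftrightarrow> (b - \<beta>) / \<beta> < y * \<nu> powr (1 / \<delta>)" by (rule pos_divide_less_eq[OF c])
      also have "\<dots> \<longleftrightarrow> b - \<beta> < y * \<nu> powr (1 / \<delta>) * \<beta>" by (rule pos_divide_less_eq[OF \<beta>])
      finally show ?thesis by (simp add: algebra_simps)
    qed
    have iff': "y < ?\<xi> \<longleftrightarrow> ?x < b"
    proof -
      have "y < ?\<xi> \<longleftrightarrow> y * \<nu> powr (1 / \<delta>) < (b - \<beta>) / \<beta>" by (rule pos_less_divide_eq[OF c])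
      also have "\<dots> \<longleftrightarrow> y * \<nu> powr (1 / \<delta>) * \<beta> < b - \<beta>" by (rule pos_less_divide_eq[OF \<beta>])
      finally show ?thesis by (simp add: algebra_simps)
    qed
    show "(\<lambda>n. if l n > 0 then erlang_CDF (k n) (l n) ?x else 0) \<longlonglongrightarrow> indicator {?\<xi><..} y"
    proof (cases "?\<xi> < y")
      case True
      then have "(\<lambda>n. erlang_CDF (k n) (l n) ?x) \<longlonglongrightarrow> 1"
        using erlang_CDF_concentrates(2)[OF l m x0] iff by blast
      then show ?thesis using True by (auto intro: Lim_transform_eventually[OF _ ev])
    next
      case False
      then have "?x < b" using ne iff' by auto
      then have "(\<lambda>n. erlang_CDF (k n) (l n) ?x) \<longlonglongrightarrow> 0"
        using erlang_CDF_concentrates(1)[OF l m x0] by blast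
      then show ?thesis using False by (auto intro: Lim_transform_eventually[OF _ ev])
    qed
  qed
  have "(\<lambda>n. \<integral>y. (if l n > 0 then erlang_CDF (k n) (l n) (\<beta> * (1 + \<nu> powr (1 / \<delta>) * y)) else 0) \<partial>P) \<longlonglongrightarrow>
    (\<integral>y. indicator {?\<xi><..} y \<partial>P)"
    by (rule integral_dominated_convergence[where w="\<lambda>_. 1", OF _ _ _ lim]) (auto simp: erlang_CDF_le_1)
  then have "(\<lambda>n. \<integral>y. (if l n > 0 then erlang_CDF (k n) (l n) (\<beta> * (1 + \<nu> powr (1 / \<delta>) * y)) else 0) \<partial>P) \<longlonglongrightarrow>
    prob {?\<xi><..}" by simp
  moreover have "\<forall>\<^sub>F n in sequentially. (\<integral>y. (if l n > 0 then erlang_CDF (k n) (l n) (\<beta> * (1 + \<nu> powr (1 / \<delta>) * y)) else 0) \<partial>P) =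
      outage_curve (k n) (l n) \<beta> \<nu>"
    using lpos by eventually_elim (simp add: outage_curve_def)
  ultimately show ?thesis by (rule Lim_transform_eventually)
qed

lemma tail_strict_antimono:
  assumes "0 < x" "x < y"
  shows "prob {y<..} < prob {x<..}"
proof -
  have "{x<..} = {x<..y} \<union> {y<..}" using assms by auto
  moreover have "prob ({x<..y} \<union> {y<..}) = prob {x<..y} + prob {y<..}"
    by (rule finite_measure_Union) auto
  ultimately have "prob {x<..} = prob {x<..y} + prob {y<..}" by presburger
  then show ?thesis using prob_Ioc_pos[OF assms] by simp
qed

lemma tail_quantile:
  assumes "0 < \<epsilon>" "\<epsilon> < 1"
  shows "\<exists>x>0. prob {x<..} = \<epsilon>"
proof -
  have tail: "prob {x<..} = 1 - cdf P x" for x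
    using prob_compl[of "{..x}"] by (simp add: cdf_def Compl_eq_Diff_UNIV[symmetric])
  have "\<forall>\<^sub>F x in at_top. 1 - \<epsilon> < cdf P x"
    by (rule order_tendstoD(1)[OF cdf_lim_at_top_prob]) (use assms in simp)
  then have "\<forall>\<^sub>F x in at_top. 1 - \<epsilon> < cdf P x \<and> 0 < x"
    by (rule eventually_conj[OF _ eventually_gt_at_top])
  then obtain b where b: "1 - \<epsilon> < cdf P b" "0 < b"
    by (auto dest!: eventually_happens)
  have c0: "cdf P 0 = 0"
  proof -
    have "AE y in P. y \<notin> {..0}" using pos by eventually_elim auto
    then show ?thesis unfolding cdf_def by (subst prob_eq_0) auto
  qed
  have "\<exists>x. 0 \<le> x \<and> x \<le> b \<and> cdf P x = 1 - \<epsilon>"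
    by (rule IVT) (use b c0 assms in \<open>auto simp: isCont_cdf prob_singleton\<close>)
  then obtain x where x: "0 \<le> x" "cdf P x = 1 - \<epsilon>" by blast
  moreover have "x \<noteq> 0" using x c0 assms by auto
  ultimately show ?thesis by (intro exI[of _ x]) (auto simp: tail)
qed

end

section \<open>Limits and asymptotics of the quantiles\<close>

context one_sided_stable
begin

lemma outage_curve_less_iff:
  assumes "l > 0" "\<beta> > 0" "0 \<le> \<nu>" "0 \<le> \<nu>'"
  shows "outage_curve k l \<beta> \<nu> < outage_curve k l \<beta> \<nu>' \<longleftrightarrow> \<nu> < \<nu>'"
  using outage_curve_strict_mono[of l \<beta> \<nu> \<nu>' k] outage_curve_strict_mono[of l \<beta> \<nu>' \<nu> k] assms
  by (cases \<nu> \<nu>' rule: linorder_cases) auto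

text \<open>The limit solves the limiting equation with right-hand side \<epsilon>. At a fixed
  intensity on either side of it the limiting outage differs strictly from \<epsilon>, hence so do
  the curves eventually, and their monotonicity places \<open>q n\<close> on the correct side.
  Pointwise convergence is enough.\<close>

lemma outage_quantile_tendsto:
  fixes k :: "nat \<Rightarrow> nat" and l q :: "nat \<Rightarrow> real"
  assumes l: "filterlim l at_top sequentially" and m: "(\<lambda>n. (real (k n) + 1) / l n) \<longlonglongrightarrow> b"
    and \<beta>: "0 < \<beta>" "\<beta> < b" and \<xi>: "0 < \<xi>" "prob {\<xi><..} = \<epsilon>"
    and q: "\<forall>\<^sub>F n in sequentially. 0 < q n \<and> outage_curve (k n) (l n) \<beta> (q n) = \<epsilon>"
  shows "q \<longlonglongrightarrow> ((b - \<beta>) / \<beta> / \<xi>) powr \<delta>"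
proof (rule order_tendstoI)
  define t where "t = (b - \<beta>) / \<beta>"
  have t: "t > 0" using \<beta> by (simp add: t_def)
  define \<nu>0 where "\<nu>0 = (t / \<xi>) powr \<delta>"
  have \<nu>0: "\<nu>0 > 0" using t \<xi> by (simp add: \<nu>0_def)
  have \<nu>0_root: "t / \<nu>0 powr (1 / \<delta>) = \<xi>"
    using t \<xi> index by (simp add: \<nu>0_def powr_powr)
  have lpos: "\<forall>\<^sub>F n in sequentially. l n > 0" using l by (simp add: filterlim_at_top_dense)
  note lim = outage_curve_concentrates[OF l m \<beta>(1), folded t_def]
  {
    fix a assume a: "a < ((b - \<beta>) / \<beta> / \<xi>) powr \<delta>"
    \<comment> \<open>The given a may be nonpositive; raising it to half the limit keeps it below
      the limit and makes it an admissible intensity.\<close>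
    define \<nu> where "\<nu> = max a (\<nu>0 / 2)"
    have "a < \<nu>0" using a by (simp only: \<nu>0_def t_def)
    then have \<nu>: "0 < \<nu>" "\<nu> < \<nu>0" "a \<le> \<nu>" using \<nu>0 by (auto simp: \<nu>_def less_max_iff_disj)
    have "\<nu> powr (1 / \<delta>) < \<nu>0 powr (1 / \<delta>)" using \<nu> index by (intro powr_less_mono2) auto
    then have "\<xi> < t / \<nu> powr (1 / \<delta>)"
      unfolding \<nu>0_root[symmetric] using t \<nu> \<nu>0 by (intro divide_strict_left_mono) auto
    then have "prob {t / \<nu> powr (1 / \<delta>)<..} < \<epsilon>" using tail_strict_antimono \<xi> by auto
    from order_tendstoD(2)[OF lim[OF \<nu>(1)] this] lpos q
    show "\<forall>\<^sub>F n in sequentially. a < q n"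
    proof eventually_elim
      case (elim n)
      then have "\<nu> < q n" using outage_curve_less_iff[of "l n" \<beta> \<nu> "q n" "k n"] \<beta> \<nu> by auto
      then show ?case using \<nu> by simp
    qed
  next
    fix a assume "((b - \<beta>) / \<beta> / \<xi>) powr \<delta> < a"
    then have a: "\<nu>0 < a" by (simp only: \<nu>0_def t_def)
    have "\<nu>0 powr (1 / \<delta>) < a powr (1 / \<delta>)" using \<nu>0 a index by (intro powr_less_mono2) auto
    then have "t / a powr (1 / \<delta>) < \<xi>"
      unfolding \<nu>0_root[symmetric] using t \<nu>0 a by (intro divide_strict_left_mono) auto
    moreover have "0 < t / a powr (1 / \<delta>)" using t \<nu>0 a by simp
    ultimately have "\<epsilon> < prob {t / a powr (1 / \<delta>)<..}" using tail_strict_antimono \<xi> by auto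
    note e = this
    have a0: "0 < a" using a \<nu>0 by simp
    from order_tendstoD(1)[OF lim[OF a0] e] lpos q
    show "\<forall>\<^sub>F n in sequentially. q n < a"
    proof eventually_elim
      case (elim n)
      then show ?case using outage_curve_less_iff[of "l n" \<beta> "q n" a "k n"] \<beta> a0 by auto
    qed
  }
qed

text \<open>With b \<le> \<beta> the threshold for y is nonpositive, so the limiting outage is 1 at
  every positive intensity and overshoots \<epsilon>. This includes b = \<beta>, where the signal
  alone does not concentrate on one side. The value 0 is allowed for indices at which \<epsilon>
  does not exceed the floor.\<close>

lemma outage_quantile_tendsto_0:
  fixes k :: "nat \<Rightarrow> nat" and l q :: "nat \<Rightarrow> real"
  assumes l: "filterlim l at_top sequentially" and m: "(\<lambda>n. (real (k n) + 1) / l n) \<longlonglongrightarrow> b"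
    and \<beta>: "0 < \<beta>" "b \<le> \<beta>" and \<epsilon>: "\<epsilon> < 1"
    and q: "\<forall>\<^sub>F n in sequentially. q n = 0 \<or> 0 < q n \<and> outage_curve (k n) (l n) \<beta> (q n) = \<epsilon>"
  shows "q \<longlonglongrightarrow> 0"
proof (rule order_tendstoI)
  show "\<forall>\<^sub>F n in sequentially. a < q n" if "a < 0" for a
    using q by eventually_elim (use that in auto)
  fix a :: real assume a: "0 < a"
  have lpos: "\<forall>\<^sub>F n in sequentially. l n > 0" using l by (simp add: filterlim_at_top_dense)
  have "(b - \<beta>) / \<beta> / a powr (1 / \<delta>) \<le> 0" using \<beta> a by (simp add: divide_nonpos_pos)
  then have "AE y in P. y \<in> {(b - \<beta>) / \<beta> / a powr (1 / \<delta>)<..}"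
    using pos by (auto elim!: eventually_mono)
  then have "prob {(b - \<beta>) / \<beta> / a powr (1 / \<delta>)<..} = 1"
    by (subst prob_eq_1) auto
  then have "\<epsilon> < prob {(b - \<beta>) / \<beta> / a powr (1 / \<delta>)<..}" using \<epsilon> by simp
  from order_tendstoD(1)[OF outage_curve_concentrates[OF l m \<beta>(1) a] this] lpos q
  show "\<forall>\<^sub>F n in sequentially. q n < a"
  proof eventually_elim
    case (elim n)
    then show ?case using outage_curve_less_iff[of "l n" \<beta> "q n" a "k n"] \<beta> a by auto
  qed
qed

text \<open>Inversion of the tail expansion with error in \<epsilon> instead of x. A crude bound
  \<open>q \<le> 2 * G * \<epsilon>\<close> comes first and converts the error
  \<open>B * q\<^sup>2\<close> into a multiple of \<open>\<epsilon>\<^sup>2\<close>; this yields the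
  constant \<open>G * B * (2 * G)\<^sup>2\<close>, that is \<open>4 * G ^ 3 * B\<close>.\<close>

lemma tail_quantile_asymptotics:
  "\<exists>\<epsilon>0>0. \<exists>K. \<forall>\<epsilon> x. 0 < \<epsilon> \<longrightarrow> \<epsilon> < \<epsilon>0 \<longrightarrow> 0 < x \<longrightarrow> prob {x<..} = \<epsilon> \<longrightarrow>
    \<bar>x powr (- \<delta>) - Gamma (1 - \<delta>) * \<epsilon>\<bar> \<le> K * \<epsilon>\<^sup>2 \<and> x powr (- \<delta>) \<le> 2 * Gamma (1 - \<delta>) * \<epsilon>"
proof -
  define G where "G = Gamma (1 - \<delta>)"
  define B where "B = 2 / (G * (1 - \<delta>))"
  have G: "G > 0" using Gamma_pos by (simp add: G_def)
  have B: "B > 0" using G index by (simp add: B_def)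
  \<comment> \<open>From \<open>x0\<close> on, the error \<open>B * q\<^sup>2\<close> is at most
    half of the main term \<open>q / G\<close>. Levels \<epsilon> below the tail at
    \<open>x0\<close> have their quantile beyond \<open>x0\<close>.\<close>
  define x0 where "x0 = (1 / (2 * G * B)) powr (- (1 / \<delta>))"
  have x0: "x0 > 0" using G B by (simp add: x0_def)
  have x0_powr: "x0 powr (- \<delta>) = 1 / (2 * G * B)"
    using G B index by (simp add: x0_def powr_powr)
  have p0: "prob {x0<..} > 0"
    using tail_strict_antimono[of x0 "x0 + 1"] x0 measure_nonneg[of P "{x0 + 1<..}"] by linarith
  show ?thesis
  proof (rule exI[of _ "prob {x0<..}"], intro exI[of _ "4 * G ^ 3 * B"] conjI p0 allI impI)
    fix \<epsilon> x :: real assume *: "0 < \<epsilon>" "\<epsilon> < prob {x0<..}" "0 < x" "prob {x<..} = \<epsilon>"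
    define q where "q = x powr (- \<delta>)"
    have q: "q > 0" using * by (simp add: q_def)
    have "x0 < x"
    proof (rule ccontr)
      assume "\<not> x0 < x"
      then have "prob {x0<..} \<le> prob {x<..}" by (intro finite_measure_mono) auto
      then show False using * by simp
    qed
    then have "q \<le> x0 powr (- \<delta>)" unfolding q_def using x0 index by (intro powr_mono2') auto
    then have "B * q \<le> 1 / (2 * G)" using x0_powr G B by (simp add: field_simps)
    from mult_right_mono[OF this, of q] have Bq: "B * q\<^sup>2 \<le> q / (2 * G)"
      using q by (simp add: power2_eq_square mult.assoc)
    have t: "\<bar>\<epsilon> - q / G\<bar> \<le> B * q\<^sup>2"
      using tail_asymptotics[OF *(3)] *(4) by (simp add: q_def G_def B_def)
    then have "q / G - q / (2 * G) \<le> \<epsilon>" using Bq by linarith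
    then have q_le: "q \<le> 2 * G * \<epsilon>" using G by (simp add: field_simps)
    then show "x powr (- \<delta>) \<le> 2 * Gamma (1 - \<delta>) * \<epsilon>" by (simp add: q_def G_def)
    have "q - G * \<epsilon> = - (G * (\<epsilon> - q / G))" using G by (simp add: right_diff_distrib)
    then have "\<bar>q - G * \<epsilon>\<bar> = G * \<bar>\<epsilon> - q / G\<bar>"
      by (simp only: abs_minus_cancel abs_mult abs_of_pos[OF G])
    also have "\<dots> \<le> G * (B * q\<^sup>2)" using t G by (intro mult_left_mono) auto
    also have "\<dots> \<le> G * (B * (2 * G * \<epsilon>)\<^sup>2)"
      using q_le q G B by (intro mult_left_mono power_mono) auto
    also have "\<dots> = 4 * G ^ 3 * B * \<epsilon>\<^sup>2" by (simp add: power2_eq_square power3_eq_cube)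
    finally show "\<bar>x powr (- \<delta>) - Gamma (1 - \<delta>) * \<epsilon>\<bar> \<le> 4 * G ^ 3 * B * \<epsilon>\<^sup>2"
      by (simp add: q_def G_def)
  qed
qed

end

section \<open>The limiting capacity\<close>

text \<open>On positive intensities the outage is \<open>outage_curve\<close> at
  \<open>\<mu> * interference_rate \<alpha> \<rho> M\<close>, which is injective in \<mu>. The
  inverse therefore takes the value \<nu> divided by the rate, with \<nu> supplied by surjectivity
  above the floor.\<close>

lemma transmission_capacity_eq:
  assumes \<alpha>: "\<alpha> > 2" and \<rho>: "\<rho> > 0" and r: "r > 0" and \<beta>: "\<beta> > 0" and M: "M \<ge> 1"
    and rate: "interference_rate \<alpha> \<rho> M > 0" and P: "one_sided_stable P (2 / \<alpha>)"
    and model: "\<And>\<mu>. \<mu> > 0 \<Longrightarrow> zf_model (\<Omega> \<mu>) \<rho> r \<alpha> N M \<mu> (W \<mu>) (X \<mu>) (\<Psi> \<mu>)"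
    and \<epsilon>: "\<epsilon> < 1"
  defines "p \<equiv> erlang_CDF (N - M) (real M * r powr \<alpha> / \<rho>) \<beta>"
  shows "zf_outage_floor \<rho> r \<alpha> \<beta> N M = p"
    and "p < \<epsilon> \<Longrightarrow> \<exists>\<nu>>0. one_sided_stable.outage_curve P (2 / \<alpha>) (N - M) (real M * r powr \<alpha> / \<rho>) \<beta> \<nu> = \<epsilon> \<and>
      transmission_capacity M (zf_outage_floor \<rho> r \<alpha> \<beta> N M)
        (\<lambda>\<mu>. outage_prob (\<Omega> \<mu>) \<alpha> \<beta> (W \<mu>) (X \<mu>) (\<Psi> \<mu>)) \<epsilon> =
      real M * (\<nu> / interference_rate \<alpha> \<rho> M) * (1 - \<epsilon>)"
proof -
  interpret P: one_sided_stable P "2 / \<alpha>" by fact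
  let ?l = "real M * r powr \<alpha> / \<rho>" and ?C = "interference_rate \<alpha> \<rho> M"
  have l: "?l > 0" using \<rho> r M by simp
  show floor: "zf_outage_floor \<rho> r \<alpha> \<beta> N M = p"
    unfolding zf_outage_floor_def p_def gamma_density_def using l by (simp add: erlang_CDF_prob)
  have F: "outage_prob (\<Omega> \<mu>) \<alpha> \<beta> (W \<mu>) (X \<mu>) (\<Psi> \<mu>) = P.outage_curve (N - M) ?l \<beta> (\<mu> * ?C)" if "\<mu> > 0" for \<mu>
  proof -
    interpret zf_regime "\<Omega> \<mu>" \<rho> r \<alpha> N M \<mu> "W \<mu>" "X \<mu>" "\<Psi> \<mu>"
      using model[OF that] \<alpha> \<rho> r M that by (simp add: zf_regime_def zf_regime_axioms_def)
    show ?thesis using outage_prob_eq[OF \<beta> rate P] by (simp add: P.outage_curve_def)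
  qed
  assume p: "p < \<epsilon>"
  then obtain \<nu> where \<nu>: "\<nu> > 0" "P.outage_curve (N - M) ?l \<beta> \<nu> = \<epsilon>"
    using P.outage_curve_surj[OF l \<beta>] \<epsilon> unfolding p_def by blast
  have "the_inv_into {0<..} (\<lambda>\<mu>. outage_prob (\<Omega> \<mu>) \<alpha> \<beta> (W \<mu>) (X \<mu>) (\<Psi> \<mu>)) \<epsilon> = \<nu> / ?C"
  proof (rule the_inv_into_f_eq)
    show "inj_on (\<lambda>\<mu>. outage_prob (\<Omega> \<mu>) \<alpha> \<beta> (W \<mu>) (X \<mu>) (\<Psi> \<mu>)) {0<..}"
    proof (rule linorder_inj_onI')
      fix \<mu> \<mu>' :: real assume "\<mu> \<in> {0<..}" "\<mu>' \<in> {0<..}" "\<mu> < \<mu>'"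
      then show "outage_prob (\<Omega> \<mu>) \<alpha> \<beta> (W \<mu>) (X \<mu>) (\<Psi> \<mu>) \<noteq> outage_prob (\<Omega> \<mu>') \<alpha> \<beta> (W \<mu>') (X \<mu>') (\<Psi> \<mu>')"
        using P.outage_curve_strict_mono[OF l \<beta>, of "\<mu> * ?C" "\<mu>' * ?C" "N - M"] rate by (simp add: F)
    qed
    show "outage_prob (\<Omega> (\<nu> / ?C)) \<alpha> \<beta> (W (\<nu> / ?C)) (X (\<nu> / ?C)) (\<Psi> (\<nu> / ?C)) = \<epsilon>"
      using \<nu> rate by (simp add: F)
    show "\<nu> / ?C \<in> {0<..}" using \<nu> rate by simp
  qed
  then show "\<exists>\<nu>>0. P.outage_curve (N - M) ?l \<beta> \<nu> = \<epsilon> \<and>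
      transmission_capacity M (zf_outage_floor \<rho> r \<alpha> \<beta> N M)
        (\<lambda>\<mu>. outage_prob (\<Omega> \<mu>) \<alpha> \<beta> (W \<mu>) (X \<mu>) (\<Psi> \<mu>)) \<epsilon> =
      real M * (\<nu> / ?C) * (1 - \<epsilon>)"
    using \<nu> p by (intro exI[of _ \<nu>]) (simp add: transmission_capacity_def floor)
qed

theorem corollary7:
  fixes \<alpha> \<rho> r \<beta> \<kappa> :: real
    and M :: "nat \<Rightarrow> nat"
    and \<Omega> :: "nat \<Rightarrow> real \<Rightarrow> 'a measure"
    and W :: "nat \<Rightarrow> real \<Rightarrow> 'a \<Rightarrow> real"
    and X :: "nat \<Rightarrow> real \<Rightarrow> nat \<Rightarrow> 'a \<Rightarrow> real ^ 2"
    and \<Psi> :: "nat \<Rightarrow> real \<Rightarrow> nat \<Rightarrow> 'a \<Rightarrow> real"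
    and c :: "nat \<Rightarrow> real \<Rightarrow> real"
    and H :: "real \<Rightarrow> real"
  assumes "\<alpha> > 2" and "\<rho> > 0" and "r > 0" and "\<beta> > 0"
    and "0 < \<kappa>" and "\<kappa> < 1"
    and M: "\<And>N. \<bar>real (M N) - \<kappa> * real N\<bar> < 1"
    and model: "\<And>N \<mu>. M N \<ge> 1 \<Longrightarrow> \<mu> > 0 \<Longrightarrow>
      zf_model (\<Omega> N \<mu>) \<rho> r \<alpha> N (M N) \<mu> (W N \<mu>) (X N \<mu>) (\<Psi> N \<mu>)"
    and capacity: "\<And>N \<epsilon>. c N \<epsilon> =
      transmission_capacity (M N) (zf_outage_floor \<rho> r \<alpha> \<beta> N (M N))
        (\<lambda>\<mu>. outage_prob (\<Omega> N \<mu>) \<alpha> \<beta> (W N \<mu>) (X N \<mu>) (\<Psi> N \<mu>)) \<epsilon>"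
    and H_neg: "\<And>x. x < 0 \<Longrightarrow> H x = 0"
    and H_pos: "\<And>x. x > 0 \<Longrightarrow> H x = 1"
  shows "\<exists>L :: real \<Rightarrow> real.
    (\<forall>\<epsilon>\<in>{0<..<1}. (\<lambda>N. c N \<epsilon> / real N) \<longlonglongrightarrow> L \<epsilon>) \<and>
    (\<lambda>\<epsilon>. L \<epsilon> -
        \<kappa> * (r powr \<alpha> / \<rho>) powr (2 / \<alpha>) *
        (max (beta_bar_zf \<rho> r \<alpha> \<kappa> - \<beta>) 0) powr (2 / \<alpha>) *
        (max (\<epsilon> - H (\<beta> - beta_bar_zf \<rho> r \<alpha> \<kappa>)) 0 / (pi * r\<^sup>2 * \<beta> powr (2 / \<alpha>))))
      \<in> O[at (H (\<beta> - beta_bar_zf \<rho> r \<alpha> \<kappa>)) within {0<..<1}](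
          \<lambda>\<epsilon>. max ((\<epsilon> - H (\<beta> - beta_bar_zf \<rho> r \<alpha> \<kappa>))\<^sup>2) 0)"
proof -
  define \<delta> where "\<delta> = 2 / \<alpha>"
  define b where "b = beta_bar_zf \<rho> r \<alpha> \<kappa>"
  define R where "R = \<rho> powr \<delta> * (pi * Gamma (1 - \<delta>))"
  define C where "C N = interference_rate \<alpha> \<rho> (M N)" for N
  define l where "l N = real (M N) * r powr \<alpha> / \<rho>" for N
  have \<delta>: "0 < \<delta>" "\<delta> < 1" using \<open>\<alpha> > 2\<close> by (auto simp: \<delta>_def)
  have G: "Gamma (1 - \<delta>) > 0" using \<delta> by (intro Gamma_real_pos) simp
  have R: "R > 0" using \<open>\<rho> > 0\<close> G by (simp add: R_def)
  have M_ratio: "(\<lambda>N. real (M N) / real N) \<longlonglongrightarrow> \<kappa>"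
  proof (rule tendsto_sandwich)
    have "\<kappa> - 1 / real N = (\<kappa> * real N - 1) / real N" "\<kappa> + 1 / real N = (\<kappa> * real N + 1) / real N"
      if "0 < N" for N using that by (simp_all add: diff_divide_distrib add_divide_distrib)
    moreover have "\<kappa> * real N - 1 \<le> real (M N)" "real (M N) \<le> \<kappa> * real N + 1" for N using M[of N] by linarith+
    ultimately have "\<kappa> - 1 / real N \<le> real (M N) / real N" "real (M N) / real N \<le> \<kappa> + 1 / real N" if "0 < N" for N
      using that by (simp_all add: divide_right_mono)
    then show "\<forall>\<^sub>F N in sequentially. \<kappa> - 1 / real N \<le> real (M N) / real N"
      "\<forall>\<^sub>F N in sequentially. real (M N) / real N \<le> \<kappa> + 1 / real N"
      by (auto intro: eventually_mono[OF eventually_gt_at_top[of 0]])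
    show "(\<lambda>N. \<kappa> - 1 / real N) \<longlonglongrightarrow> \<kappa>" "(\<lambda>N. \<kappa> + 1 / real N) \<longlonglongrightarrow> \<kappa>" by real_asymp+
  qed
  have M_top: "filterlim (\<lambda>N. real (M N)) at_top sequentially"
  proof (rule filterlim_at_top_mono)
    show "filterlim (\<lambda>N. \<kappa> * real N - 1) at_top sequentially" using \<open>0 < \<kappa>\<close> by real_asymp
    show "\<forall>\<^sub>F N in sequentially. \<kappa> * real N - 1 \<le> real (M N)"
    proof (intro always_eventually allI)
      fix N show "\<kappa> * real N - 1 \<le> real (M N)" using M[of N] by linarith
    qed
  qed
  then have M_top': "filterlim M at_top sequentially"
    by (simp add: filterlim_sequentially_iff_filterlim_real)
  have M_ge: "\<forall>\<^sub>F N in sequentially. M N \<ge> 1"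
    using M_top' by (simp add: filterlim_at_top)
  have M_le: "\<forall>\<^sub>F N in sequentially. M N \<le> N"
    using order_tendstoD(2)[OF M_ratio \<open>\<kappa> < 1\<close>] eventually_gt_at_top[of 0]
    by eventually_elim (auto simp: field_simps)
  have l_top: "filterlim l at_top sequentially"
  proof -
    have "filterlim (\<lambda>N. r powr \<alpha> / \<rho> * real (M N)) at_top sequentially"
      using \<open>\<rho> > 0\<close> \<open>r > 0\<close> by (intro filterlim_tendsto_pos_mult_at_top[OF tendsto_const _ M_top]) simp
    then show ?thesis by (simp add: l_def[abs_def] mult.commute)
  qed
  \<comment> \<open>This is the mean of the signal: shape \<open>N - M N + 1\<close> divided by the
    rate. After division by N the extra 1 vanishes and \<open>(1 - \<kappa>) / \<kappa>\<close>
    remains.\<close>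
  have mean: "(\<lambda>N. (real (N - M N) + 1) / l N) \<longlonglongrightarrow> b"
  proof -
    have inv: "(\<lambda>N. 1 / real N) \<longlonglongrightarrow> 0" by real_asymp
    have "(\<lambda>N. \<rho> / r powr \<alpha> * ((1 - real (M N) / real N + 1 / real N) / (real (M N) / real N))) \<longlonglongrightarrow>
        \<rho> / r powr \<alpha> * ((1 - \<kappa> + 0) / \<kappa>)"
      using \<open>0 < \<kappa>\<close> by (intro tendsto_intros M_ratio inv) simp
    also have "\<rho> / r powr \<alpha> * ((1 - \<kappa> + 0) / \<kappa>) = b"
      using \<open>0 < \<kappa>\<close> by (simp add: b_def beta_bar_zf_def diff_divide_distrib)
    finally show ?thesis
    proof (rule Lim_transform_eventually)
      show "\<forall>\<^sub>F N in sequentially. \<rho> / r powr \<alpha> * ((1 - real (M N) / real N + 1 / real N) / (real (M N) / real N)) =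
          (real (N - M N) + 1) / l N"
        using M_ge M_le eventually_gt_at_top[of 0]
      proof eventually_elim
        case (elim N)
        then have "(1 - real (M N) / real N + 1 / real N) / (real (M N) / real N) = (real N - real (M N) + 1) / real (M N)"
          by (simp add: field_simps)
        then show ?case using elim by (simp add: l_def of_nat_diff mult.commute)
      qed
    qed
  qed
  have C_lim: "C \<longlonglongrightarrow> R"
    unfolding C_def[abs_def] R_def \<delta>_def
    by (rule filterlim_compose[OF interference_rate_tendsto M_top']) fact+
  have C_pos: "\<forall>\<^sub>F N in sequentially. C N > 0" by (rule order_tendstoD(1)[OF C_lim R])
  \<comment> \<open>Any antenna number with a stream and a positive interference rate can furnish
    the stable law; at intensity 1 its normalised interference is taken as P.\<close>
  obtain N0 where N0: "M N0 \<ge> 1" "C N0 > 0"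
    using eventually_happens[OF eventually_conj[OF M_ge C_pos]] by auto
  interpret zf_regime "\<Omega> N0 1" \<rho> r \<alpha> N0 "M N0" 1 "W N0 1" "X N0 1" "\<Psi> N0 1"
    using model[OF N0(1), of 1] assms(1-3) N0 by (simp add: zf_regime_def zf_regime_axioms_def)
  define P where "P = distr (\<Omega> N0 1) borel (\<lambda>\<omega>. interference \<omega> / (1 * C N0) powr (\<alpha> / 2))"
  have P: "one_sided_stable P (2 / \<alpha>)"
    unfolding P_def C_def using N0(2) by (intro one_sided_stable_interference) (simp add: C_def)
  interpret P: one_sided_stable P \<delta> using P by (simp add: \<delta>_def)
  \<comment> \<open>\<open>q N\<close> is the inverting intensity multiplied by \<open>C N\<close>.
    Setting it to 0 when \<epsilon> does not exceed the floor lets one formula cover both branches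
    of \<open>transmission_capacity\<close>.\<close>
  have cap: "\<exists>q. (\<forall>\<^sub>F N in sequentially. c N \<epsilon> = real (M N) * (q N / C N) * (1 - \<epsilon>) \<and>
      (if \<epsilon> \<le> erlang_CDF (N - M N) (l N) \<beta> then q N = 0
       else 0 < q N \<and> P.outage_curve (N - M N) (l N) \<beta> (q N) = \<epsilon>))"
    if \<epsilon>: "\<epsilon> < 1" for \<epsilon>
  proof -
    have "\<forall>\<^sub>F N in sequentially. \<exists>q. c N \<epsilon> = real (M N) * (q / C N) * (1 - \<epsilon>) \<and>
      (if \<epsilon> \<le> erlang_CDF (N - M N) (l N) \<beta> then q = 0
       else 0 < q \<and> P.outage_curve (N - M N) (l N) \<beta> q = \<epsilon>)"
      using M_ge C_pos
    proof eventually_elim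
      case (elim N)
      note eq = transmission_capacity_eq[OF assms(1-4) elim(1) elim(2)[unfolded C_def] P model[OF elim(1)] \<epsilon>]
      show ?case
      proof (cases "\<epsilon> \<le> erlang_CDF (N - M N) (l N) \<beta>")
        case True
        then show ?thesis
          by (intro exI[of _ 0]) (simp add: capacity eq(1) l_def transmission_capacity_def)
      next
        case False
        with eq(2) show ?thesis by (auto simp: capacity l_def C_def \<delta>_def not_le)
      qed
    qed
    then show ?thesis unfolding eventually_ex by simp
  qed
  have limit: "(\<lambda>N. c N \<epsilon> / real N) \<longlonglongrightarrow> \<kappa> * (q0 / R) * (1 - \<epsilon>)"
    if q: "\<forall>\<^sub>F N in sequentially. c N \<epsilon> = real (M N) * (q N / C N) * (1 - \<epsilon>)" and q0: "q \<longlonglongrightarrow> q0" for \<epsilon> q q0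
  proof (rule Lim_transform_eventually)
    show "(\<lambda>N. real (M N) / real N * (q N / C N) * (1 - \<epsilon>)) \<longlonglongrightarrow> \<kappa> * (q0 / R) * (1 - \<epsilon>)"
      using R by (intro tendsto_intros M_ratio q0 C_lim) simp
    show "\<forall>\<^sub>F N in sequentially. real (M N) / real N * (q N / C N) * (1 - \<epsilon>) = c N \<epsilon> / real N"
      using q by eventually_elim simp
  qed
  show ?thesis
  proof (cases "b \<le> \<beta>")
    \<comment> \<open>The claimed main term vanishes identically because the positive part of b -
      \<beta> is 0, so L = 0 gives remainder 0, whatever value H takes, including at 0 when b =
      \<beta>.\<close>
    case True
    have "(\<lambda>N. c N \<epsilon> / real N) \<longlonglongrightarrow> 0" if "\<epsilon> \<in> {0<..<1}" for \<epsilon>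
    proof -
      have \<epsilon>: "\<epsilon> < 1" using that by simp
      obtain q where q: "\<forall>\<^sub>F N in sequentially. c N \<epsilon> = real (M N) * (q N / C N) * (1 - \<epsilon>) \<and>
          (if \<epsilon> \<le> erlang_CDF (N - M N) (l N) \<beta> then q N = 0
           else 0 < q N \<and> P.outage_curve (N - M N) (l N) \<beta> (q N) = \<epsilon>)"
        using cap[OF \<epsilon>] by blast
      have "\<forall>\<^sub>F N in sequentially. q N = 0 \<or> 0 < q N \<and> P.outage_curve (N - M N) (l N) \<beta> (q N) = \<epsilon>"
        using q by eventually_elim (auto split: if_splits)
      then have "q \<longlonglongrightarrow> 0"
        by (rule P.outage_quantile_tendsto_0[OF l_top mean \<open>\<beta> > 0\<close> True \<epsilon>])
      from limit[OF _ this, of \<epsilon>] q show ?thesis by (simp add: eventually_conj_iff)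
    qed
    then show ?thesis
      using True by (intro exI[of _ "\<lambda>_. 0"]) (simp add: b_def[symmetric] max_absorb2)
  next
    case False
    then have \<beta>b: "\<beta> < b" by simp
    define t where "t = (b - \<beta>) / \<beta>"
    have t: "t > 0" using \<beta>b \<open>\<beta> > 0\<close> by (simp add: t_def)
    have H0: "H (\<beta> - beta_bar_zf \<rho> r \<alpha> \<kappa>) = 0" using \<beta>b by (intro H_neg) (simp add: b_def)
    obtain \<xi> where \<xi>: "\<And>\<epsilon>. 0 < \<epsilon> \<Longrightarrow> \<epsilon> < 1 \<Longrightarrow> \<xi> \<epsilon> > 0 \<and> P.prob {\<xi> \<epsilon><..} = \<epsilon>"
      using P.tail_quantile by metis
    \<comment> \<open>The limit formula evaluated at
      \<open>q0 = (t / \<xi> \<epsilon>) powr \<delta>\<close>, the intensity at which the limiting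
      outage threshold \<open>t / q0 powr (1 / \<delta>)\<close> equals the tail quantile
      \<open>\<xi> \<epsilon>\<close>.\<close>
    define L where "L \<epsilon> = \<kappa> * ((t / \<xi> \<epsilon>) powr \<delta> / R) * (1 - \<epsilon>)" for \<epsilon>
    define A where "A = \<kappa> * t powr \<delta> / R"
    have A: "A > 0" using \<open>0 < \<kappa>\<close> t R by (simp add: A_def)
    have "(\<lambda>N. c N \<epsilon> / real N) \<longlonglongrightarrow> L \<epsilon>" if "\<epsilon> \<in> {0<..<1}" for \<epsilon>
    proof -
      have \<epsilon>: "0 < \<epsilon>" "\<epsilon> < 1" using that by auto
      obtain q where q: "\<forall>\<^sub>F N in sequentially. c N \<epsilon> = real (M N) * (q N / C N) * (1 - \<epsilon>) \<and>
          (if \<epsilon> \<le> erlang_CDF (N - M N) (l N) \<beta> then q N = 0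
           else 0 < q N \<and> P.outage_curve (N - M N) (l N) \<beta> (q N) = \<epsilon>)"
        using cap[OF \<epsilon>(2)] by blast
      have "(\<lambda>N. erlang_CDF (N - M N) (l N) \<beta>) \<longlonglongrightarrow> 0"
        using erlang_CDF_concentrates(1)[OF l_top mean _ \<beta>b] \<open>\<beta> > 0\<close> by simp
      from order_tendstoD(2)[OF this \<epsilon>(1)] q
      have "\<forall>\<^sub>F N in sequentially. 0 < q N \<and> P.outage_curve (N - M N) (l N) \<beta> (q N) = \<epsilon>"
        by eventually_elim (auto split: if_splits)
      then have "q \<longlonglongrightarrow> (t / \<xi> \<epsilon>) powr \<delta>"
        unfolding t_def using \<xi>[OF \<epsilon>] by (intro P.outage_quantile_tendsto[OF l_top mean \<open>\<beta> > 0\<close> \<beta>b]) auto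
      from limit[OF _ this, of \<epsilon>] q show ?thesis by (simp add: eventually_conj_iff L_def)
    qed
    moreover have "(\<lambda>\<epsilon>. L \<epsilon> -
        \<kappa> * (r powr \<alpha> / \<rho>) powr (2 / \<alpha>) *
        (max (beta_bar_zf \<rho> r \<alpha> \<kappa> - \<beta>) 0) powr (2 / \<alpha>) *
        (max (\<epsilon> - H (\<beta> - beta_bar_zf \<rho> r \<alpha> \<kappa>)) 0 / (pi * r\<^sup>2 * \<beta> powr (2 / \<alpha>))))
      \<in> O[at (H (\<beta> - beta_bar_zf \<rho> r \<alpha> \<kappa>)) within {0<..<1}](
          \<lambda>\<epsilon>. max ((\<epsilon> - H (\<beta> - beta_bar_zf \<rho> r \<alpha> \<kappa>))\<^sup>2) 0)"
      unfolding H0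
    proof -
      obtain \<epsilon>0 K where \<epsilon>0: "\<epsilon>0 > 0" and K: "\<And>\<epsilon> x. 0 < \<epsilon> \<Longrightarrow> \<epsilon> < \<epsilon>0 \<Longrightarrow> 0 < x \<Longrightarrow> P.prob {x<..} = \<epsilon> \<Longrightarrow>
          \<bar>x powr (- \<delta>) - Gamma (1 - \<delta>) * \<epsilon>\<bar> \<le> K * \<epsilon>\<^sup>2 \<and> x powr (- \<delta>) \<le> 2 * Gamma (1 - \<delta>) * \<epsilon>"
        using P.tail_quantile_asymptotics by blast
      show "(\<lambda>\<epsilon>. L \<epsilon> - \<kappa> * (r powr \<alpha> / \<rho>) powr (2 / \<alpha>) * (max (beta_bar_zf \<rho> r \<alpha> \<kappa> - \<beta>) 0) powr (2 / \<alpha>) *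
          (max (\<epsilon> - 0) 0 / (pi * r\<^sup>2 * \<beta> powr (2 / \<alpha>)))) \<in> O[at 0 within {0<..<1}](\<lambda>\<epsilon>. max ((\<epsilon> - 0)\<^sup>2) 0)"
      \<comment> \<open>K bounds the quantile expansion, and \<open>2 * Gamma (1 - \<delta>)\<close>
        comes from the success factor \<open>1 - \<epsilon>\<close>, which contributes
        \<open>q * \<epsilon>\<close> with q of order \<epsilon>.\<close>
      proof (rule bigoI[where c="A * (K + 2 * Gamma (1 - \<delta>))"])
        have "\<forall>\<^sub>F \<epsilon> in at 0 within {0<..<1}. \<epsilon> \<in> {0<..<1} \<and> \<epsilon> < \<epsilon>0"
          unfolding eventually_at using \<epsilon>0 by (intro exI[of _ \<epsilon>0]) (auto simp: dist_real_def)
        then show "\<forall>\<^sub>F \<epsilon> in at 0 within {0<..<1}.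
          norm (L \<epsilon> - \<kappa> * (r powr \<alpha> / \<rho>) powr (2 / \<alpha>) * (max (beta_bar_zf \<rho> r \<alpha> \<kappa> - \<beta>) 0) powr (2 / \<alpha>) *
            (max (\<epsilon> - 0) 0 / (pi * r\<^sup>2 * \<beta> powr (2 / \<alpha>)))) \<le>
          A * (K + 2 * Gamma (1 - \<delta>)) * norm (max ((\<epsilon> - 0)\<^sup>2) 0)"
        proof eventually_elim
          case (elim \<epsilon>)
          then have \<epsilon>: "0 < \<epsilon>" "\<epsilon> < 1" "\<epsilon> < \<epsilon>0" by auto
          define q where "q = \<xi> \<epsilon> powr (- \<delta>)"
          note \<xi>\<epsilon> = \<xi>[OF \<epsilon>(1,2)]
          have q: "\<bar>q - Gamma (1 - \<delta>) * \<epsilon>\<bar> \<le> K * \<epsilon>\<^sup>2" "q \<le> 2 * Gamma (1 - \<delta>) * \<epsilon>" "0 < q"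
            using K[OF \<epsilon>(1,3)] \<xi>\<epsilon> by (auto simp: q_def)
          have L: "L \<epsilon> = A * q * (1 - \<epsilon>)"
            using \<xi>\<epsilon> t by (simp add: L_def A_def q_def powr_divide powr_minus_divide)
          \<comment> \<open>\<open>Gamma (1 - \<delta>)\<close> cancels against the one inside R and
            leaves the pi of the claim; \<open>r\<^sup>2\<close> cancels as well, since
            \<open>(r powr \<alpha>) powr (2 / \<alpha>)\<close> equals it.\<close>
          have main: "\<kappa> * (r powr \<alpha> / \<rho>) powr (2 / \<alpha>) * (max (beta_bar_zf \<rho> r \<alpha> \<kappa> - \<beta>) 0) powr (2 / \<alpha>) *
              (max (\<epsilon> - 0) 0 / (pi * r\<^sup>2 * \<beta> powr (2 / \<alpha>))) = A * (Gamma (1 - \<delta>) * \<epsilon>)"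
          proof -
            have "(r powr \<alpha> / \<rho>) powr (2 / \<alpha>) = r\<^sup>2 / \<rho> powr \<delta>"
              using \<open>r > 0\<close> \<open>\<rho> > 0\<close> \<open>\<alpha> > 2\<close> by (simp add: powr_divide powr_powr \<delta>_def)
            moreover have "(max (beta_bar_zf \<rho> r \<alpha> \<kappa> - \<beta>) 0) powr (2 / \<alpha>) = t powr \<delta> * \<beta> powr (2 / \<alpha>)"
              using \<beta>b \<open>\<beta> > 0\<close> by (simp add: t_def powr_divide \<delta>_def b_def max_absorb1)
            ultimately show ?thesis
              using \<epsilon> \<open>r > 0\<close> \<open>\<beta> > 0\<close> G by (simp add: A_def R_def max_absorb1)
          qed
          have "L \<epsilon> - A * (Gamma (1 - \<delta>) * \<epsilon>) = A * ((q - Gamma (1 - \<delta>) * \<epsilon>) - q * \<epsilon>)"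
            by (simp add: L algebra_simps)
          then have "\<bar>L \<epsilon> - A * (Gamma (1 - \<delta>) * \<epsilon>)\<bar> = A * \<bar>(q - Gamma (1 - \<delta>) * \<epsilon>) - q * \<epsilon>\<bar>"
            by (simp only: abs_mult abs_of_pos[OF A])
          also have "\<dots> \<le> A * (K * \<epsilon>\<^sup>2 + 2 * Gamma (1 - \<delta>) * \<epsilon> * \<epsilon>)"
          proof (rule mult_left_mono)
            have "\<bar>(q - Gamma (1 - \<delta>) * \<epsilon>) - q * \<epsilon>\<bar> \<le> \<bar>q - Gamma (1 - \<delta>) * \<epsilon>\<bar> + \<bar>q * \<epsilon>\<bar>"
              by (rule abs_triangle_ineq4)
            also have "\<bar>q * \<epsilon>\<bar> = q * \<epsilon>" using q \<epsilon> by simp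
            also have "q * \<epsilon> \<le> 2 * Gamma (1 - \<delta>) * \<epsilon> * \<epsilon>" using q \<epsilon> by (intro mult_right_mono) auto
            finally show "\<bar>(q - Gamma (1 - \<delta>) * \<epsilon>) - q * \<epsilon>\<bar> \<le> K * \<epsilon>\<^sup>2 + 2 * Gamma (1 - \<delta>) * \<epsilon> * \<epsilon>"
              using q(1) by simp
          qed (use A in simp)
          also have "\<dots> = A * (K + 2 * Gamma (1 - \<delta>)) * \<epsilon>\<^sup>2"
            by (simp add: power2_eq_square algebra_simps)
          finally show ?case unfolding main by (simp add: max_absorb1)
        qed
      qed
    qed
    ultimately show ?thesis by (intro exI[of _ L]) blast
  qed
qed

end
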